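(* Let $R$ and $C$ be the row and column operator spaces, respectively, and let $\theta,\gamma\in[0,1]$ be distinct. Then the interpolation operator space $(R,C)_\theta$ does not spherically-completely coarsely embed into $(R,C)_\gamma$.
   Context: An operator space is a closed linear subspace $X$ of $\mathcal{B}(H)$ for some complex Hilbert space $H$. For $n\in\mathbb{N}$, $\mathrm{M}_n(X)$ is the space of $n\times n$ matrices over $X$ with the norm inherited from $\mathrm{M}_n(\mathcal{B}(H))\cong\mathcal{B}(H^{\oplus n})$. For a (not necessarily linear) map $f\colon X\to Y$, its $n$-th amplification is $f_n\colon\mathrm{M}_n(X)\to\mathrm{M}_n(Y)$, $f_n([x_{ij}])=[f(x_{ij})]$. $\partial B_E$ denotes the unit sphere of a Banach space $E$. A sequence $\bar f=(F^n\colon A_n\to B_n)_n$ of maps between metric spaces $(A_n,d_n)$, $(B_n,\partial_n)$ is an equi-coarse embedding (the maps are equi-coarse embeddings) if $\omega_{\bar f}(t)<\infty$ for all $t\ge 0$ and $\lim_{t\to\infty}\rho_{\bar f}(t)=\infty$, where $\omega_{\bar f}(t)=\sup_n\sup\{\partial_n(F^n(x),F^n(y))\mid d_n(x,y)\le t\}$ and $\rho_{\bar f}(t)=\inf_n\inf\{\partial_n(F^n(x),F^n(y))\mid d_n(x,y)\ge t\}$ (with $\inf\emptyset=\infty$). A map $F\colon\mathrm{M}_n(X)\to\mathrm{M}_n(Y)$ is a spherical amplification if for all $r\ge 0$ there is a map $f\colon X\to Y$ with $F\restriction_{r\cdot\partial B_{\mathrm{M}_n(X)}}=f_n\restriction_{r\cdot\partial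 B_{\mathrm{M}_n(X)}}$. The operator space $X$ spherically-completely coarsely embeds into $Y$ if there is a sequence $(F^n\colon\mathrm{M}_n(X)\to\mathrm{M}_n(Y))_n$ of spherical amplifications which are equi-coarse embeddings. Let $e_{i,j}\in\mathcal{B}(\ell_2)$ be the operator whose $(i,j)$-coordinate is $1$ and all others are $0$. Then $R=\overline{\mathrm{span}}\{e_{1,j}\mid j\in\mathbb{N}\}$ and $C=\overline{\mathrm{span}}\{e_{j,1}\mid j\in\mathbb{N}\}$. For $\theta\in[0,1]$, $(R,C)_\theta$ is the complex $\theta$-interpolation space of $R$ and $C$, both regarded as embedded in $\ell_2$ via the canonical linear isometries, with operator space structure given by $\mathrm{M}_n((R,C)_\theta)=(\mathrm{M}_n(R),\mathrm{M}_n(C))_\theta$ for all $n$; in particular $(R,C)_0=R$ and $(R,C)_1=C$ completely isometrically. *)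

theory Defs
  imports "HOL-Analysis.Analysis" "Jordan_Normal_Form.Matrix"
begin

no_notation scalar_prod (infix "\<bullet>" 70)

section \<open>Complex normed spaces and complex Hilbert spaces\<close>

class scaleC =
  fixes scaleC :: "complex \<Rightarrow> 'a \<Rightarrow> 'a" (infixr "*\<^sub>C" 75)

class complex_normed_vector = scaleC + real_normed_vector +
  assumes scaleC_add_right: "c *\<^sub>C (x + y) = c *\<^sub>C x + c *\<^sub>C y"
    and scaleC_add_left: "(c + d) *\<^sub>C x = c *\<^sub>C x + d *\<^sub>C x"
    and scaleC_scaleC: "c *\<^sub>C d *\<^sub>C x = (c * d) *\<^sub>C x"
    and scaleC_of_real: "complex_of_real r *\<^sub>C x = r *\<^sub>R x"
    and norm_scaleC: "norm (c *\<^sub>C x) = cmod c * norm x"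

text \<open>
  The class operation \<open>\<bullet>\<close> is the real part of the complex inner product. Since multiplication by
  \<open>\<i>\<close> is isometric, the complex inner product is recovered by polarisation, so that this class
  describes exactly the complex Hilbert spaces.
\<close>

class complex_hilbert = complex_normed_vector + real_inner + complete_space

global_interpretation complex_vector:
  vector_space "scaleC :: complex \<Rightarrow> 'a \<Rightarrow> 'a :: complex_normed_vector"
proof
  fix x :: 'a
  show "1 *\<^sub>C x = x"
    using scaleC_of_real[of 1 x] by simp
qed (simp_all add: scaleC_add_right scaleC_add_left scaleC_scaleC)

lemma bounded_linear_scaleC: "bounded_linear (\<lambda>x::'a::complex_normed_vector. c *\<^sub>C x)"
proof (rule bounded_linear_intro[of _ "cmod c"])
  fix r :: real and x :: 'a
  show "c *\<^sub>C (r *\<^sub>R x) = r *\<^sub>R (c *\<^sub>C x)"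
    by (simp add: scaleC_of_real[symmetric] scaleC_scaleC mult.commute)
qed (simp_all add: scaleC_add_right norm_scaleC mult.commute)

instantiation blinfun :: (real_normed_vector, complex_normed_vector) complex_normed_vector
begin

lift_definition scaleC_blinfun :: "complex \<Rightarrow> 'a \<Rightarrow>\<^sub>L 'b \<Rightarrow> 'a \<Rightarrow>\<^sub>L 'b"
  is "\<lambda>c T x. c *\<^sub>C T x"
  by (rule bounded_linear_compose[OF bounded_linear_scaleC])

instance
proof
  fix c d :: complex and r :: real and S T :: "'a \<Rightarrow>\<^sub>L 'b"
  show "c *\<^sub>C (S + T) = c *\<^sub>C S + c *\<^sub>C T"
    by transfer (simp add: scaleC_add_right)
  show "(c + d) *\<^sub>C T = c *\<^sub>C T + d *\<^sub>C T"
    by transfer (simp add: scaleC_add_left)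
  show assoc: "c *\<^sub>C d *\<^sub>C T = (c * d) *\<^sub>C T" for c d and T :: "'a \<Rightarrow>\<^sub>L 'b"
    by transfer (simp add: scaleC_scaleC)
  show scaleR: "complex_of_real r *\<^sub>C T = r *\<^sub>R T" for r and T :: "'a \<Rightarrow>\<^sub>L 'b"
    by transfer (simp add: scaleC_of_real)
  have le: "norm (e *\<^sub>C U) \<le> cmod e * norm U" for e and U :: "'a \<Rightarrow>\<^sub>L 'b"
  proof (rule norm_blinfun_bound)
    fix x
    show "norm (blinfun_apply (e *\<^sub>C U) x) \<le> cmod e * norm U * norm x"
      using mult_left_mono[OF norm_blinfun[of U x], of "cmod e"]
      by (simp add: scaleC_blinfun.rep_eq norm_scaleC mult.assoc)
  qed simp
  show "norm (c *\<^sub>C T) = cmod c * norm T"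
  proof (cases "c = 0")
    case True
    then show ?thesis using le[of c T] by simp
  next
    case False
    have "inverse c *\<^sub>C c *\<^sub>C T = 1 *\<^sub>R T"
      unfolding assoc using False scaleR[of 1 T] by simp
    then have "norm T \<le> cmod (inverse c) * norm (c *\<^sub>C T)"
      using le[of "inverse c" "c *\<^sub>C T"] by simp
    then have "cmod c * norm T \<le> norm (c *\<^sub>C T)"
      using False by (simp add: norm_divide field_simps)
    with le[of c T] show ?thesis by simp
  qed
qed

end


section \<open>The Hilbert space of square-summable sequences\<close>

typedef ell2 = "{x :: nat \<Rightarrow> complex. summable (\<lambda>i. (cmod (x i))\<^sup>2)}"
  morphisms coord Abs_ell2
  by (rule exI[of _ "\<lambda>_. 0"]) simp

setup_lifting type_definition_ell2

lemma summable_coord: "summable (\<lambda>i. (cmod (coord x i))\<^sup>2)"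
  using coord[of x] by simp

lemma summable_inner_ell2:
  fixes x y :: "nat \<Rightarrow> complex"
  assumes "summable (\<lambda>i. (cmod (x i))\<^sup>2)" "summable (\<lambda>i. (cmod (y i))\<^sup>2)"
  shows "summable (\<lambda>i. x i \<bullet> y i)"
proof (rule summable_comparison_test')
  show "summable (\<lambda>i. (cmod (x i))\<^sup>2 + (cmod (y i))\<^sup>2)"
    using assms by (rule summable_add)
  fix i
  have "\<bar>x i \<bullet> y i\<bar> \<le> cmod (x i) * cmod (y i)"
    by (rule Cauchy_Schwarz_ineq2)
  also have "\<dots> \<le> (cmod (x i))\<^sup>2 + (cmod (y i))\<^sup>2"
    using sum_squares_bound[of "cmod (x i)" "cmod (y i)"]
      mult_nonneg_nonneg[OF norm_ge_zero[of "x i"] norm_ge_zero[of "y i"]]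
    by linarith
  finally show "norm (x i \<bullet> y i) \<le> (cmod (x i))\<^sup>2 + (cmod (y i))\<^sup>2" by simp
qed

lemma summable_add_ell2:
  fixes x y :: "nat \<Rightarrow> complex"
  assumes "summable (\<lambda>i. (cmod (x i))\<^sup>2)" "summable (\<lambda>i. (cmod (y i))\<^sup>2)"
  shows "summable (\<lambda>i. (cmod (x i + y i))\<^sup>2)"
proof -
  have "(cmod (x i + y i))\<^sup>2 = (cmod (x i))\<^sup>2 + 2 * (x i \<bullet> y i) + (cmod (y i))\<^sup>2" for i
    by (simp add: power2_norm_eq_inner inner_add_left inner_add_right inner_commute)
  then show ?thesis
    using summable_add[OF summable_add[OF assms(1) summable_mult[OF summable_inner_ell2[OF assms], of 2]] assms(2)]
    by simp
qed

lemma summable_scale_ell2: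
  "summable (\<lambda>i. (cmod (x i))\<^sup>2) \<Longrightarrow> summable (\<lambda>i. (cmod (c * x i))\<^sup>2)"
  by (simp add: norm_mult power_mult_distrib summable_mult)

instantiation ell2 :: "{complex_normed_vector, real_inner}"
begin

lift_definition zero_ell2 :: ell2 is "\<lambda>_. 0" by simp

lift_definition plus_ell2 :: "ell2 \<Rightarrow> ell2 \<Rightarrow> ell2" is "\<lambda>x y i. x i + y i"
  by (rule summable_add_ell2)

lift_definition scaleC_ell2 :: "complex \<Rightarrow> ell2 \<Rightarrow> ell2" is "\<lambda>c x i. c * x i"
  by (rule summable_scale_ell2)

lift_definition uminus_ell2 :: "ell2 \<Rightarrow> ell2" is "\<lambda>x i. - x i" by simp

lift_definition minus_ell2 :: "ell2 \<Rightarrow> ell2 \<Rightarrow> ell2" is "\<lambda>x y i. x i - y i"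
  using summable_add_ell2[of _ "\<lambda>i. - _ i"] by simp

definition scaleR_ell2 :: "real \<Rightarrow> ell2 \<Rightarrow> ell2"
  where "scaleR_ell2 r x = complex_of_real r *\<^sub>C x"

lift_definition inner_ell2 :: "ell2 \<Rightarrow> ell2 \<Rightarrow> real" is "\<lambda>x y. \<Sum>i. x i \<bullet> y i" .

definition norm_ell2 :: "ell2 \<Rightarrow> real"
  where "norm_ell2 x = sqrt (\<Sum>i. (cmod (coord x i))\<^sup>2)"

definition sgn_ell2 :: "ell2 \<Rightarrow> ell2"
  where "sgn_ell2 x = inverse (norm x) *\<^sub>R x"

definition dist_ell2 :: "ell2 \<Rightarrow> ell2 \<Rightarrow> real"
  where "dist_ell2 x y = norm (x - y)"

definition uniformity_ell2 :: "(ell2 \<times> ell2) filter"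
  where "uniformity_ell2 = (INF e\<in>{0<..}. principal {(x, y). dist x y < e})"

definition open_ell2 :: "ell2 set \<Rightarrow> bool"
  where "open_ell2 U \<longleftrightarrow> (\<forall>x\<in>U. eventually (\<lambda>(x', y). x' = x \<longrightarrow> y \<in> U) uniformity)"

lemma inner_self_ell2: "x \<bullet> x = (\<Sum>i. (cmod (coord x i))\<^sup>2)" for x :: ell2
  by transfer (simp add: power2_norm_eq_inner)

lemma coord_scaleR: "coord (r *\<^sub>R x) i = complex_of_real r * coord x i"
  by (simp add: scaleR_ell2_def scaleC_ell2.rep_eq)

lemma ell2_eqI: "(\<And>i. coord x i = coord y i) \<Longrightarrow> x = y"
  by (metis coord_inject ext)

instance
proof
  fix a b :: real and c d :: complex and x y z :: ell2
  show "x + y + z = x + (y + z)" "x + y = y + x" "0 + x = x" "- x + x = 0" "x - y = x + - y"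
    by (transfer; simp add: fun_eq_iff add.assoc add.commute)+
  show "a *\<^sub>R (x + y) = a *\<^sub>R x + a *\<^sub>R y" "(a + b) *\<^sub>R x = a *\<^sub>R x + b *\<^sub>R x"
    "a *\<^sub>R b *\<^sub>R x = (a * b) *\<^sub>R x" "1 *\<^sub>R x = x"
    unfolding scaleR_ell2_def by (transfer; simp add: fun_eq_iff algebra_simps)+
  show "c *\<^sub>C (x + y) = c *\<^sub>C x + c *\<^sub>C y" "(c + d) *\<^sub>C x = c *\<^sub>C x + d *\<^sub>C x"
    "c *\<^sub>C d *\<^sub>C x = (c * d) *\<^sub>C x"
    by (transfer; simp add: fun_eq_iff algebra_simps)+
  show "complex_of_real a *\<^sub>C x = a *\<^sub>R x"
    by (simp add: scaleR_ell2_def)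
  show "norm (c *\<^sub>C x) = cmod c * norm x"
    by (simp add: norm_ell2_def scaleC_ell2.rep_eq norm_mult power_mult_distrib
        suminf_mult[OF summable_coord] real_sqrt_mult)
  show "dist x y = norm (x - y)" by (rule dist_ell2_def)
  show "sgn x = inverse (norm x) *\<^sub>R x" by (rule sgn_ell2_def)
  show "uniformity = (INF e\<in>{0<..}. principal {(x, y :: ell2). dist x y < e})"
    by (rule uniformity_ell2_def)
  show "open U \<longleftrightarrow> (\<forall>x\<in>U. \<forall>\<^sub>F (x', y) in uniformity. x' = x \<longrightarrow> y \<in> U)" for U :: "ell2 set"
    by (rule open_ell2_def)
  show "x \<bullet> y = y \<bullet> x"
    by transfer (simp add: inner_commute)
  show add: "(x + y) \<bullet> z = x \<bullet> z + y \<bullet> z" for x y z :: ell2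
    by transfer (simp add: inner_add_left suminf_add[OF summable_inner_ell2 summable_inner_ell2])
  show "a *\<^sub>R x \<bullet> y = a * (x \<bullet> y)"
    unfolding scaleR_ell2_def
    by transfer (simp add: suminf_mult[OF summable_inner_ell2, symmetric]
        scaleR_conv_of_real[symmetric])
  show "0 \<le> x \<bullet> x"
    by (simp add: inner_self_ell2 suminf_nonneg[OF summable_coord])
  show "x \<bullet> x = 0 \<longleftrightarrow> x = 0"
    unfolding inner_self_ell2 suminf_eq_zero_iff[OF summable_coord zero_le_power2]
    by transfer (simp add: fun_eq_iff)
  show "norm x = sqrt (x \<bullet> x)"
    by (simp add: norm_ell2_def inner_self_ell2)
  show "norm x = 0 \<longleftrightarrow> x = 0"
    unfolding norm_ell2_def real_sqrt_eq_0_iff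
      suminf_eq_zero_iff[OF summable_coord zero_le_power2]
    by transfer (simp add: fun_eq_iff)
  show "norm (a *\<^sub>R x) = \<bar>a\<bar> * norm x"
    by (simp add: norm_ell2_def coord_scaleR norm_mult power_mult_distrib
        suminf_mult[OF summable_coord] real_sqrt_mult)
  show "norm (x + y) \<le> norm x + norm y"
  proof -
    have le: "sqrt (\<Sum>i<n. (cmod (coord (x + y) i))\<^sup>2) \<le> norm x + norm y" for n
    proof -
      have "sqrt (\<Sum>i<n. (cmod (coord (x + y) i))\<^sup>2)
        = L2_set (\<lambda>i. cmod (coord x i + coord y i)) {..<n}"
        by (simp add: L2_set_def plus_ell2.rep_eq)
      also have "\<dots> \<le> L2_set (\<lambda>i. cmod (coord x i) + cmod (coord y i)) {..<n}"
        by (rule L2_set_mono) (simp_all add: norm_triangle_ineq)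
      also have "\<dots> \<le> L2_set (\<lambda>i. cmod (coord x i)) {..<n} + L2_set (\<lambda>i. cmod (coord y i)) {..<n}"
        by (rule L2_set_triangle_ineq)
      also have "\<dots> \<le> norm x + norm y"
        unfolding L2_set_def norm_ell2_def
        by (intro add_mono real_sqrt_le_mono sum_le_suminf summable_coord) auto
      finally show ?thesis .
    qed
    have "(\<lambda>n. sqrt (\<Sum>i<n. (cmod (coord (x + y) i))\<^sup>2)) \<longlonglongrightarrow> norm (x + y)"
      unfolding norm_ell2_def
      by (intro tendsto_real_sqrt summable_LIMSEQ summable_coord)
    then show ?thesis by (rule LIMSEQ_le_const2) (use le in auto)
  qed
qed

end

instance ell2 :: complex_hilbert
proof
  fix X :: "nat \<Rightarrow> ell2"
  have norm_sub: "norm (x - y) = sqrt (\<Sum>i. (cmod (coord x i - coord y i))\<^sup>2)" for x y :: ell2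
    by (simp add: norm_ell2_def minus_ell2.rep_eq)
  have summ_sub: "summable (\<lambda>i. (cmod (coord x i - coord y i))\<^sup>2)" for x y
    using summable_coord[of "x - y"] by (simp add: minus_ell2.rep_eq)
  assume "Cauchy X"
  then have cau: "\<exists>M. \<forall>m\<ge>M. \<forall>n\<ge>M. norm (X m - X n) < e" if "e > 0" for e
    using that \<open>Cauchy X\<close> by (simp add: Cauchy_def dist_ell2_def)
  have coord_le: "cmod (coord x i - coord y i) \<le> norm (x - y)" for x y i
    unfolding norm_sub
    using sum_le_suminf[OF summ_sub, of "{i}" x y]
    by (intro real_le_rsqrt) auto
  have "Cauchy (\<lambda>n. coord (X n) i)" for i
    unfolding Cauchy_def dist_norm by (meson cau coord_le le_less_trans)
  then have "\<exists>l. (\<lambda>n. coord (X n) i) \<longlonglongrightarrow> l" for i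
    by (simp add: Cauchy_convergent_iff convergent_def)
  then obtain l where l: "\<And>i. (\<lambda>n. coord (X n) i) \<longlonglongrightarrow> l i" by metis
  have part: "summable (\<lambda>i. (cmod (coord (X m) i - l i))\<^sup>2)
      \<and> (\<Sum>i. (cmod (coord (X m) i - l i))\<^sup>2) \<le> e\<^sup>2"
    if M: "\<forall>m\<ge>M. \<forall>n\<ge>M. norm (X m - X n) < e" and "m \<ge> M" "e > 0" for M m e
  proof -
    have bd: "(\<Sum>i<k. (cmod (coord (X m) i - l i))\<^sup>2) \<le> e\<^sup>2" for k
    proof (rule LIMSEQ_le_const2)
      show "(\<lambda>n. \<Sum>i<k. (cmod (coord (X m) i - coord (X n) i))\<^sup>2)
          \<longlonglongrightarrow> (\<Sum>i<k. (cmod (coord (X m) i - l i))\<^sup>2)"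
        by (intro tendsto_intros l)
      have "(\<Sum>i<k. (cmod (coord (X m) i - coord (X n) i))\<^sup>2) \<le> e\<^sup>2" if "n \<ge> M" for n
      proof -
        have "(\<Sum>i<k. (cmod (coord (X m) i - coord (X n) i))\<^sup>2)
            \<le> (\<Sum>i. (cmod (coord (X m) i - coord (X n) i))\<^sup>2)"
          by (intro sum_le_suminf summ_sub) auto
        also have "\<dots> = (norm (X m - X n))\<^sup>2"
          unfolding norm_sub by (simp add: suminf_nonneg[OF summ_sub])
        also have "\<dots> \<le> e\<^sup>2"
          using M \<open>m \<ge> M\<close> that by (intro power_mono) (auto simp: norm_ell2_def suminf_nonneg[OF summable_coord] less_imp_le)
        finally show ?thesis .
      qed
      then show "\<exists>N. \<forall>n\<ge>N. (\<Sum>i<k. (cmod (coord (X m) i - coord (X n) i))\<^sup>2) \<le> e\<^sup>2" by blast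
    qed
    have s: "summable (\<lambda>i. (cmod (coord (X m) i - l i))\<^sup>2)"
      by (rule summableI_nonneg_bounded[OF _ bd]) simp
    then show ?thesis using suminf_le_const[OF s bd] by blast
  qed
  have "summable (\<lambda>i. (cmod (l i))\<^sup>2)"
  proof -
    obtain M where "\<forall>m\<ge>M. \<forall>n\<ge>M. norm (X m - X n) < 1" using cau[of 1] by auto
    from part[OF this order_refl] have "summable (\<lambda>i. (cmod (coord (X M) i - l i))\<^sup>2)" by simp
    then have "summable (\<lambda>i. (cmod (l i - coord (X M) i))\<^sup>2)" by (simp add: norm_minus_commute)
    from summable_add_ell2[OF this summable_coord[of "X M"]] show ?thesis by simp
  qed
  then have cl: "coord (Abs_ell2 l) = l" by (simp add: Abs_ell2_inverse)
  have "X \<longlonglongrightarrow> Abs_ell2 l"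
  proof -
    have "\<exists>M. \<forall>m\<ge>M. norm (X m - Abs_ell2 l) < e" if "e > 0" for e
    proof -
      obtain M where M: "\<forall>m\<ge>M. \<forall>n\<ge>M. norm (X m - X n) < e / 2" using cau[OF half_gt_zero[OF \<open>e > 0\<close>]] by blast
      have "norm (X m - Abs_ell2 l) < e" if "m \<ge> M" for m
      proof -
        have "norm (X m - Abs_ell2 l) \<le> sqrt ((e / 2)\<^sup>2)"
          unfolding norm_sub cl using part[OF M that] \<open>e > 0\<close> by (intro real_sqrt_le_mono) simp
        then show ?thesis using \<open>e > 0\<close> by simp
      qed
      then show ?thesis by blast
    qed
    then show ?thesis
      unfolding LIMSEQ_def dist_ell2_def by blast
  qed
  then show "convergent X" by (auto simp: convergent_def)
qed


section \<open>Operator spaces and matrix norms\<close>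

definition matrices :: "nat \<Rightarrow> 'a set \<Rightarrow> 'a mat set"
  where "matrices n X = {A \<in> carrier_mat n n. elements_mat A \<subseteq> X}"

text \<open>
  The type \<open>'h \<Rightarrow>\<^sub>L 'h\<close> consists of real-linear operators; \<open>B(H)\<close> is its subspace of
  complex-linear ones, on which the operator norm is the library norm.
\<close>

definition complex_linear :: "('h::complex_hilbert \<Rightarrow>\<^sub>L 'h) \<Rightarrow> bool"
  where "complex_linear T \<longleftrightarrow> (\<forall>c x. blinfun_apply T (c *\<^sub>C x) = c *\<^sub>C blinfun_apply T x)"

definition operator_space :: "('h::complex_hilbert \<Rightarrow>\<^sub>L 'h) set \<Rightarrow> bool"
  where "operator_space X \<longleftrightarrow> complex_vector.subspace X \<and> closed X \<and> (\<forall>T\<in>X. complex_linear T)"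

text \<open>The norm of an operator matrix acting between finite Hilbert space direct sums.\<close>

definition operator_matrix_norm :: "('h::complex_hilbert \<Rightarrow>\<^sub>L 'h) mat \<Rightarrow> real"
  where "operator_matrix_norm A =
    (SUP x \<in> {x. (\<Sum>j<dim_col A. (norm (x j))\<^sup>2) \<le> 1}.
      sqrt (\<Sum>i<dim_row A. (norm (\<Sum>j<dim_col A. blinfun_apply (A $$ (i, j)) (x j)))\<^sup>2))"

text \<open>
  An operator space structure: a space together with the norms of all the \<open>M\<^sub>n(X)\<close>. The size
  \<open>n\<close> is read off from the matrix, so one function covers all of them.
\<close>

record 'a matrix_normed =
  points :: "'a set"
  mat_norm :: "'a mat \<Rightarrow> real"

definition point_norm :: "'a matrix_normed \<Rightarrow> 'a \<Rightarrow> real"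
  where "point_norm X x = mat_norm X (mat 1 1 (\<lambda>_. x))"

definition mat_dist :: "'a::minus matrix_normed \<Rightarrow> 'a mat \<Rightarrow> 'a mat \<Rightarrow> real"
  where "mat_dist X A B = mat_norm X (A - B)"

definition concrete :: "('h::complex_hilbert \<Rightarrow>\<^sub>L 'h) set \<Rightarrow> ('h \<Rightarrow>\<^sub>L 'h) matrix_normed"
  where "concrete X = \<lparr>points = X, mat_norm = operator_matrix_norm\<rparr>"

text \<open>Transport of the structure along a map that is injective on the space.\<close>

definition transport :: "('a \<Rightarrow> 'b) \<Rightarrow> 'a matrix_normed \<Rightarrow> 'b matrix_normed"
  where "transport \<iota> X =
    \<lparr>points = \<iota> ` points X,
     mat_norm = (\<lambda>A. mat_norm X (map_mat (inv_into (points X) \<iota>) A))\<rparr>"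


section \<open>Complex interpolation\<close>

text \<open>
  Calderon's method for a couple \<open>(X\<^sub>0, N\<^sub>0)\<close>, \<open>(X\<^sub>1, N\<^sub>1)\<close> of complex Banach spaces which are
  subspaces of a common vector space. The ambient type only carries the operations, because it
  will also be instantiated with a matrix type, which is a vector space only after fixing the size.
  As in Calderon's original definition, boundary values are required to vanish at infinity;
  asking only for bounded boundary values gives the same spaces and norms. The definition is used
  verbatim for \<open>\<theta> = 0\<close> and \<open>\<theta> = 1\<close>; if \<open>X\<^sub>0\<close> and \<open>X\<^sub>1\<close> coincide as sets, it returns the
  endpoint spaces isometrically there.
\<close>

instantiation mat :: (scaleC) scaleC
begin

definition scaleC_mat :: "complex \<Rightarrow> 'a mat \<Rightarrow> 'a mat"
  where "scaleC_mat c = map_mat (scaleC c)"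

instance ..

end

definition strip :: "complex set"
  where "strip = {z. 0 \<le> Re z \<and> Re z \<le> 1}"

definition sum_space :: "'v::plus set \<Rightarrow> 'v set \<Rightarrow> 'v set"
  where "sum_space X\<^sub>0 X\<^sub>1 = {a + b | a b. a \<in> X\<^sub>0 \<and> b \<in> X\<^sub>1}"

definition sum_norm ::
  "'v::plus set \<Rightarrow> ('v \<Rightarrow> real) \<Rightarrow> 'v set \<Rightarrow> ('v \<Rightarrow> real) \<Rightarrow> 'v \<Rightarrow> real"
  where "sum_norm X\<^sub>0 N\<^sub>0 X\<^sub>1 N\<^sub>1 x = Inf {N\<^sub>0 a + N\<^sub>1 b | a b. a \<in> X\<^sub>0 \<and> b \<in> X\<^sub>1 \<and> x = a + b}"

definition boundary_function :: "'v::minus set \<Rightarrow> ('v \<Rightarrow> real) \<Rightarrow> (real \<Rightarrow> 'v) \<Rightarrow> bool"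
  where "boundary_function X N g \<longleftrightarrow>
    (\<forall>t. g t \<in> X) \<and>
    (\<forall>t. ((\<lambda>s. N (g s - g t)) \<longlongrightarrow> 0) (at t)) \<and>
    ((\<lambda>t. N (g t)) \<longlongrightarrow> 0) at_infinity"

definition calderon_functions ::
  "'v::{plus,minus,scaleC} set \<Rightarrow> ('v \<Rightarrow> real) \<Rightarrow> 'v set \<Rightarrow> ('v \<Rightarrow> real) \<Rightarrow> (complex \<Rightarrow> 'v) set"
  where "calderon_functions X\<^sub>0 N\<^sub>0 X\<^sub>1 N\<^sub>1 =
    (let \<Sigma> = sum_space X\<^sub>0 X\<^sub>1; N = sum_norm X\<^sub>0 N\<^sub>0 X\<^sub>1 N\<^sub>1 in
     {f. (\<forall>z\<in>strip. f z \<in> \<Sigma>) \<and>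
         (\<exists>K. \<forall>z\<in>strip. N (f z) \<le> K) \<and>
         (\<forall>z\<in>strip. ((\<lambda>w. N (f w - f z)) \<longlongrightarrow> 0) (at z within strip)) \<and>
         (\<forall>z\<in>interior strip. \<exists>L\<in>\<Sigma>.
            ((\<lambda>w. N (inverse (w - z) *\<^sub>C (f w - f z) - L)) \<longlongrightarrow> 0) (at z)) \<and>
         boundary_function X\<^sub>0 N\<^sub>0 (\<lambda>t. f (Complex 0 t)) \<and>
         boundary_function X\<^sub>1 N\<^sub>1 (\<lambda>t. f (Complex 1 t))})"

definition interpolation_space ::
  "'v::{plus,minus,scaleC} set \<Rightarrow> ('v \<Rightarrow> real) \<Rightarrow> 'v set \<Rightarrow> ('v \<Rightarrow> real) \<Rightarrow> real \<Rightarrow> 'v set"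
  where "interpolation_space X\<^sub>0 N\<^sub>0 X\<^sub>1 N\<^sub>1 \<theta> =
    (\<lambda>f. f (complex_of_real \<theta>)) ` calderon_functions X\<^sub>0 N\<^sub>0 X\<^sub>1 N\<^sub>1"

definition interpolation_norm ::
  "'v::{plus,minus,scaleC} set \<Rightarrow> ('v \<Rightarrow> real) \<Rightarrow> 'v set \<Rightarrow> ('v \<Rightarrow> real) \<Rightarrow> real \<Rightarrow> 'v \<Rightarrow> real"
  where "interpolation_norm X\<^sub>0 N\<^sub>0 X\<^sub>1 N\<^sub>1 \<theta> x =
    Inf {max (SUP t. N\<^sub>0 (f (Complex 0 t))) (SUP t. N\<^sub>1 (f (Complex 1 t))) | f.
      f \<in> calderon_functions X\<^sub>0 N\<^sub>0 X\<^sub>1 N\<^sub>1 \<and> f (complex_of_real \<theta>) = x}"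

definition interpolation ::
  "'a::{plus,minus,scaleC} matrix_normed \<Rightarrow> 'a matrix_normed \<Rightarrow> real \<Rightarrow> 'a matrix_normed"
  where "interpolation X\<^sub>0 X\<^sub>1 \<theta> =
    \<lparr>points = interpolation_space (points X\<^sub>0) (point_norm X\<^sub>0) (points X\<^sub>1) (point_norm X\<^sub>1) \<theta>,
     mat_norm = (\<lambda>A. interpolation_norm
       (matrices (dim_row A) (points X\<^sub>0)) (mat_norm X\<^sub>0)
       (matrices (dim_row A) (points X\<^sub>1)) (mat_norm X\<^sub>1) \<theta> A)\<rparr>"


section \<open>Row and column operator spaces\<close>

text \<open>Indices start at 0, so the first row and the first column have index 0.\<close>

lift_definition unit_vec_ell2 :: "nat \<Rightarrow> ell2" is "\<lambda>i k. if k = i then 1 else 0"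
  subgoal for i
    by (rule summable_finite[of "{i}"]) auto
  done

lemma coord_le_norm: "cmod (coord x i) \<le> norm x"
  unfolding norm_ell2_def
  using sum_le_suminf[OF summable_coord, of "{i}" x] by (intro real_le_rsqrt) auto

lift_definition matrix_unit :: "nat \<Rightarrow> nat \<Rightarrow> ell2 \<Rightarrow>\<^sub>L ell2"
  is "\<lambda>i j x. coord x j *\<^sub>C unit_vec_ell2 i"
proof (rule bounded_linear_intro)
  fix i j :: nat and x y :: ell2 and r :: real
  show "coord (x + y) j *\<^sub>C unit_vec_ell2 i
      = coord x j *\<^sub>C unit_vec_ell2 i + coord y j *\<^sub>C unit_vec_ell2 i"
    by (simp add: plus_ell2.rep_eq scaleC_add_left)
  show "coord (r *\<^sub>R x) j *\<^sub>C unit_vec_ell2 i = r *\<^sub>R (coord x j *\<^sub>C unit_vec_ell2 i)"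
    by (simp add: scaleC_of_real[symmetric] scaleC_scaleC scaleC_ell2.rep_eq)
  show "norm (coord x j *\<^sub>C unit_vec_ell2 i) \<le> norm x * norm (unit_vec_ell2 i)"
    by (simp add: norm_scaleC coord_le_norm mult_right_mono)
qed

definition row_space :: "(ell2 \<Rightarrow>\<^sub>L ell2) set"
  where "row_space = closure (complex_vector.span (range (\<lambda>j. matrix_unit 0 j)))"

definition column_space :: "(ell2 \<Rightarrow>\<^sub>L ell2) set"
  where "column_space = closure (complex_vector.span (range (\<lambda>j. matrix_unit j 0)))"

lemma operator_space_closure_span:
  assumes S: "\<And>T. T \<in> S \<Longrightarrow> complex_linear T"
  shows "operator_space (closure (complex_vector.span S))"
proof -
  let ?V = "complex_vector.span S"
  have "complex_linear T" if "T \<in> ?V" for T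
    using that
  proof (induction rule: complex_vector.span_induct_alt)
    case base
    show ?case by (simp add: complex_linear_def)
  next
    case (step c T U)
    then show ?case
      using S[of T]
      by (simp add: complex_linear_def blinfun.add_left scaleC_blinfun.rep_eq scaleC_add_right
          scaleC_scaleC mult.commute)
  qed
  then have "?V \<subseteq> {T. \<forall>c x. blinfun_apply T (c *\<^sub>C x) = c *\<^sub>C blinfun_apply T x}"
    by (auto simp: complex_linear_def)
  moreover have "closed {T :: 'a \<Rightarrow>\<^sub>L 'a. \<forall>c x. blinfun_apply T (c *\<^sub>C x) = c *\<^sub>C blinfun_apply T x}"
    by (intro closed_Collect_all closed_Collect_eq continuous_intros
        bounded_linear.continuous_on[OF bounded_linear_scaleC])
  ultimately have "closure ?V \<subseteq> {T. \<forall>c x. blinfun_apply T (c *\<^sub>C x) = c *\<^sub>C blinfun_apply T x}"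
    by (rule closure_minimal)
  moreover have "complex_vector.subspace (closure ?V)"
  proof (rule complex_vector.subspaceI)
    show "0 \<in> closure ?V"
      using closure_subset complex_vector.span_zero by blast
  next
    fix T U assume "T \<in> closure ?V" "U \<in> closure ?V"
    then obtain t u where "\<And>n. t n \<in> ?V" "t \<longlonglongrightarrow> T" "\<And>n. u n \<in> ?V" "u \<longlonglongrightarrow> U"
      unfolding closure_sequential by blast
    then show "T + U \<in> closure ?V"
      unfolding closure_sequential
      by (intro exI[of _ "\<lambda>n. t n + u n"]) (auto intro: complex_vector.span_add tendsto_add)
  next
    fix c T assume "T \<in> closure ?V"
    then obtain t where "\<And>n. t n \<in> ?V" "t \<longlonglongrightarrow> T"
      unfolding closure_sequential by blast
    then show "c *\<^sub>C T \<in> closure ?V"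
      unfolding closure_sequential
      by (intro exI[of _ "\<lambda>n. c *\<^sub>C t n"])
        (auto intro: complex_vector.span_scale bounded_linear.tendsto[OF bounded_linear_scaleC])
  qed
  ultimately show ?thesis
    by (auto simp: operator_space_def complex_linear_def)
qed

lemma complex_linear_matrix_unit: "complex_linear (matrix_unit i j)"
  by (simp add: complex_linear_def matrix_unit.rep_eq scaleC_ell2.rep_eq scaleC_scaleC)

lemma operator_space_row: "operator_space row_space"
  and operator_space_column: "operator_space column_space"
  unfolding row_space_def column_space_def
  by (auto intro!: operator_space_closure_span complex_linear_matrix_unit)

text \<open>
  The canonical isometries onto \<open>\<ell>\<^sub>2\<close>, which read off the first row and the first column of the
  matrix of an operator.
\<close>

definition row_to_ell2 :: "(ell2 \<Rightarrow>\<^sub>L ell2) \<Rightarrow> ell2"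
  where "row_to_ell2 T = Abs_ell2 (\<lambda>j. coord (blinfun_apply T (unit_vec_ell2 j)) 0)"

definition column_to_ell2 :: "(ell2 \<Rightarrow>\<^sub>L ell2) \<Rightarrow> ell2"
  where "column_to_ell2 T = blinfun_apply T (unit_vec_ell2 0)"

lemma coord_sum: "coord (\<Sum>j\<in>J. x j) k = (\<Sum>j\<in>J. coord (x j) k)"
  by (induction J rule: infinite_finite_induct) (simp_all add: zero_ell2.rep_eq plus_ell2.rep_eq)

lemma coord_row_to_ell2:
  assumes "complex_linear T"
  shows "coord (row_to_ell2 T) = (\<lambda>j. coord (blinfun_apply T (unit_vec_ell2 j)) 0)"
proof -
  define a where "a j = coord (blinfun_apply T (unit_vec_ell2 j)) 0" for j
  have "(\<Sum>j<n. (cmod (a j))\<^sup>2) \<le> (norm T)\<^sup>2" for n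
  proof -
    define s where "s = (\<Sum>j<n. (cmod (a j))\<^sup>2)"
    define v where "v = (\<Sum>j<n. cnj (a j) *\<^sub>C unit_vec_ell2 j)"
    have "coord v k = (if k < n then cnj (a k) else 0)" for k
      by (simp add: v_def coord_sum scaleC_ell2.rep_eq unit_vec_ell2.rep_eq if_distrib cong: if_cong)
    then have "(\<Sum>k. (cmod (coord v k))\<^sup>2) = s"
      unfolding s_def by (subst suminf_finite[of "{..<n}"]) auto
    then have norm_v: "norm v = sqrt s" by (simp add: norm_ell2_def)
    have s0: "s \<ge> 0" by (simp add: s_def sum_nonneg)
    have "coord (blinfun_apply T v) 0 = (\<Sum>j<n. cnj (a j) * a j)"
      using assms
      by (simp add: v_def blinfun.sum_right coord_sum complex_linear_def scaleC_ell2.rep_eq a_def)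
    also have "\<dots> = complex_of_real s"
      by (simp add: s_def complex_norm_square mult.commute del: of_real_power)
    finally have "s = cmod (coord (blinfun_apply T v) 0)" using s0 by simp
    also have "\<dots> \<le> norm T * sqrt s"
      using order_trans[OF coord_le_norm norm_blinfun[of T v]] by (simp add: norm_v)
    finally have "sqrt s * sqrt s \<le> norm T * sqrt s" using s0 by simp
    then have "sqrt s \<le> norm T"
      using s0 by (cases "s = 0") (auto simp del: real_sqrt_mult_self)
    then show ?thesis
      unfolding s_def[symmetric] by (simp add: sqrt_le_D)
  qed
  then have "summable (\<lambda>j. (cmod (a j))\<^sup>2)"
    by (intro summableI_nonneg_bounded[of _ "(norm T)\<^sup>2"]) auto
  then show ?thesis by (simp add: row_to_ell2_def a_def Abs_ell2_inverse)
qed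

lemma row_to_ell2_matrix_unit: "row_to_ell2 (matrix_unit 0 j) = unit_vec_ell2 j"
  by (rule ell2_eqI)
    (simp add: coord_row_to_ell2 complex_linear_matrix_unit matrix_unit.rep_eq
      scaleC_ell2.rep_eq unit_vec_ell2.rep_eq)

lemma column_to_ell2_matrix_unit: "column_to_ell2 (matrix_unit j 0) = unit_vec_ell2 j"
  by (rule ell2_eqI)
    (simp add: column_to_ell2_def matrix_unit.rep_eq scaleC_ell2.rep_eq unit_vec_ell2.rep_eq)

definition row_column_interpolation :: "real \<Rightarrow> ell2 matrix_normed"
  where "row_column_interpolation \<theta> =
    interpolation (transport row_to_ell2 (concrete row_space))
      (transport column_to_ell2 (concrete column_space)) \<theta>"


section \<open>Spherically-complete coarse embeddings\<close>

definition expansion_modulus ::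
  "'i set \<Rightarrow> ('i \<Rightarrow> 'a set) \<Rightarrow> ('i \<Rightarrow> 'a \<Rightarrow> 'a \<Rightarrow> real) \<Rightarrow> ('i \<Rightarrow> 'b \<Rightarrow> 'b \<Rightarrow> real)
    \<Rightarrow> ('i \<Rightarrow> 'a \<Rightarrow> 'b) \<Rightarrow> real \<Rightarrow> ereal"
  where "expansion_modulus I A d d' F t =
    (SUP n\<in>I. Sup {ereal (d' n (F n x) (F n y)) | x y. x \<in> A n \<and> y \<in> A n \<and> d n x y \<le> t})"

definition compression_modulus ::
  "'i set \<Rightarrow> ('i \<Rightarrow> 'a set) \<Rightarrow> ('i \<Rightarrow> 'a \<Rightarrow> 'a \<Rightarrow> real) \<Rightarrow> ('i \<Rightarrow> 'b \<Rightarrow> 'b \<Rightarrow> real)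
    \<Rightarrow> ('i \<Rightarrow> 'a \<Rightarrow> 'b) \<Rightarrow> real \<Rightarrow> ereal"
  where "compression_modulus I A d d' F t =
    (INF n\<in>I. Inf {ereal (d' n (F n x) (F n y)) | x y. x \<in> A n \<and> y \<in> A n \<and> d n x y \<ge> t})"

definition equi_coarse_embeddings ::
  "'i set \<Rightarrow> ('i \<Rightarrow> 'a set) \<Rightarrow> ('i \<Rightarrow> 'a \<Rightarrow> 'a \<Rightarrow> real)
    \<Rightarrow> ('i \<Rightarrow> 'b set) \<Rightarrow> ('i \<Rightarrow> 'b \<Rightarrow> 'b \<Rightarrow> real) \<Rightarrow> ('i \<Rightarrow> 'a \<Rightarrow> 'b) \<Rightarrow> bool"
  where "equi_coarse_embeddings I A d B d' F \<longleftrightarrow>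
    (\<forall>n\<in>I. F n \<in> A n \<rightarrow> B n) \<and>
    (\<forall>t\<ge>0. expansion_modulus I A d d' F t < \<infinity>) \<and>
    (compression_modulus I A d d' F \<longlongrightarrow> \<infinity>) at_top"

definition mat_unit_sphere :: "nat \<Rightarrow> 'a matrix_normed \<Rightarrow> 'a mat set"
  where "mat_unit_sphere n X = {A \<in> matrices n (points X). mat_norm X A = 1}"

text \<open>The amplification of \<open>f\<close> is \<open>map_mat f\<close>.\<close>

definition spherical_amplification ::
  "nat \<Rightarrow> 'a::real_vector matrix_normed \<Rightarrow> 'b matrix_normed \<Rightarrow> ('a mat \<Rightarrow> 'b mat) \<Rightarrow> bool"
  where "spherical_amplification n X Y F \<longleftrightarrow>
    F \<in> matrices n (points X) \<rightarrow> matrices n (points Y) \<and>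
    (\<forall>r\<ge>0. \<exists>f \<in> points X \<rightarrow> points Y.
       \<forall>A \<in> map_mat (scaleR r) ` mat_unit_sphere n X. F A = map_mat f A)"

definition spherically_completely_coarsely_embeds ::
  "'a::real_vector matrix_normed \<Rightarrow> 'b::minus matrix_normed \<Rightarrow> bool"
  where "spherically_completely_coarsely_embeds X Y \<longleftrightarrow>
    (\<exists>F. (\<forall>n\<ge>1. spherical_amplification n X Y (F n)) \<and>
      equi_coarse_embeddings {1..} (\<lambda>n. matrices n (points X)) (\<lambda>n. mat_dist X)
        (\<lambda>n. matrices n (points Y)) (\<lambda>n. mat_dist Y) F)"

end

theory Submission
  imports Defs "HOL-Complex_Analysis.Conformal_Mappings" "HOL-Real_Asymp.Real_Asymp"
begin

text \<open>
  Let \<open>e j\<close> be orthonormal vectors. In the matrices over \<open>(R, C)\<^sub>\<theta>\<close>, a row of \<open>m\<close> of them has norm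
  \<open>m powr ((1 - \<theta>) / 2)\<close> and a column has norm \<open>m powr (\<theta> / 2)\<close>. If \<open>\<theta> \<noteq> \<gamma>\<close>, then in one of the two
  directions, say for rows, the exponent \<open>a\<close> of the source is smaller than the exponent \<open>b\<close> of the
  target; for columns the exponents are \<open>1 / 2 - a\<close> and \<open>1 / 2 - b\<close>, in the opposite order.

  Given a spherically-complete coarse embedding, a fixed entry of large norm, put into a corner of its
  own, moves all rows and columns in question to one sphere, so that they are mapped by the
  amplification of one map \<open>f\<close> (\<open>spherical_amplification_basis_lines\<close>); the corner cancels in
  differences. Put \<open>s = m powr (- a)\<close>. Two disjoint rows of \<open>m\<close> vectors \<open>s *\<^sub>R e j\<close> have distance at most
  \<open>2\<close>, so their images have distance at most some \<open>W\<close> that does not depend on \<open>m\<close>. The norm of a row in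
  the target controls the norms of its entries (\<open>line_le_mat_norm\<close>), and it follows that among any
  \<open>m\<close> disjoint pairs of basis vectors there is one whose images under \<open>f\<close> differ by at most
  \<open>c = W * m powr (- b)\<close>. As the sequence of images is bounded, one can choose \<open>k\<close> such
  differences that are almost orthogonal to each other (\<open>almost_orthogonal_differences\<close>).

  Now these pairs are arranged in columns of length \<open>k\<close>. In the source the two columns have distance at
  least \<open>s * k powr (1 / 2 - a)\<close>, and in the target at most \<open>sqrt 2 * c * k powr (1 / 2 - b)\<close>. For suitable
  \<open>m\<close> and \<open>k\<close> the first number exceeds a given \<open>t\<close> and the second one is less than \<open>1\<close>
  (\<open>exists_line_lengths\<close>), which contradicts that the compression modulus tends to infinity.

  The norms of lines are estimated from above by explicit functions in Calderon's class
  (\<open>mat_norm_line_corner_le\<close>) and from below by the three lines theorem, applied to linear functionals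
  (\<open>mat_pairing_le_interpolation_norm\<close>). At the endpoints \<open>R\<close> and \<open>C\<close> both reduce to the
  Cauchy--Schwarz inequality and to a Bessel inequality for almost orthogonal vectors.
\<close>

section \<open>The three lines theorem\<close>

text \<open>
  The maximum principle needs a bounded domain. The factor \<open>exp (d * z\<^sup>2)\<close> makes a bounded function
  small far up and far down the strip, so that the boundary bound holds on all sides of a high
  rectangle; letting \<open>d\<close> tend to \<open>0\<close> removes the factor again. The strip is closed, which covers
  the endpoints of the interpolation parameter.
\<close>

lemma bounded_on_strip_by_boundary:
  fixes g :: "complex \<Rightarrow> complex"
  assumes cont: "continuous_on strip g" and holo: "g holomorphic_on interior strip"
    and bdd: "\<And>z. z \<in> strip \<Longrightarrow> cmod (g z) \<le> M"
    and left: "\<And>t. cmod (g (Complex 0 t)) \<le> B" and right: "\<And>t. cmod (g (Complex 1 t)) \<le> B"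
    and B: "B > 0" and z: "z \<in> strip"
  shows "cmod (g z) \<le> B"
proof -
  have M: "M \<ge> 0"
    using bdd[OF z] norm_ge_zero order_trans by blast
  have damped: "cmod (g z) \<le> exp d * B / exp (d * ((Re z)\<^sup>2 - (Im z)\<^sup>2))" if d: "d > 0" for d
  proof -
    define h where "h w = exp (complex_of_real d * w\<^sup>2) * g w" for w
    have norm_h: "cmod (h w) = exp (d * ((Re w)\<^sup>2 - (Im w)\<^sup>2)) * cmod (g w)" for w
      by (simp add: h_def norm_mult power2_eq_square)
    have "((\<lambda>T. exp (d * (1 - T\<^sup>2)) * M) \<longlongrightarrow> 0 * M) at_top"
      using d by (intro tendsto_mult tendsto_const) real_asymp
    then have "eventually (\<lambda>T. exp (d * (1 - T\<^sup>2)) * M < B) at_top"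
      using B by (simp add: order_tendsto_iff)
    then obtain T where T: "exp (d * (1 - T\<^sup>2)) * M < B" "T \<ge> \<bar>Im z\<bar>"
      using eventually_happens[OF eventually_conj[OF _ eventually_ge_at_top[of "\<bar>Im z\<bar>"]]]
      by (metis (mono_tags, lifting) trivial_limit_at_top_linorder)
    define S where "S = cbox (Complex 0 (- T)) (Complex 1 T)"
    have S_strip: "S \<subseteq> strip"
      by (auto simp: S_def strip_def in_cbox_complex_iff)
    have int_S: "interior S = box (Complex 0 (- T)) (Complex 1 T)"
      by (simp add: S_def interior_cbox)
    have "cmod (h z) \<le> exp d * B"
    proof (rule maximum_modulus_frontier[of h S])
      have "g holomorphic_on interior S"
        using holo interior_mono[OF S_strip] by (rule holomorphic_on_subset)
      then show "h holomorphic_on interior S"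
        unfolding h_def by (intro holomorphic_intros)
      have "continuous_on S g"
        using cont S_strip by (rule continuous_on_subset)
      then show "continuous_on (closure S) h"
        unfolding h_def by (simp add: S_def) (intro continuous_intros)
      show "bounded S" by (simp add: S_def)
      show "z \<in> S" using z T by (auto simp: S_def strip_def in_cbox_complex_iff)
      fix w assume "w \<in> frontier S"
      then have w: "w \<in> S" "w \<notin> box (Complex 0 (- T)) (Complex 1 T)"
        by (auto simp: frontier_def int_S) (simp add: S_def)
      then have w_strip: "w \<in> strip" using S_strip by blast
      then have Re2: "(Re w)\<^sup>2 \<le> 1"
        by (simp add: strip_def power_le_one)
      from w consider "Re w = 0" | "Re w = 1" | "\<bar>Im w\<bar> = T"
        by (force simp: S_def in_cbox_complex_iff in_box_complex_iff)
      then show "cmod (h w) \<le> exp d * B"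
      proof cases
        case 1
        then have "cmod (g w) \<le> B" using left[of "Im w"] by (metis complex.collapse)
        moreover have "exp (d * ((Re w)\<^sup>2 - (Im w)\<^sup>2)) \<le> exp d"
          using d 1 by (simp add: order_trans[of _ 0])
        ultimately show ?thesis unfolding norm_h by (intro mult_mono) auto
      next
        case 2
        then have "cmod (g w) \<le> B" using right[of "Im w"] by (metis complex.collapse)
        moreover have "exp (d * ((Re w)\<^sup>2 - (Im w)\<^sup>2)) \<le> exp d"
          using d 2 by simp
        ultimately show ?thesis unfolding norm_h by (intro mult_mono) auto
      next
        case 3
        then have "(Im w)\<^sup>2 = T\<^sup>2" by (metis power2_abs)
        then have "exp (d * ((Re w)\<^sup>2 - (Im w)\<^sup>2)) \<le> exp (d * (1 - T\<^sup>2))"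
          using d Re2 by simp
        then have "cmod (h w) \<le> exp (d * (1 - T\<^sup>2)) * M"
          unfolding norm_h using bdd[OF w_strip] by (intro mult_mono) auto
        also have "\<dots> \<le> 1 * B" using T by simp
        also have "\<dots> \<le> exp d * B" using d B by (intro mult_right_mono) auto
        finally show ?thesis .
      qed
    qed
    then show ?thesis by (simp add: norm_h field_simps)
  qed
  have "((\<lambda>d. exp d * B / exp (d * ((Re z)\<^sup>2 - (Im z)\<^sup>2))) \<longlongrightarrow> exp 0 * B / exp (0 * ((Re z)\<^sup>2 - (Im z)\<^sup>2)))
      (at_right 0)"
    by (intro tendsto_intros) auto
  then have "((\<lambda>d. exp d * B / exp (d * ((Re z)\<^sup>2 - (Im z)\<^sup>2))) \<longlongrightarrow> B) (at_right 0)" by simp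
  moreover have "\<forall>\<^sub>F d in at_right 0. cmod (g z) \<le> exp d * B / exp (d * ((Re z)\<^sup>2 - (Im z)\<^sup>2))"
    using damped by (intro eventually_at_right_less[THEN eventually_mono]) auto
  ultimately show ?thesis
    by (rule tendsto_lowerbound) simp
qed

text \<open>
  The function \<open>u\<close> below has constant modulus \<open>1 / B\<^sub>0\<close> and \<open>1 / B\<^sub>1\<close> on the two boundary lines,
  which reduces the claim to the case of boundary bounds equal to \<open>1\<close>.
\<close>

lemma three_lines:
  fixes g :: "complex \<Rightarrow> complex"
  assumes cont: "continuous_on strip g" and holo: "g holomorphic_on interior strip"
    and bdd: "\<And>z. z \<in> strip \<Longrightarrow> cmod (g z) \<le> M"
    and left: "\<And>t. cmod (g (Complex 0 t)) \<le> B\<^sub>0" and right: "\<And>t. cmod (g (Complex 1 t)) \<le> B\<^sub>1"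
    and B: "B\<^sub>0 > 0" "B\<^sub>1 > 0" and \<theta>: "\<theta> \<in> {0..1}"
  shows "cmod (g (complex_of_real \<theta>)) \<le> B\<^sub>0 powr (1 - \<theta>) * B\<^sub>1 powr \<theta>"
proof -
  define u where "u z = exp (- ((1 - z) * complex_of_real (ln B\<^sub>0) + z * complex_of_real (ln B\<^sub>1)))" for z
  have norm_u: "cmod (u z) = inverse (B\<^sub>0 powr (1 - Re z) * B\<^sub>1 powr Re z)" for z
    using B by (simp add: u_def powr_def exp_minus[symmetric] exp_add[symmetric])
  have "cmod (g (complex_of_real \<theta>) * u (complex_of_real \<theta>)) \<le> 1"
  proof (rule bounded_on_strip_by_boundary[where g = "\<lambda>z. g z * u z"])
    show "continuous_on strip (\<lambda>z. g z * u z)" "(\<lambda>z. g z * u z) holomorphic_on interior strip"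
      unfolding u_def using cont holo by (intro continuous_intros holomorphic_intros; simp)+
    fix z assume z: "z \<in> strip"
    have 1: "\<bar>1 - Re z\<bar> \<le> 1" "\<bar>Re z\<bar> \<le> 1" using z by (auto simp: strip_def)
    have "- (r * l) \<le> \<bar>l\<bar>" if "\<bar>r\<bar> \<le> 1" for r l :: real
      using that mult_right_mono[of "\<bar>r\<bar>" 1 "\<bar>l\<bar>"] abs_ge_minus_self[of "r * l"]
      by (simp add: abs_mult)
    from this[OF 1(1), of "ln B\<^sub>0"] this[OF 1(2), of "ln B\<^sub>1"]
    have "cmod (u z) \<le> exp (\<bar>ln B\<^sub>0\<bar> + \<bar>ln B\<^sub>1\<bar>)"
      by (simp add: u_def algebra_simps)
    then show "cmod (g z * u z) \<le> M * exp (\<bar>ln B\<^sub>0\<bar> + \<bar>ln B\<^sub>1\<bar>)"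
      unfolding norm_mult using bdd[OF z] norm_ge_zero[of "g z"]
      by (intro mult_mono) (linarith | simp)+
  next
    fix t
    show "cmod (g (Complex 0 t) * u (Complex 0 t)) \<le> 1"
      "cmod (g (Complex 1 t) * u (Complex 1 t)) \<le> 1"
      using left[of t] right[of t] B by (simp_all add: norm_mult norm_u field_simps)
  qed (use \<theta> in \<open>auto simp: strip_def\<close>)
  then show ?thesis
    using B by (simp add: norm_mult norm_u field_simps)
qed

section \<open>The bilinear pairing of square-summable sequences\<close>

lift_definition cnj_ell2 :: "ell2 \<Rightarrow> ell2" is "\<lambda>x i. cnj (x i)" by simp

text \<open>
  The pairing is bilinear rather than sesquilinear because the operator with first row \<open>x\<close> depends
  linearly on \<open>x\<close>; the complex inner product of \<open>x\<close> and \<open>y\<close> is \<open>pair x (cnj_ell2 y)\<close>.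
\<close>

definition pair :: "ell2 \<Rightarrow> ell2 \<Rightarrow> complex"
  where "pair x y = (\<Sum>i. coord x i * coord y i)"

lemma norm_cnj_ell2 [simp]: "norm (cnj_ell2 x) = norm x"
  by (simp add: norm_ell2_def cnj_ell2.rep_eq)

lemma cnj_ell2_cnj_ell2 [simp]: "cnj_ell2 (cnj_ell2 x) = x"
  by (rule ell2_eqI) (simp add: cnj_ell2.rep_eq)

lemma cnj_ell2_scaleC: "cnj_ell2 (c *\<^sub>C x) = cnj c *\<^sub>C cnj_ell2 x"
  by (rule ell2_eqI) (simp add: cnj_ell2.rep_eq scaleC_ell2.rep_eq)

lemma cnj_ell2_scaleR: "cnj_ell2 (s *\<^sub>R x) = s *\<^sub>R cnj_ell2 x"
  by (rule ell2_eqI) (simp add: cnj_ell2.rep_eq coord_scaleR)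

lemma cnj_ell2_diff: "cnj_ell2 (x - y) = cnj_ell2 x - cnj_ell2 y"
  by (rule ell2_eqI) (simp add: cnj_ell2.rep_eq minus_ell2.rep_eq)

lemma summable_pair: "summable (\<lambda>i. coord x i * coord y i)"
proof (rule summable_comparison_test')
  show "summable (\<lambda>i. (cmod (coord x i))\<^sup>2 + (cmod (coord y i))\<^sup>2)"
    by (intro summable_add summable_coord)
  fix i
  show "norm (coord x i * coord y i) \<le> (cmod (coord x i))\<^sup>2 + (cmod (coord y i))\<^sup>2"
    using sum_squares_bound[of "cmod (coord x i)" "cmod (coord y i)"]
      mult_nonneg_nonneg[OF norm_ge_zero[of "coord x i"] norm_ge_zero[of "coord y i"]]
    unfolding norm_mult by linarith
qed

lemma pair_commute: "pair x y = pair y x"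
  by (simp add: pair_def mult.commute)

lemma pair_add_left: "pair (x + y) z = pair x z + pair y z"
  unfolding pair_def
  by (subst suminf_add[OF summable_pair summable_pair]) (simp add: plus_ell2.rep_eq distrib_right)

lemma pair_scaleC_left: "pair (c *\<^sub>C x) y = c * pair x y"
  unfolding pair_def
  by (subst suminf_mult[OF summable_pair, symmetric]) (simp add: scaleC_ell2.rep_eq mult.assoc)

lemma pair_add_right: "pair x (y + z) = pair x y + pair x z"
  and pair_scaleC_right: "pair x (c *\<^sub>C y) = c * pair x y"
  by (metis pair_commute pair_add_left) (metis pair_commute pair_scaleC_left)

lemma pair_scaleR_left: "pair (r *\<^sub>R x) y = complex_of_real r * pair x y"
  and pair_scaleR_right: "pair x (r *\<^sub>R y) = complex_of_real r * pair x y"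
  by (simp_all add: scaleC_of_real[symmetric] pair_scaleC_left pair_scaleC_right)

lemma pair_zero [simp]: "pair 0 x = 0" "pair x 0 = 0"
  using pair_scaleR_left[of 0] pair_scaleR_right[of _ 0] by simp_all

lemma pair_diff_left: "pair (x - y) z = pair x z - pair y z"
  using pair_add_left[of "x - y" y z] by simp

lemma pair_diff_right: "pair z (x - y) = pair z x - pair z y"
  by (metis pair_commute pair_diff_left)

lemma pair_sum_left: "pair (\<Sum>i\<in>I. x i) y = (\<Sum>i\<in>I. pair (x i) y)"
  by (induction I rule: infinite_finite_induct) (simp_all add: pair_add_left)

lemma inner_eq_Re_pair: "x \<bullet> y = Re (pair x (cnj_ell2 y))"
proof -
  have "(\<lambda>i. Re (coord x i * coord (cnj_ell2 y) i)) sums Re (pair x (cnj_ell2 y))"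
    unfolding pair_def by (intro sums_Re summable_sums summable_pair)
  moreover have "Re (coord x i * coord (cnj_ell2 y) i) = coord x i \<bullet> coord y i" for i
    by (simp add: cnj_ell2.rep_eq inner_complex_def)
  ultimately show ?thesis by (simp add: inner_ell2.rep_eq sums_iff)
qed

lemma norm_eq_pair: "pair x (cnj_ell2 x) = complex_of_real ((norm x)\<^sup>2)"
proof -
  have "coord x i * coord (cnj_ell2 x) i = complex_of_real ((cmod (coord x i))\<^sup>2)" for i
    by (simp add: cnj_ell2.rep_eq complex_norm_square del: of_real_power)
  then have "pair x (cnj_ell2 x) = complex_of_real (\<Sum>i. (cmod (coord x i))\<^sup>2)"
    unfolding pair_def by (simp only: suminf_of_real[OF summable_coord])
  then show ?thesis by (simp add: norm_ell2_def suminf_nonneg[OF summable_coord] del: of_real_power)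
qed

lemma pair_cnj_swap: "pair y (cnj_ell2 x) = cnj (pair x (cnj_ell2 y))"
proof -
  have "(\<lambda>i. cnj (coord x i * coord (cnj_ell2 y) i)) sums cnj (pair x (cnj_ell2 y))"
    unfolding pair_def sums_cnj by (rule summable_sums[OF summable_pair])
  then show ?thesis by (simp add: pair_def cnj_ell2.rep_eq sums_iff mult.commute)
qed

text \<open>
  Rotating \<open>x\<close> makes the pairing real, and then it is a value of the real inner product, to which
  the Cauchy--Schwarz inequality applies.
\<close>

lemma norm_pair_le: "cmod (pair x y) \<le> norm x * norm y"
proof -
  define u where "u = cnj (sgn (pair x y))"
  have "u * pair x y = complex_of_real (cmod (pair x y))"
    by (cases "pair x y = 0")
      (simp_all add: u_def sgn_eq complex_norm_square[symmetric] power2_eq_square mult.commute)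
  then have "cmod (pair x y) = (u *\<^sub>C x) \<bullet> cnj_ell2 y"
    by (simp add: inner_eq_Re_pair pair_scaleC_left)
  also have "\<dots> \<le> norm (u *\<^sub>C x) * norm y"
    using norm_cauchy_schwarz[of "u *\<^sub>C x" "cnj_ell2 y"] by simp
  also have "\<dots> \<le> norm x * norm y"
    by (intro mult_right_mono) (simp_all add: norm_scaleC u_def norm_sgn)
  finally show ?thesis .
qed

lemma coord_unit_vec: "coord (unit_vec_ell2 i) k = (if k = i then 1 else 0)"
  by (simp add: unit_vec_ell2.rep_eq)

lemma pair_unit_vec [simp]: "pair x (unit_vec_ell2 i) = coord x i"
proof -
  have "pair x (unit_vec_ell2 i) = (\<Sum>k\<in>{i}. coord x k * coord (unit_vec_ell2 i) k)"
    unfolding pair_def by (rule suminf_finite) (auto simp: coord_unit_vec)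
  then show ?thesis by (simp add: coord_unit_vec)
qed

lemma cnj_unit_vec [simp]: "cnj_ell2 (unit_vec_ell2 i) = unit_vec_ell2 i"
  by (rule ell2_eqI) (simp add: cnj_ell2.rep_eq coord_unit_vec)

lemma norm_unit_vec [simp]: "norm (unit_vec_ell2 i) = 1"
  using norm_eq_pair[of "unit_vec_ell2 i"] power2_eq_1_iff[of "norm (unit_vec_ell2 i)"]
  by (auto simp: coord_unit_vec simp del: of_real_power)
    (metis norm_ge_zero not_one_le_zero neg_0_le_iff_le)

text \<open>
  In the expansion of the square, the diagonal terms add up to at most \<open>c\<^sup>2 * (\<Sum>j<m. (cmod (a j))\<^sup>2)\<close>.
  The bound \<open>c\<^sup>2 / m\<close> on the correlations is the size at which the off-diagonal terms, at most
  \<open>(\<Sum>j<m. cmod (a j))\<^sup>2 * (c\<^sup>2 / m)\<close>, contribute no more than that.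
\<close>

lemma norm_sum_almost_orthogonal:
  fixes m :: nat and c :: real
  assumes z: "\<And>j. j < m \<Longrightarrow> norm (z j) \<le> c"
    and orth: "\<And>i j. i < m \<Longrightarrow> j < m \<Longrightarrow> i \<noteq> j \<Longrightarrow> cmod (pair (z i) (cnj_ell2 (z j))) \<le> c\<^sup>2 / m"
  shows "(norm (\<Sum>j<m. a j *\<^sub>C z j))\<^sup>2 \<le> 2 * c\<^sup>2 * (\<Sum>j<m. (cmod (a j))\<^sup>2)"
proof -
  have entry: "(a i *\<^sub>C z i) \<bullet> (a j *\<^sub>C z j)
      \<le> cmod (a i) * cmod (a j) * (c\<^sup>2 / m) + (if i = j then (cmod (a i))\<^sup>2 * c\<^sup>2 else 0)"
    if "i < m" "j < m" for i j
  proof (cases "i = j")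
    case True
    have "(norm (z i))\<^sup>2 \<le> c\<^sup>2" using z[OF that(1)] by (intro power_mono) auto
    then have "(cmod (a i))\<^sup>2 * (norm (z i))\<^sup>2 \<le> (cmod (a i))\<^sup>2 * c\<^sup>2"
      by (intro mult_left_mono) auto
    then show ?thesis
      using True by (simp add: add_increasing dot_square_norm norm_scaleC power_mult_distrib del: power2_norm_eq_inner)
  next
    case False
    have "(a i *\<^sub>C z i) \<bullet> (a j *\<^sub>C z j) = Re (a i * (cnj (a j) * pair (z i) (cnj_ell2 (z j))))"
      by (simp only: inner_eq_Re_pair cnj_ell2_scaleC pair_scaleC_left pair_scaleC_right mult_ac)
    also have "\<dots> \<le> cmod (a i) * cmod (a j) * cmod (pair (z i) (cnj_ell2 (z j)))"
      using complex_Re_le_cmod[of "a i * (cnj (a j) * pair (z i) (cnj_ell2 (z j)))"]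
      by (simp add: norm_mult mult.assoc)
    also have "\<dots> \<le> cmod (a i) * cmod (a j) * (c\<^sup>2 / m)"
      using orth[OF that False] by (intro mult_left_mono) auto
    finally show ?thesis using False by simp
  qed
  have "(norm (\<Sum>j<m. a j *\<^sub>C z j))\<^sup>2 = (\<Sum>i<m. \<Sum>j<m. (a i *\<^sub>C z i) \<bullet> (a j *\<^sub>C z j))"
    unfolding power2_norm_eq_inner inner_sum_left unfolding inner_sum_right by (rule refl)
  also have "\<dots> \<le> (\<Sum>i<m. \<Sum>j<m. cmod (a i) * cmod (a j) * (c\<^sup>2 / m)
      + (if i = j then (cmod (a i))\<^sup>2 * c\<^sup>2 else 0))"
    by (intro sum_mono entry) auto
  also have "\<dots> = (\<Sum>j<m. cmod (a j))\<^sup>2 * (c\<^sup>2 / m) + c\<^sup>2 * (\<Sum>j<m. (cmod (a j))\<^sup>2)"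
  proof -
    have "(\<Sum>i<m. \<Sum>j<m. cmod (a i) * cmod (a j) * (c\<^sup>2 / m)) = (\<Sum>j<m. cmod (a j))\<^sup>2 * (c\<^sup>2 / m)"
      unfolding power2_eq_square[of "\<Sum>j<m. cmod (a j)"] sum_product
      unfolding sum_distrib_right by (rule refl)
    moreover have "(\<Sum>i<m. \<Sum>j<m. if i = j then (cmod (a i))\<^sup>2 * c\<^sup>2 else 0)
        = c\<^sup>2 * (\<Sum>j<m. (cmod (a j))\<^sup>2)"
      by (simp add: sum_distrib_left mult.commute)
    ultimately show ?thesis by (simp only: sum.distrib)
  qed
  also have "(\<Sum>j<m. cmod (a j))\<^sup>2 * (c\<^sup>2 / m) \<le> (real m * (\<Sum>j<m. (cmod (a j))\<^sup>2)) * (c\<^sup>2 / m)"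
    using sum_squared_le_sum_of_squares[of "\<lambda>j. cmod (a j)" "{..<m}"]
    by (intro mult_right_mono) (auto simp: mult.commute)
  also have "\<dots> \<le> c\<^sup>2 * (\<Sum>j<m. (cmod (a j))\<^sup>2)"
    by (cases "m = 0") auto
  finally show ?thesis by simp
qed

text \<open>
  Synthesis and analysis operators are adjoint to each other, so they have the same norm: the
  estimate is the previous one, tested on the coefficients of \<open>v\<close> itself.
\<close>

lemma bessel_almost_orthogonal:
  fixes m :: nat and c :: real
  assumes z: "\<And>j. j < m \<Longrightarrow> norm (z j) \<le> c"
    and orth: "\<And>i j. i < m \<Longrightarrow> j < m \<Longrightarrow> i \<noteq> j \<Longrightarrow> cmod (pair (z i) (cnj_ell2 (z j))) \<le> c\<^sup>2 / m"
  shows "(\<Sum>j<m. (cmod (pair (z j) v))\<^sup>2) \<le> 2 * c\<^sup>2 * (norm v)\<^sup>2"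
proof -
  define S where "S = (\<Sum>j<m. (cmod (pair (z j) v))\<^sup>2)"
  have S0: "S \<ge> 0" by (simp add: S_def sum_nonneg)
  define w where "w = (\<Sum>j<m. cnj (pair (z j) v) *\<^sub>C z j)"
  have "pair w v = (\<Sum>j<m. complex_of_real ((cmod (pair (z j) v))\<^sup>2))"
    unfolding w_def pair_sum_left pair_scaleC_left
    by (intro sum.cong refl) (simp add: complex_norm_square mult.commute del: of_real_power)
  then have "pair w v = complex_of_real S" by (simp add: S_def)
  then have "S = cmod (pair w v)" using S0 by simp
  also have "\<dots> \<le> norm w * norm v" by (rule norm_pair_le)
  finally have "S\<^sup>2 \<le> (norm w)\<^sup>2 * (norm v)\<^sup>2"
    using S0 by (metis power_mono power_mult_distrib)
  also have "(norm w)\<^sup>2 \<le> 2 * c\<^sup>2 * S"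
    using norm_sum_almost_orthogonal[OF z orth, where a = "\<lambda>j. cnj (pair (z j) v)"]
    by (simp add: w_def S_def)
  finally have "S * S \<le> (2 * c\<^sup>2 * (norm v)\<^sup>2) * S"
    by (simp add: power2_eq_square mult_ac mult_right_mono)
  then show ?thesis
    using S0 unfolding S_def[symmetric] by (cases "S = 0") (auto simp: mult_le_cancel_right)
qed

section \<open>Row and column operators\<close>

definition row_op :: "ell2 \<Rightarrow> ell2 \<Rightarrow>\<^sub>L ell2"
  where "row_op x = Blinfun (\<lambda>v. pair x v *\<^sub>C unit_vec_ell2 0)"

definition col_op :: "ell2 \<Rightarrow> ell2 \<Rightarrow>\<^sub>L ell2"
  where "col_op x = Blinfun (\<lambda>v. coord v 0 *\<^sub>C x)"

lemma row_op_apply: "row_op x v = pair x v *\<^sub>C unit_vec_ell2 0"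
proof -
  have "bounded_linear (\<lambda>v. pair x v *\<^sub>C unit_vec_ell2 0)"
  proof (rule bounded_linear_intro)
    fix v w :: ell2 and r :: real
    show "pair x (v + w) *\<^sub>C unit_vec_ell2 0 = pair x v *\<^sub>C unit_vec_ell2 0 + pair x w *\<^sub>C unit_vec_ell2 0"
      by (simp add: pair_add_right scaleC_add_left)
    show "pair x (r *\<^sub>R v) *\<^sub>C unit_vec_ell2 0 = r *\<^sub>R (pair x v *\<^sub>C unit_vec_ell2 0)"
      unfolding pair_scaleR_right by (simp add: scaleC_of_real[symmetric] scaleC_scaleC)
    show "norm (pair x v *\<^sub>C unit_vec_ell2 0) \<le> norm v * norm x"
      by (simp add: norm_scaleC norm_pair_le mult.commute[of "norm v"])
  qed
  then show ?thesis by (simp add: row_op_def bounded_linear_Blinfun_apply)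
qed

lemma col_op_apply: "col_op x v = coord v 0 *\<^sub>C x"
proof -
  have "bounded_linear (\<lambda>v. coord v 0 *\<^sub>C x)"
  proof (rule bounded_linear_intro)
    fix v w :: ell2 and r :: real
    show "coord (v + w) 0 *\<^sub>C x = coord v 0 *\<^sub>C x + coord w 0 *\<^sub>C x"
      by (simp add: plus_ell2.rep_eq scaleC_add_left)
    show "coord (r *\<^sub>R v) 0 *\<^sub>C x = r *\<^sub>R (coord v 0 *\<^sub>C x)"
      unfolding coord_scaleR by (simp add: scaleC_of_real[symmetric] scaleC_scaleC)
    show "norm (coord v 0 *\<^sub>C x) \<le> norm v * norm x"
      by (simp add: norm_scaleC coord_le_norm mult_right_mono)
  qed
  then show ?thesis by (simp add: col_op_def bounded_linear_Blinfun_apply)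
qed

text \<open>
  What the row and the column embedding of \<open>\<ell>\<^sub>2\<close> into the bounded operators have in common.
\<close>

definition isometric_operators :: "(ell2 \<Rightarrow> ell2 \<Rightarrow>\<^sub>L ell2) \<Rightarrow> bool"
  where "isometric_operators T \<longleftrightarrow> (\<forall>x y. T (x + y) = T x + T y) \<and> (\<forall>c x. T (c *\<^sub>C x) = c *\<^sub>C T x)
    \<and> (\<forall>x. norm (T x) = norm x)"

lemma isometric_row_op: "isometric_operators row_op"
  unfolding isometric_operators_def
proof (intro conjI allI)
  fix x y :: ell2 and c :: complex
  show "row_op (x + y) = row_op x + row_op y"
    by (rule blinfun_eqI) (simp add: row_op_apply blinfun.add_left pair_add_left scaleC_add_left)
  show "row_op (c *\<^sub>C x) = c *\<^sub>C row_op x"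
    by (rule blinfun_eqI) (simp add: row_op_apply scaleC_blinfun.rep_eq pair_scaleC_left scaleC_scaleC)
  show "norm (row_op x) = norm x"
  proof (rule antisym)
    show "norm (row_op x) \<le> norm x"
      by (rule norm_blinfun_bound) (simp_all add: row_op_apply norm_scaleC norm_pair_le)
    have "(norm x)\<^sup>2 = norm (row_op x (cnj_ell2 x))"
      by (simp add: row_op_apply norm_scaleC norm_eq_pair norm_power)
    also have "\<dots> \<le> norm (row_op x) * norm x"
      using norm_blinfun[of "row_op x" "cnj_ell2 x"] by simp
    finally show "norm x \<le> norm (row_op x)"
      by (cases "x = 0") (simp_all add: power2_eq_square)
  qed
qed

lemma isometric_col_op: "isometric_operators col_op"
  unfolding isometric_operators_def
proof (intro conjI allI)
  fix x y :: ell2 and c :: complex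
  show "col_op (x + y) = col_op x + col_op y"
    by (rule blinfun_eqI) (simp add: col_op_apply blinfun.add_left scaleC_add_right)
  show "col_op (c *\<^sub>C x) = c *\<^sub>C col_op x"
    by (rule blinfun_eqI) (simp add: col_op_apply scaleC_blinfun.rep_eq scaleC_scaleC mult.commute)
  show "norm (col_op x) = norm x"
  proof (rule antisym)
    show "norm (col_op x) \<le> norm x"
      by (rule norm_blinfun_bound)
        (simp_all add: col_op_apply norm_scaleC coord_le_norm mult_right_mono mult.commute[of "norm x"])
    show "norm x \<le> norm (col_op x)"
      using norm_blinfun[of "col_op x" "unit_vec_ell2 0"]
      by (simp add: col_op_apply norm_scaleC coord_unit_vec)
  qed
qed

lemma truncation_tendsto: "(\<lambda>n. \<Sum>j<n. coord x j *\<^sub>C unit_vec_ell2 j) \<longlonglongrightarrow> x"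
proof -
  let ?t = "\<lambda>n. \<Sum>j<n. coord x j *\<^sub>C unit_vec_ell2 j"
  let ?s = "\<lambda>i. (cmod (coord x i))\<^sup>2"
  have "coord (?t n - x) i = - (if i < n then 0 else coord x i)" for n i
    by (simp add: minus_ell2.rep_eq coord_sum scaleC_ell2.rep_eq coord_unit_vec if_distrib cong: if_cong)
  then have "norm (?t n - x) = sqrt (\<Sum>i. (if i < n then 0 else ?s i))" for n
    unfolding norm_ell2_def by (intro arg_cong[where f = sqrt] suminf_cong) simp
  moreover have "(\<Sum>i. (if i < n then 0 else ?s i)) = suminf ?s - (\<Sum>i<n. ?s i)" for n
  proof -
    have "(\<lambda>i. if i \<in> {..<n} then ?s i else 0) sums (\<Sum>i<n. ?s i)"
      by (rule sums_If_finite_set) simp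
    from sums_diff[OF summable_sums[OF summable_coord] this]
    have "(\<lambda>i. ?s i - (if i < n then ?s i else 0)) sums (suminf ?s - (\<Sum>i<n. ?s i))" by simp
    moreover have "(\<lambda>i. ?s i - (if i < n then ?s i else 0)) = (\<lambda>i. if i < n then 0 else ?s i)" by auto
    ultimately show ?thesis by (simp add: sums_iff)
  qed
  moreover have "(\<lambda>n. sqrt (suminf ?s - (\<Sum>i<n. ?s i))) \<longlonglongrightarrow> sqrt (suminf ?s - suminf ?s)"
    by (intro tendsto_intros summable_LIMSEQ summable_coord)
  ultimately have "(\<lambda>n. norm (?t n - x)) \<longlonglongrightarrow> 0" by simp
  then show ?thesis by (simp add: tendsto_norm_zero_iff LIM_zero_iff)
qed

text \<open>
  The range is closed as an isometric image of a complete space, and it is spanned by the images of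
  the unit vectors because every vector is the limit of its truncations.
\<close>

lemma closure_span_eq_range:
  assumes T: "isometric_operators T"
  shows "closure (complex_vector.span (range (\<lambda>j. T (unit_vec_ell2 j)))) = range T"
proof (rule antisym)
  have add: "T (x + y) = T x + T y" and scaleC: "T (c *\<^sub>C x) = c *\<^sub>C T x"
    and norm: "norm (T x) = norm x" for x y c
    using T by (auto simp: isometric_operators_def)
  have bl: "bounded_linear T"
    by (rule bounded_linear_intro[where K = 1])
      (simp_all add: add norm scaleC scaleC_of_real[symmetric])
  have "complete (range T)"
    using complete_isometric_image[of 1 UNIV T] bl by (simp add: norm complete_UNIV)
  then have "closed (range T)" by (rule complete_imp_closed)
  moreover have "complex_vector.subspace (range T)"
  proof (rule complex_vector.subspaceI)
    show "0 \<in> range T" using linear_0[OF bounded_linear.linear[OF bl]] by (metis rangeI)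
  qed (auto simp: add[symmetric] scaleC[symmetric])
  then have "complex_vector.span (range (\<lambda>j. T (unit_vec_ell2 j))) \<subseteq> range T"
    by (intro complex_vector.span_minimal) auto
  ultimately show "closure (complex_vector.span (range (\<lambda>j. T (unit_vec_ell2 j)))) \<subseteq> range T"
    by (intro closure_minimal)
  show "range T \<subseteq> closure (complex_vector.span (range (\<lambda>j. T (unit_vec_ell2 j))))"
  proof
    fix U assume "U \<in> range T"
    then obtain x where U: "U = T x" by blast
    let ?t = "\<lambda>n. \<Sum>j<n. coord x j *\<^sub>C unit_vec_ell2 j"
    have "(\<lambda>n. T (?t n)) \<longlonglongrightarrow> U"
      unfolding U by (intro bounded_linear.tendsto[OF bl] truncation_tendsto)
    moreover have "T (?t n) \<in> complex_vector.span (range (\<lambda>j. T (unit_vec_ell2 j)))" for n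
      unfolding linear_sum[OF bounded_linear.linear[OF bl]] scaleC
      by (intro complex_vector.span_sum complex_vector.span_scale complex_vector.span_base) auto
    ultimately show "U \<in> closure (complex_vector.span (range (\<lambda>j. T (unit_vec_ell2 j))))"
      unfolding closure_sequential by (intro exI[of _ "\<lambda>n. T (?t n)"]) simp
  qed
qed

lemma row_space_eq: "row_space = range row_op"
proof -
  have "row_op (unit_vec_ell2 j) = matrix_unit 0 j" for j
    by (rule blinfun_eqI) (simp add: row_op_apply matrix_unit.rep_eq pair_commute[of "unit_vec_ell2 j"])
  then show ?thesis
    using closure_span_eq_range[OF isometric_row_op] by (simp add: row_space_def)
qed

lemma column_space_eq: "column_space = range col_op"
proof -
  have "col_op (unit_vec_ell2 j) = matrix_unit j 0" for j
    by (rule blinfun_eqI) (simp add: col_op_apply matrix_unit.rep_eq)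
  then show ?thesis
    using closure_span_eq_range[OF isometric_col_op] by (simp add: column_space_def)
qed

lemma row_to_ell2_row_op: "row_to_ell2 (row_op x) = x"
proof -
  have "complex_linear (row_op x)"
    by (simp add: complex_linear_def row_op_apply pair_scaleC_right scaleC_scaleC)
  then show ?thesis
    by (intro ell2_eqI) (simp add: coord_row_to_ell2 row_op_apply scaleC_ell2.rep_eq coord_unit_vec)
qed

lemma column_to_ell2_col_op: "column_to_ell2 (col_op x) = x"
  using scaleC_of_real[of 1 x] by (simp add: column_to_ell2_def col_op_apply coord_unit_vec)

abbreviation row_ell2 :: "ell2 matrix_normed"
  where "row_ell2 \<equiv> transport row_to_ell2 (concrete row_space)"

abbreviation col_ell2 :: "ell2 matrix_normed"
  where "col_ell2 \<equiv> transport column_to_ell2 (concrete column_space)"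

text \<open>
  Since the canonical maps onto \<open>\<ell>\<^sub>2\<close> are inverse to \<open>row_op\<close> and \<open>col_op\<close>, transporting the matrix
  norms of the row and the column space to matrices over \<open>\<ell>\<^sub>2\<close> gives this norm with \<open>T = row_op\<close>
  and \<open>T = col_op\<close>.
\<close>

definition operator_norm_via :: "(ell2 \<Rightarrow> ell2 \<Rightarrow>\<^sub>L ell2) \<Rightarrow> ell2 mat \<Rightarrow> real"
  where "operator_norm_via T A = operator_matrix_norm (map_mat T A)"

lemma row_ell2_simps:
  "points row_ell2 = UNIV" "mat_norm row_ell2 = operator_norm_via row_op"
proof -
  have "inv_into row_space row_to_ell2 = row_op"
    unfolding row_space_eq
    by (rule ext, rule inv_into_f_eq) (auto simp: inj_on_def row_to_ell2_row_op)
  then show "mat_norm row_ell2 = operator_norm_via row_op"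
    by (intro ext) (simp add: transport_def concrete_def operator_norm_via_def)
  show "points row_ell2 = UNIV"
    by (simp add: transport_def concrete_def row_space_eq image_image row_to_ell2_row_op)
qed

lemma col_ell2_simps:
  "points col_ell2 = UNIV" "mat_norm col_ell2 = operator_norm_via col_op"
proof -
  have "inv_into column_space column_to_ell2 = col_op"
    unfolding column_space_eq
    by (rule ext, rule inv_into_f_eq) (auto simp: inj_on_def column_to_ell2_col_op)
  then show "mat_norm col_ell2 = operator_norm_via col_op"
    by (intro ext) (simp add: transport_def concrete_def operator_norm_via_def)
  show "points col_ell2 = UNIV"
    by (simp add: transport_def concrete_def column_space_eq image_image column_to_ell2_col_op)
qed

section \<open>Norms of operator matrices\<close>

text \<open>
  A crude upper bound for all norms on matrices of a fixed size. Regularity of matrix-valued functions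
  follows from that of their entries through this norm.
\<close>

definition entry_norm :: "'a::real_normed_vector mat \<Rightarrow> real"
  where "entry_norm A = (\<Sum>i<dim_row A. \<Sum>j<dim_col A. norm (A $$ (i, j)))"

definition direct_sum_ball :: "nat \<Rightarrow> (nat \<Rightarrow> ell2) set"
  where "direct_sum_ball n = {v. (\<Sum>j<n. (norm (v j))\<^sup>2) \<le> 1}"

definition action_norm :: "(ell2 \<Rightarrow> ell2 \<Rightarrow>\<^sub>L ell2) \<Rightarrow> nat \<Rightarrow> ell2 mat \<Rightarrow> (nat \<Rightarrow> ell2) \<Rightarrow> real"
  where "action_norm T n A v = L2_set (\<lambda>i. norm (\<Sum>j<n. T (A $$ (i, j)) (v j))) {..<n}"

lemma zero_in_direct_sum_ball: "(\<lambda>_. 0) \<in> direct_sum_ball n"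
  by (simp add: direct_sum_ball_def)

context
  fixes T :: "ell2 \<Rightarrow> ell2 \<Rightarrow>\<^sub>L ell2" and n :: nat
  assumes T: "isometric_operators T"
begin

lemma operator_norm_via_eq:
  assumes "A \<in> carrier_mat n n"
  shows "operator_norm_via T A = (SUP v\<in>direct_sum_ball n. action_norm T n A v)"
proof -
  have "(\<Sum>i<n. (norm (\<Sum>j<n. blinfun_apply (map_mat T A $$ (i, j)) (v j)))\<^sup>2)
      = (\<Sum>i<n. (norm (\<Sum>j<n. T (A $$ (i, j)) (v j)))\<^sup>2)" for v
    using assms by (intro sum.cong refl arg_cong[where f = "\<lambda>x. (norm x)\<^sup>2"]) auto
  then show ?thesis
    using assms by (auto simp: operator_norm_via_def operator_matrix_norm_def L2_set_def
        action_norm_def direct_sum_ball_def)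
qed

lemma action_norm_le_entry_norm:
  assumes A: "A \<in> carrier_mat n n" and v: "v \<in> direct_sum_ball n"
  shows "action_norm T n A v \<le> entry_norm A"
proof -
  have v1: "norm (v j) \<le> 1" if "j < n" for j
  proof -
    have "(norm (v j))\<^sup>2 \<le> (\<Sum>j<n. (norm (v j))\<^sup>2)"
      using that by (intro member_le_sum) auto
    then have "(norm (v j))\<^sup>2 \<le> 1" using v by (simp add: direct_sum_ball_def)
    then show ?thesis by (simp add: power_le_one_iff)
  qed
  have "norm (T (A $$ (i, j)) (v j)) \<le> norm (A $$ (i, j))" if "j < n" for i j
  proof -
    have "norm (T (A $$ (i, j)) (v j)) \<le> norm (T (A $$ (i, j))) * norm (v j)"
      by (rule norm_blinfun)
    also have "\<dots> \<le> norm (A $$ (i, j)) * 1"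
      using T v1[OF that] by (intro mult_mono) (auto simp: isometric_operators_def)
    finally show ?thesis by simp
  qed
  then have "(\<Sum>i<n. norm (\<Sum>j<n. T (A $$ (i, j)) (v j))) \<le> entry_norm A"
    using A unfolding entry_norm_def
    by (auto intro!: sum_mono order_trans[OF norm_sum])
  moreover have "action_norm T n A v \<le> (\<Sum>i<n. norm (\<Sum>j<n. T (A $$ (i, j)) (v j)))"
    unfolding action_norm_def by (intro L2_set_le_sum) auto
  ultimately show ?thesis by linarith
qed

lemma action_norm_le_operator_norm_via:
  assumes "A \<in> carrier_mat n n" "v \<in> direct_sum_ball n"
  shows "action_norm T n A v \<le> operator_norm_via T A"
  unfolding operator_norm_via_eq[OF assms(1)]
proof (rule cSUP_upper)
  show "bdd_above (action_norm T n A ` direct_sum_ball n)"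
    by (rule bdd_aboveI2) (rule action_norm_le_entry_norm[OF assms(1)])
qed (rule assms(2))

lemma operator_norm_via_le:
  assumes "A \<in> carrier_mat n n" "\<And>v. v \<in> direct_sum_ball n \<Longrightarrow> action_norm T n A v \<le> K"
  shows "operator_norm_via T A \<le> K"
  unfolding operator_norm_via_eq[OF assms(1)]
proof (rule cSUP_least)
  show "direct_sum_ball n \<noteq> {}" using zero_in_direct_sum_ball by blast
qed (rule assms(2))

lemma operator_norm_via_le_entry_norm:
  "A \<in> carrier_mat n n \<Longrightarrow> operator_norm_via T A \<le> entry_norm A"
  using operator_norm_via_le[of A "entry_norm A"] action_norm_le_entry_norm[of A] by blast

lemma operator_norm_via_nonneg:
  assumes "A \<in> carrier_mat n n"
  shows "0 \<le> operator_norm_via T A"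
proof -
  have "0 \<le> action_norm T n A (\<lambda>_. 0)"
    unfolding action_norm_def by (rule L2_set_nonneg)
  also have "\<dots> \<le> operator_norm_via T A"
    using assms zero_in_direct_sum_ball by (rule action_norm_le_operator_norm_via)
  finally show ?thesis .
qed

lemma operator_norm_via_add:
  assumes A: "A \<in> carrier_mat n n" and B: "B \<in> carrier_mat n n"
  shows "operator_norm_via T (A + B) \<le> operator_norm_via T A + operator_norm_via T B"
proof (rule operator_norm_via_le)
  fix v assume v: "v \<in> direct_sum_ball n"
  have "action_norm T n (A + B) v = L2_set (\<lambda>i. norm ((\<Sum>j<n. T (A $$ (i, j)) (v j)) + (\<Sum>j<n. T (B $$ (i, j)) (v j)))) {..<n}"
    using A B T unfolding action_norm_def by (intro L2_set_cong refl)
      (auto simp: isometric_operators_def blinfun.add_left sum.distrib)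
  also have "\<dots> \<le> L2_set (\<lambda>i. norm (\<Sum>j<n. T (A $$ (i, j)) (v j)) + norm (\<Sum>j<n. T (B $$ (i, j)) (v j))) {..<n}"
    by (intro L2_set_mono norm_triangle_ineq norm_ge_zero)
  also have "\<dots> \<le> action_norm T n A v + action_norm T n B v"
    unfolding action_norm_def by (rule L2_set_triangle_ineq)
  also have "\<dots> \<le> operator_norm_via T A + operator_norm_via T B"
    by (rule add_mono[OF action_norm_le_operator_norm_via[OF A v] action_norm_le_operator_norm_via[OF B v]])
  finally show "action_norm T n (A + B) v \<le> operator_norm_via T A + operator_norm_via T B" .
qed (use A B in auto)

lemma operator_norm_via_diff_commute:
  assumes A: "A \<in> carrier_mat n n" and B: "B \<in> carrier_mat n n"
  shows "operator_norm_via T (A - B) = operator_norm_via T (B - A)"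
proof -
  have diff: "T (x - y) = T x - T y" for x y
  proof -
    have "T ((x - y) + y) = T (x - y) + T y"
      using T unfolding isometric_operators_def by blast
    then show ?thesis by simp
  qed
  have "action_norm T n (A - B) v = action_norm T n (B - A) v" for v
    using A B unfolding action_norm_def by (intro L2_set_cong refl)
      (auto simp: diff blinfun.diff_left sum_subtractf norm_minus_commute)
  then show ?thesis
    using A B by (subst (1 2) operator_norm_via_eq) auto
qed

lemma entry_le_operator_norm_via:
  assumes A: "A \<in> carrier_mat n n" and ij: "i < n" "j < n"
  shows "norm (A $$ (i, j)) \<le> operator_norm_via T A"
proof -
  have "norm (T (A $$ (i, j)) x) \<le> operator_norm_via T A * norm x" for x
  proof (cases "x = 0")
    case False
    define v where "v k = (if k = j then x /\<^sub>R norm x else 0)" for k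
    have "(norm (v k))\<^sup>2 = (if k = j then 1 else 0)" for k
      using False by (simp add: v_def)
    then have v: "v \<in> direct_sum_ball n" using ij by (simp add: direct_sum_ball_def)
    have "(\<Sum>k<n. T (A $$ (i, k)) (v k)) = (\<Sum>k<n. if k = j then T (A $$ (i, j)) (x /\<^sub>R norm x) else 0)"
      by (intro sum.cong) (auto simp: v_def)
    also have "\<dots> = T (A $$ (i, j)) x /\<^sub>R norm x"
      using ij by (simp add: blinfun.scaleR_right)
    finally have "norm (T (A $$ (i, j)) x) / norm x = norm (\<Sum>k<n. T (A $$ (i, k)) (v k))"
      by (simp add: divide_inverse mult.commute)
    also have "\<dots> \<le> action_norm T n A v"
      unfolding action_norm_def using ij by (intro member_le_L2_set) auto
    also have "\<dots> \<le> operator_norm_via T A"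
      by (rule action_norm_le_operator_norm_via[OF A v])
    finally show ?thesis using False by (simp add: field_simps)
  qed simp
  then have "norm (T (A $$ (i, j))) \<le> operator_norm_via T A"
    using operator_norm_via_nonneg[OF A] by (intro norm_blinfun_bound) auto
  then show ?thesis using T by (simp add: isometric_operators_def)
qed

end

section \<open>Calderon functions\<close>

text \<open>
  The conditions on a scalar function \<open>g\<close> under which multiplying fixed vectors by \<open>g\<close> gives
  functions in Calderon's class.
\<close>

definition admissible :: "(complex \<Rightarrow> complex) \<Rightarrow> bool"
  where "admissible g \<longleftrightarrow> (\<forall>z. g field_differentiable at z) \<and> (\<exists>K. \<forall>z\<in>strip. cmod (g z) \<le> K)
    \<and> ((\<lambda>t. g (Complex 0 t)) \<longlongrightarrow> 0) at_infinity \<and> ((\<lambda>t. g (Complex 1 t)) \<longlongrightarrow> 0) at_infinity"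

text \<open>
  The quadratic term forces decay at infinity and becomes negligible as \<open>d\<close> tends to \<open>0\<close>. The linear
  term shifts weight between the two boundary lines, while the value at \<open>\<theta>\<close> stays \<open>1\<close>.
\<close>

definition gaussian :: "real \<Rightarrow> real \<Rightarrow> real \<Rightarrow> complex \<Rightarrow> complex"
  where "gaussian \<theta> d l z =
    exp (complex_of_real d * (z\<^sup>2 - complex_of_real (\<theta>\<^sup>2)) + complex_of_real l * (z - complex_of_real \<theta>))"

lemma gaussian_at [simp]: "gaussian \<theta> d l (complex_of_real \<theta>) = 1"
  by (simp add: gaussian_def)

lemma norm_gaussian:
  "cmod (gaussian \<theta> d l z) = exp (d * ((Re z)\<^sup>2 - (Im z)\<^sup>2 - \<theta>\<^sup>2) + l * (Re z - \<theta>))"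
  by (simp add: gaussian_def power2_eq_square)

lemma admissible_gaussian:
  assumes "d > 0"
  shows "admissible (gaussian \<theta> d l)"
  unfolding admissible_def
proof (intro conjI allI)
  have "((\<lambda>z. gaussian \<theta> d l z) has_field_derivative
     gaussian \<theta> d l z * (complex_of_real d * (2 * z) + complex_of_real l)) (at z)" for z
    unfolding gaussian_def by (auto intro!: derivative_eq_intros)
  then show "gaussian \<theta> d l field_differentiable at z" for z
    unfolding field_differentiable_def by blast
  have "cmod (gaussian \<theta> d l z) \<le> exp (d + \<bar>l\<bar> * (1 + \<bar>\<theta>\<bar>))" if z: "z \<in> strip" for z
  proof -
    have "(Re z)\<^sup>2 \<le> 1" using z by (simp add: strip_def power_le_one)
    then have "(Re z)\<^sup>2 - (Im z)\<^sup>2 - \<theta>\<^sup>2 \<le> 1"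
      using zero_le_power2[of "Im z"] zero_le_power2[of \<theta>] by linarith
    then have "d * ((Re z)\<^sup>2 - (Im z)\<^sup>2 - \<theta>\<^sup>2) \<le> d"
      using assms by (metis mult.right_neutral mult_left_mono less_imp_le)
    moreover have "l * (Re z - \<theta>) \<le> \<bar>l\<bar> * (1 + \<bar>\<theta>\<bar>)"
    proof -
      have "l * (Re z - \<theta>) \<le> \<bar>l\<bar> * \<bar>Re z - \<theta>\<bar>" by (metis abs_ge_self abs_mult)
      also have "\<bar>Re z - \<theta>\<bar> \<le> 1 + \<bar>\<theta>\<bar>" using z by (auto simp: strip_def)
      finally show ?thesis by (simp add: mult_left_mono)
    qed
    ultimately show ?thesis by (simp add: norm_gaussian)
  qed
  then show "\<exists>K. \<forall>z\<in>strip. cmod (gaussian \<theta> d l z) \<le> K" by blast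
  have vanish: "((\<lambda>t. gaussian \<theta> d l (Complex a t)) \<longlongrightarrow> 0) at_infinity" for a
  proof -
    have top: "((\<lambda>t. exp (d * (a\<^sup>2 - t\<^sup>2 - \<theta>\<^sup>2) + l * (a - \<theta>))) \<longlongrightarrow> 0) at_top"
      using assms by real_asymp
    have bot: "((\<lambda>t. exp (d * (a\<^sup>2 - t\<^sup>2 - \<theta>\<^sup>2) + l * (a - \<theta>))) \<longlongrightarrow> 0) at_bot"
      using assms by real_asymp
    have "((\<lambda>t. cmod (gaussian \<theta> d l (Complex a t))) \<longlongrightarrow> 0) at_infinity"
      unfolding norm_gaussian at_infinity_eq_at_top_bot using top bot
      by (simp add: filterlim_sup)
    then show ?thesis by (rule tendsto_norm_zero_cancel)
  qed
  show "((\<lambda>t. gaussian \<theta> d l (Complex 0 t)) \<longlongrightarrow> 0) at_infinity"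
    "((\<lambda>t. gaussian \<theta> d l (Complex 1 t)) \<longlongrightarrow> 0) at_infinity"
    by (rule vanish)+
qed

text \<open>
  All conditions in Calderon's class can be verified in one norm \<open>D\<close> that dominates the others.
  The statement does not speak of a vector space since it is used both for vectors and for matrices
  of a fixed size.
\<close>

lemma calderon_functionsI:
  fixes S :: "'v::{plus,minus,scaleC} set"
  assumes sum: "sum_space S S = S"
    and sum_norm: "\<And>x. x \<in> S \<Longrightarrow> 0 \<le> sum_norm S N\<^sub>0 S N\<^sub>1 x \<and> sum_norm S N\<^sub>0 S N\<^sub>1 x \<le> D x"
    and N: "\<And>x. x \<in> S \<Longrightarrow> 0 \<le> N\<^sub>0 x \<and> N\<^sub>0 x \<le> D x" "\<And>x. x \<in> S \<Longrightarrow> 0 \<le> N\<^sub>1 x \<and> N\<^sub>1 x \<le> D x"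
    and minus: "\<And>x y. x \<in> S \<Longrightarrow> y \<in> S \<Longrightarrow> x - y \<in> S"
    and scale: "\<And>c x. x \<in> S \<Longrightarrow> c *\<^sub>C x \<in> S"
    and fS: "\<And>z. f z \<in> S" and bdd: "\<And>z. z \<in> strip \<Longrightarrow> D (f z) \<le> K"
    and cont: "\<And>z. ((\<lambda>w. D (f w - f z)) \<longlongrightarrow> 0) (at z)"
    and diff: "\<And>z. \<exists>L\<in>S. ((\<lambda>w. D (inverse (w - z) *\<^sub>C (f w - f z) - L)) \<longlongrightarrow> 0) (at z)"
    and vanish: "((\<lambda>t. D (f (Complex 0 t))) \<longlongrightarrow> 0) at_infinity"
      "((\<lambda>t. D (f (Complex 1 t))) \<longlongrightarrow> 0) at_infinity"
  shows "f \<in> calderon_functions S N\<^sub>0 S N\<^sub>1"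
proof -
  have squeeze: "((\<lambda>w. P (h w)) \<longlongrightarrow> 0) F"
    if "\<And>x. x \<in> S \<Longrightarrow> 0 \<le> P x \<and> P x \<le> D x" "\<And>w. h w \<in> S" "((\<lambda>w. D (h w)) \<longlongrightarrow> 0) F"
    for P h and F :: "'b filter"
    using that(3) by (rule Lim_null_comparison[rotated]) (use that in auto)
  have line: "((\<lambda>s. D (f (Complex a s) - f (Complex a t))) \<longlongrightarrow> 0) (at t)" for a t
  proof -
    have "filterlim (\<lambda>s. Complex a s) (at (Complex a t)) (at t)"
      by (intro filterlim_atI tendsto_Complex tendsto_intros) (auto simp: eventually_at_filter)
    from filterlim_compose[OF cont this] show ?thesis .
  qed
  show ?thesis
    unfolding calderon_functions_def Let_def sum mem_Collect_eq boundary_function_def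
  proof (intro conjI ballI allI)
    show "\<exists>K. \<forall>z\<in>strip. sum_norm S N\<^sub>0 S N\<^sub>1 (f z) \<le> K"
      using sum_norm fS bdd by (intro exI[of _ K]) (meson order_trans)
    show "((\<lambda>w. sum_norm S N\<^sub>0 S N\<^sub>1 (f w - f z)) \<longlongrightarrow> 0) (at z within strip)" for z
      by (rule tendsto_within_subset[OF _ subset_UNIV]) (intro squeeze[OF sum_norm] minus fS cont)
    show "\<exists>L\<in>S. ((\<lambda>w. sum_norm S N\<^sub>0 S N\<^sub>1 (inverse (w - z) *\<^sub>C (f w - f z) - L)) \<longlongrightarrow> 0) (at z)" for z
    proof -
      obtain L where L: "L \<in> S" "((\<lambda>w. D (inverse (w - z) *\<^sub>C (f w - f z) - L)) \<longlongrightarrow> 0) (at z)"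
        using diff by blast
      then have "((\<lambda>w. sum_norm S N\<^sub>0 S N\<^sub>1 (inverse (w - z) *\<^sub>C (f w - f z) - L)) \<longlongrightarrow> 0) (at z)"
        by (intro squeeze[OF sum_norm] minus scale fS)
      then show ?thesis using L(1) by blast
    qed
    show "((\<lambda>s. N\<^sub>0 (f (Complex 0 s) - f (Complex 0 t))) \<longlongrightarrow> 0) (at t)" for t
      by (intro squeeze[OF N(1)] minus fS line)
    show "((\<lambda>s. N\<^sub>1 (f (Complex 1 s) - f (Complex 1 t))) \<longlongrightarrow> 0) (at t)" for t
      by (intro squeeze[OF N(2)] minus fS line)
    show "((\<lambda>t. N\<^sub>0 (f (Complex 0 t))) \<longlongrightarrow> 0) at_infinity"
      by (intro squeeze[OF N(1)] fS vanish)
    show "((\<lambda>t. N\<^sub>1 (f (Complex 1 t))) \<longlongrightarrow> 0) at_infinity"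
      by (intro squeeze[OF N(2)] fS vanish)
  qed (rule fS)+
qed

section \<open>Couples of matrix norms\<close>

text \<open>
  The properties of the row and the column norm on which the general part of the interpolation
  argument depends. The bounds by entries make both norms equivalent to \<open>entry_norm\<close> on the
  matrices of size \<open>n\<close>.
\<close>

locale matrix_seminorm =
  fixes n :: nat and N :: "ell2 mat \<Rightarrow> real"
  assumes nonneg: "A \<in> carrier_mat n n \<Longrightarrow> 0 \<le> N A"
    and le_entry_norm: "A \<in> carrier_mat n n \<Longrightarrow> N A \<le> entry_norm A"
    and add_le: "A \<in> carrier_mat n n \<Longrightarrow> B \<in> carrier_mat n n \<Longrightarrow> N (A + B) \<le> N A + N B"
    and diff_commute: "A \<in> carrier_mat n n \<Longrightarrow> B \<in> carrier_mat n n \<Longrightarrow> N (A - B) = N (B - A)"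
    and entry_le: "A \<in> carrier_mat n n \<Longrightarrow> i < n \<Longrightarrow> j < n \<Longrightarrow> norm (A $$ (i, j)) \<le> N A"

lemma matrix_seminorm_operator_norm_via:
  assumes "isometric_operators T"
  shows "matrix_seminorm n (operator_norm_via T)"
  using assms
  by unfold_locales (rule operator_norm_via_nonneg operator_norm_via_le_entry_norm operator_norm_via_add
      operator_norm_via_diff_commute entry_le_operator_norm_via; assumption)+

text \<open>
  The linear functionals on matrices over \<open>\<ell>\<^sub>2\<close> that bound interpolation norms from below.
\<close>

definition mat_pairing :: "nat \<Rightarrow> (nat \<Rightarrow> nat \<Rightarrow> ell2) \<Rightarrow> ell2 mat \<Rightarrow> complex"
  where "mat_pairing n W A = (\<Sum>i<n. \<Sum>j<n. pair (A $$ (i, j)) (W i j))"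

lemma mat_pairing_add:
  assumes "A \<in> carrier_mat n n" "B \<in> carrier_mat n n"
  shows "mat_pairing n W (A + B) = mat_pairing n W A + mat_pairing n W B"
proof -
  have "mat_pairing n W (A + B) = (\<Sum>i<n. \<Sum>j<n. pair (A $$ (i, j)) (W i j) + pair (B $$ (i, j)) (W i j))"
    unfolding mat_pairing_def using assms by (intro sum.cong refl) (auto simp: pair_add_left)
  then show ?thesis by (simp only: mat_pairing_def sum.distrib)
qed

lemma mat_pairing_diff:
  assumes "A \<in> carrier_mat n n" "B \<in> carrier_mat n n"
  shows "mat_pairing n W (A - B) = mat_pairing n W A - mat_pairing n W B"
proof -
  have "mat_pairing n W (A - B) = (\<Sum>i<n. \<Sum>j<n. pair (A $$ (i, j)) (W i j) - pair (B $$ (i, j)) (W i j))"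
    unfolding mat_pairing_def using assms by (intro sum.cong refl) (auto simp: pair_diff_left)
  then show ?thesis by (simp only: mat_pairing_def sum_subtractf)
qed

lemma scaleC_mat_carrier: "A \<in> carrier_mat n n \<Longrightarrow> c *\<^sub>C A \<in> carrier_mat n n"
  by (simp add: scaleC_mat_def)

lemma mat_pairing_scaleC:
  assumes "A \<in> carrier_mat n n"
  shows "mat_pairing n W (c *\<^sub>C A) = c * mat_pairing n W A"
proof -
  have "mat_pairing n W (c *\<^sub>C A) = (\<Sum>i<n. \<Sum>j<n. c * pair (A $$ (i, j)) (W i j))"
    unfolding mat_pairing_def scaleC_mat_def using assms
    by (intro sum.cong refl) (auto simp: pair_scaleC_left)
  then show ?thesis by (simp only: mat_pairing_def sum_distrib_left)
qed

context matrix_seminorm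
begin

lemma abs_diff_le:
  assumes "A \<in> carrier_mat n n" "B \<in> carrier_mat n n"
  shows "\<bar>N A - N B\<bar> \<le> N (A - B)"
proof -
  have "A = (A - B) + B" "B = (B - A) + A"
    using assms by (auto intro!: eq_matI)
  then have "N A \<le> N (A - B) + N B" "N B \<le> N (B - A) + N A"
    using add_le[of "A - B" B] add_le[of "B - A" A] assms by (metis minus_carrier_mat)+
  then show ?thesis using diff_commute[OF assms] by linarith
qed

lemma mat_pairing_le:
  assumes "A \<in> carrier_mat n n"
  shows "cmod (mat_pairing n W A) \<le> (\<Sum>i<n. \<Sum>j<n. norm (W i j)) * N A"
proof -
  have "cmod (mat_pairing n W A) \<le> (\<Sum>i<n. \<Sum>j<n. cmod (pair (A $$ (i, j)) (W i j)))"
    unfolding mat_pairing_def by (intro order_trans[OF norm_sum] sum_mono order_trans[OF norm_sum] order_refl)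
  also have "\<dots> \<le> (\<Sum>i<n. \<Sum>j<n. norm (W i j) * N A)"
  proof (intro sum_mono)
    fix i j assume "i \<in> {..<n}" "j \<in> {..<n}"
    then have "norm (A $$ (i, j)) * norm (W i j) \<le> N A * norm (W i j)"
      using entry_le[OF assms] by (intro mult_right_mono) auto
    then show "cmod (pair (A $$ (i, j)) (W i j)) \<le> norm (W i j) * N A"
      using norm_pair_le[of "A $$ (i, j)" "W i j"] by (simp add: mult.commute)
  qed
  finally show ?thesis by (simp only: sum_distrib_right)
qed

text \<open>
  The suprema in the definition of the interpolation norm are taken over boundary values, and a
  supremum of reals bounds its set only if that set is bounded.
\<close>

lemma boundary_function_bdd_above:
  assumes "boundary_function (carrier_mat n n) N g"
  shows "bdd_above (range (\<lambda>t. N (g t)))"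
proof -
  have gS: "g t \<in> carrier_mat n n" and cont: "((\<lambda>s. N (g s - g t)) \<longlongrightarrow> 0) (at t)"
    and vanish: "((\<lambda>t. N (g t)) \<longlongrightarrow> 0) at_infinity" for t
    using assms by (auto simp: boundary_function_def)
  have "((\<lambda>s. N (g s)) \<longlongrightarrow> N (g t)) (at t)" for t
  proof (rule LIM_zero_cancel, rule Lim_null_comparison[OF _ cont])
    show "\<forall>\<^sub>F s in at t. norm (N (g s) - N (g t)) \<le> N (g s - g t)"
      using abs_diff_le[OF gS gS] by simp
  qed
  then have "continuous_on {- b..b} (\<lambda>t. N (g t))" for b
    by (intro continuous_at_imp_continuous_on) (simp add: isCont_def)
  then have "bounded ((\<lambda>t. N (g t)) ` {- b..b})" for b
    by (intro compact_imp_bounded compact_continuous_image) auto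
  moreover obtain b where b: "\<And>t. b \<le> \<bar>t\<bar> \<Longrightarrow> N (g t) < 1"
  proof -
    have "\<forall>\<^sub>F t in at_infinity. N (g t) < 1"
      using vanish by (rule order_tendstoD(2)) simp
    then show ?thesis using that by (auto simp: eventually_at_infinity)
  qed
  ultimately obtain K where K: "\<And>t. t \<in> {- b..b} \<Longrightarrow> \<bar>N (g t)\<bar> \<le> K"
    unfolding bounded_iff by (metis imageI real_norm_def)
  have "N (g t) \<le> max 1 K" for t
  proof (cases "b \<le> \<bar>t\<bar>")
    case True
    then show ?thesis using b[of t] by linarith
  next
    case False
    then have "t \<in> {- b..b}" by auto
    from K[OF this] show ?thesis by linarith
  qed
  then show ?thesis by (intro bdd_aboveI2)
qed

end

lemma entry_norm_zero [simp]: "entry_norm (0\<^sub>m n n :: 'a::real_normed_vector mat) = 0"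
  by (simp add: entry_norm_def)

locale matrix_couple = N\<^sub>0: matrix_seminorm n N\<^sub>0 + N\<^sub>1: matrix_seminorm n N\<^sub>1 for n N\<^sub>0 N\<^sub>1
begin

abbreviation "M \<equiv> carrier_mat n n :: ell2 mat set"

lemma sum_space_carrier: "sum_space M M = M"
proof -
  have "A \<in> sum_space M M" if "A \<in> M" for A
    unfolding sum_space_def using that
    by (intro CollectI exI[of _ A] exI[of _ "0\<^sub>m n n"]) auto
  moreover have "sum_space M M \<subseteq> M" by (auto simp: sum_space_def)
  ultimately show ?thesis by blast
qed

lemma sum_norm_set_nonempty:
  assumes "A \<in> M"
  shows "N\<^sub>0 A + N\<^sub>1 (0\<^sub>m n n) \<in> {N\<^sub>0 a + N\<^sub>1 b | a b. a \<in> M \<and> b \<in> M \<and> A = a + b}"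
  using assms by (intro CollectI exI[of _ A] exI[of _ "0\<^sub>m n n"]) auto

lemma sum_norm_nonneg:
  assumes "A \<in> M"
  shows "0 \<le> sum_norm M N\<^sub>0 M N\<^sub>1 A"
  unfolding sum_norm_def using sum_norm_set_nonempty[OF assms]
  by (intro cInf_greatest) (blast, auto simp: N\<^sub>0.nonneg N\<^sub>1.nonneg)

lemma sum_norm_le_entry_norm:
  assumes "A \<in> M"
  shows "sum_norm M N\<^sub>0 M N\<^sub>1 A \<le> entry_norm A"
proof -
  have "sum_norm M N\<^sub>0 M N\<^sub>1 A \<le> N\<^sub>0 A + N\<^sub>1 (0\<^sub>m n n)"
    unfolding sum_norm_def
    by (rule cInf_lower[OF sum_norm_set_nonempty[OF assms]])
      (auto intro!: bdd_belowI[of _ 0] simp: N\<^sub>0.nonneg N\<^sub>1.nonneg)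
  also have "\<dots> \<le> entry_norm A + entry_norm (0\<^sub>m n n :: ell2 mat)"
    using assms by (intro add_mono N\<^sub>0.le_entry_norm N\<^sub>1.le_entry_norm) auto
  finally show ?thesis by simp
qed

text \<open>
  This transfers continuity and differentiability from Calderon's class, where they are expressed in
  the norm of the sum space, to scalar functions.
\<close>

lemma mat_pairing_le_sum_norm:
  assumes A: "A \<in> M"
  shows "cmod (mat_pairing n W A) \<le> (\<Sum>i<n. \<Sum>j<n. norm (W i j)) * sum_norm M N\<^sub>0 M N\<^sub>1 A"
proof -
  define \<kappa> where "\<kappa> = (\<Sum>i<n. \<Sum>j<n. norm (W i j))"
  have \<kappa>: "\<kappa> \<ge> 0" by (simp add: \<kappa>_def sum_nonneg)
  have le: "cmod (mat_pairing n W A) \<le> \<kappa> * x"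
    if x: "x \<in> {N\<^sub>0 a + N\<^sub>1 b | a b. a \<in> M \<and> b \<in> M \<and> A = a + b}" for x
  proof -
    obtain a b where ab: "x = N\<^sub>0 a + N\<^sub>1 b" "a \<in> M" "b \<in> M" "A = a + b" using x by blast
    have "cmod (mat_pairing n W A) \<le> cmod (mat_pairing n W a) + cmod (mat_pairing n W b)"
      using ab by (simp add: mat_pairing_add norm_triangle_ineq)
    also have "\<dots> \<le> \<kappa> * N\<^sub>0 a + \<kappa> * N\<^sub>1 b"
      unfolding \<kappa>_def using ab by (intro add_mono N\<^sub>0.mat_pairing_le N\<^sub>1.mat_pairing_le)
    finally show ?thesis by (simp add: ab distrib_left)
  qed
  show ?thesis
  proof (cases "\<kappa> = 0")
    case True
    then show ?thesis using le[OF sum_norm_set_nonempty[OF A]] by (simp add: \<kappa>_def[symmetric])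
  next
    case False
    then have "cmod (mat_pairing n W A) / \<kappa> \<le> sum_norm M N\<^sub>0 M N\<^sub>1 A"
      unfolding sum_norm_def using \<kappa> le sum_norm_set_nonempty[OF A]
      by (intro cInf_greatest) (blast, simp add: divide_le_eq mult.commute)
    then show ?thesis using False \<kappa> by (simp add: \<kappa>_def[symmetric] divide_le_eq mult.commute)
  qed
qed

lemma calderon_functions_mat:
  assumes g: "\<And>i j. admissible (g i j)"
  shows "(\<lambda>z. mat n n (\<lambda>(i, j). g i j z *\<^sub>C a i j)) \<in> calderon_functions M N\<^sub>0 M N\<^sub>1"
proof -
  let ?f = "\<lambda>z. mat n n (\<lambda>(i, j). g i j z *\<^sub>C a i j)"
  have "\<exists>K. \<forall>z\<in>strip. cmod (g i j z) \<le> K" for i j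
    using g by (simp add: admissible_def)
  then obtain K where K: "\<And>i j z. z \<in> strip \<Longrightarrow> cmod (g i j z) \<le> K i j" by metis
  have scaleC_diff: "(c - d) *\<^sub>C x = c *\<^sub>C x - d *\<^sub>C x" for c d and x :: ell2
    by (rule complex_vector.scale_left_diff_distrib)
  have entry_f: "entry_norm (mat n n (\<lambda>(i, j). h i j *\<^sub>C a i j)) = (\<Sum>i<n. \<Sum>j<n. cmod (h i j) * norm (a i j))" for h
    by (simp add: entry_norm_def norm_scaleC)
  have diff_f: "?f w - ?f z = mat n n (\<lambda>(i, j). (g i j w - g i j z) *\<^sub>C a i j)" for w z
    by (rule eq_matI) (auto simp: scaleC_diff)
  have lim: "((\<lambda>w. entry_norm (mat n n (\<lambda>(i, j). h w i j *\<^sub>C a i j))) \<longlongrightarrow> 0) F"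
    if "\<And>i j. ((\<lambda>w. h w i j) \<longlongrightarrow> 0) F" for h and F :: "'b filter"
    unfolding entry_f by (intro tendsto_null_sum tendsto_mult_left_zero tendsto_norm_zero that)
  show ?thesis
  proof (rule calderon_functionsI[where D = entry_norm and K = "\<Sum>i<n. \<Sum>j<n. K i j * norm (a i j)"])
    fix z
    show "((\<lambda>w. entry_norm (?f w - ?f z)) \<longlongrightarrow> 0) (at z)"
      unfolding diff_f
    proof (rule lim)
      fix i j
      have "isCont (g i j) z"
        using g[of i j] by (auto simp: admissible_def field_differentiable_imp_continuous_at)
      then show "((\<lambda>w. g i j w - g i j z) \<longlongrightarrow> 0) (at z)"
        by (intro LIM_zero) (simp add: isCont_def)
    qed
    define L where "L = mat n n (\<lambda>(i, j). deriv (g i j) z *\<^sub>C a i j)"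
    have L: "inverse (w - z) *\<^sub>C (?f w - ?f z) - L
        = mat n n (\<lambda>(i, j). ((g i j w - g i j z) / (w - z) - deriv (g i j) z) *\<^sub>C a i j)" for w
      by (rule eq_matI)
        (auto simp: L_def scaleC_mat_def diff_f scaleC_diff scaleC_scaleC divide_inverse mult.commute
          complex_vector.scale_right_diff_distrib right_diff_distrib)
    have "((\<lambda>w. entry_norm (inverse (w - z) *\<^sub>C (?f w - ?f z) - L)) \<longlongrightarrow> 0) (at z)"
      unfolding L
    proof (rule lim)
      fix i j
      have "(g i j has_field_derivative deriv (g i j) z) (at z)"
        using g[of i j] by (simp add: admissible_def DERIV_deriv_iff_field_differentiable)
      then show "((\<lambda>w. (g i j w - g i j z) / (w - z) - deriv (g i j) z) \<longlongrightarrow> 0) (at z)"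
        by (intro LIM_zero) (simp add: has_field_derivative_iff)
    qed
    moreover have "L \<in> M" by (simp add: L_def)
    ultimately show "\<exists>L\<in>M. ((\<lambda>w. entry_norm (inverse (w - z) *\<^sub>C (?f w - ?f z) - L)) \<longlongrightarrow> 0) (at z)"
      by blast
  next
    fix z assume "z \<in> strip"
    then show "entry_norm (?f z) \<le> (\<Sum>i<n. \<Sum>j<n. K i j * norm (a i j))"
      unfolding entry_f using K by (intro sum_mono mult_right_mono) auto
  next
    show "((\<lambda>t. entry_norm (?f (Complex 0 t))) \<longlongrightarrow> 0) at_infinity"
      "((\<lambda>t. entry_norm (?f (Complex 1 t))) \<longlongrightarrow> 0) at_infinity"
      using g by (intro lim; simp add: admissible_def)+
  qed (simp_all add: sum_space_carrier sum_norm_nonneg sum_norm_le_entry_norm scaleC_mat_carrier minus_carrier_mat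
      N\<^sub>0.nonneg N\<^sub>0.le_entry_norm N\<^sub>1.nonneg N\<^sub>1.le_entry_norm)
qed

lemma calderon_functions_bdd_above:
  assumes "f \<in> calderon_functions M N\<^sub>0 M N\<^sub>1"
  shows "bdd_above (range (\<lambda>t. N\<^sub>0 (f (Complex 0 t))))" "bdd_above (range (\<lambda>t. N\<^sub>1 (f (Complex 1 t))))"
  using assms unfolding calderon_functions_def Let_def
  by (auto intro!: N\<^sub>0.boundary_function_bdd_above N\<^sub>1.boundary_function_bdd_above)

lemma calderon_functions_in_carrier:
  assumes "f \<in> calderon_functions M N\<^sub>0 M N\<^sub>1" "z \<in> strip"
  shows "f z \<in> M"
  using assms unfolding calderon_functions_def Let_def sum_space_carrier by blast

lemma interpolation_norm_le:
  assumes f: "f \<in> calderon_functions M N\<^sub>0 M N\<^sub>1" and at: "f (complex_of_real \<theta>) = A"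
    and le: "\<And>t. N\<^sub>0 (f (Complex 0 t)) \<le> K" "\<And>t. N\<^sub>1 (f (Complex 1 t)) \<le> K"
  shows "interpolation_norm M N\<^sub>0 M N\<^sub>1 \<theta> A \<le> K"
proof -
  have "interpolation_norm M N\<^sub>0 M N\<^sub>1 \<theta> A
      \<le> max (SUP t. N\<^sub>0 (f (Complex 0 t))) (SUP t. N\<^sub>1 (f (Complex 1 t)))"
    unfolding interpolation_norm_def
  proof (rule cInf_lower)
    show "bdd_below {max (SUP t. N\<^sub>0 (f (Complex 0 t))) (SUP t. N\<^sub>1 (f (Complex 1 t))) | f.
      f \<in> calderon_functions M N\<^sub>0 M N\<^sub>1 \<and> f (complex_of_real \<theta>) = A}"
    proof (rule bdd_belowI[of _ 0], clarify)
      fix f assume f: "f \<in> calderon_functions M N\<^sub>0 M N\<^sub>1"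
      have "0 \<le> N\<^sub>0 (f (Complex 0 0))"
        by (intro N\<^sub>0.nonneg calderon_functions_in_carrier[OF f]) (simp add: strip_def)
      also have "\<dots> \<le> (SUP t. N\<^sub>0 (f (Complex 0 t)))"
        by (rule cSUP_upper[OF UNIV_I calderon_functions_bdd_above(1)[OF f]])
      finally show "0 \<le> max (SUP t. N\<^sub>0 (f (Complex 0 t))) (SUP t. N\<^sub>1 (f (Complex 1 t)))"
        by linarith
    qed
  qed (use f at in blast)
  also have "\<dots> \<le> K"
    using le by (intro max.boundedI cSUP_least) auto
  finally show ?thesis .
qed

text \<open>
  Applying the functional to a function of Calderon's class gives a scalar function on the strip,
  bounded by \<open>K\<^sub>0 * B\<close> and \<open>K\<^sub>1 * B\<close> on the two boundary lines.
\<close>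

lemma mat_pairing_three_lines:
  assumes f: "f \<in> calderon_functions M N\<^sub>0 M N\<^sub>1" and \<theta>: "\<theta> \<in> {0..1}"
    and K: "0 < K\<^sub>0" "0 < K\<^sub>1"
    and W: "\<And>A. A \<in> M \<Longrightarrow> cmod (mat_pairing n W A) \<le> K\<^sub>0 * N\<^sub>0 A"
      "\<And>A. A \<in> M \<Longrightarrow> cmod (mat_pairing n W A) \<le> K\<^sub>1 * N\<^sub>1 A"
    and B: "\<And>t. N\<^sub>0 (f (Complex 0 t)) \<le> B" "\<And>t. N\<^sub>1 (f (Complex 1 t)) \<le> B" "0 < B"
  shows "cmod (mat_pairing n W (f (complex_of_real \<theta>))) \<le> K\<^sub>0 powr (1 - \<theta>) * K\<^sub>1 powr \<theta> * B"
proof -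
  let ?N = "sum_norm M N\<^sub>0 M N\<^sub>1"
  let ?\<phi> = "\<lambda>z. mat_pairing n W (f z)"
  define \<kappa> where "\<kappa> = (\<Sum>i<n. \<Sum>j<n. norm (W i j))"
  have \<kappa>: "\<kappa> \<ge> 0" by (simp add: \<kappa>_def sum_nonneg)
  have fM: "f z \<in> M" if "z \<in> strip" for z
    using calderon_functions_in_carrier[OF f that] .
  have le: "cmod (mat_pairing n W A) \<le> \<kappa> * ?N A" if "A \<in> M" for A
    unfolding \<kappa>_def by (rule mat_pairing_le_sum_norm[OF that])
  obtain K where bdd: "\<And>z. z \<in> strip \<Longrightarrow> ?N (f z) \<le> K"
    using f unfolding calderon_functions_def Let_def by blast
  have cont: "((\<lambda>w. ?N (f w - f z)) \<longlongrightarrow> 0) (at z within strip)" if "z \<in> strip" for z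
    using f that unfolding calderon_functions_def Let_def by blast
  have diff: "\<exists>L\<in>M. ((\<lambda>w. ?N (inverse (w - z) *\<^sub>C (f w - f z) - L)) \<longlongrightarrow> 0) (at z)"
    if "z \<in> interior strip" for z
    using f that unfolding calderon_functions_def Let_def sum_space_carrier by blast
  have "cmod (?\<phi> (complex_of_real \<theta>)) \<le> (K\<^sub>0 * B) powr (1 - \<theta>) * (K\<^sub>1 * B) powr \<theta>"
  proof (rule three_lines[where g = ?\<phi> and M = "\<kappa> * K"])
    show "cmod (?\<phi> z) \<le> \<kappa> * K" if "z \<in> strip" for z
      using le[OF fM[OF that]] mult_left_mono[OF bdd[OF that] \<kappa>] by linarith
    show "continuous_on strip ?\<phi>"
      unfolding continuous_on_def
    proof
      fix z assume z: "z \<in> strip"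
      show "(?\<phi> \<longlongrightarrow> ?\<phi> z) (at z within strip)"
      proof (rule LIM_zero_cancel, rule Lim_null_comparison)
        show "((\<lambda>w. \<kappa> * ?N (f w - f z)) \<longlongrightarrow> 0) (at z within strip)"
          using tendsto_mult_right_zero[OF cont[OF z]] .
        show "\<forall>\<^sub>F w in at z within strip. norm (?\<phi> w - ?\<phi> z) \<le> \<kappa> * ?N (f w - f z)"
          unfolding eventually_at_filter
        proof (intro always_eventually allI impI)
          fix w assume "w \<in> strip"
          then show "norm (?\<phi> w - ?\<phi> z) \<le> \<kappa> * ?N (f w - f z)"
            using le[of "f w - f z"] fM[of w] fM[OF z] by (simp add: mat_pairing_diff minus_carrier_mat)
        qed
      qed
    qed
    have "?\<phi> field_differentiable at z" if z: "z \<in> interior strip" for z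
    proof -
      obtain L where L: "L \<in> M" "((\<lambda>w. ?N (inverse (w - z) *\<^sub>C (f w - f z) - L)) \<longlongrightarrow> 0) (at z)"
        using diff[OF z] by blast
      have zs: "z \<in> strip" using z interior_subset by blast
      have "((\<lambda>w. (?\<phi> w - ?\<phi> z) / (w - z)) \<longlongrightarrow> mat_pairing n W L) (at z)"
      proof (rule LIM_zero_cancel, rule Lim_null_comparison)
        show "((\<lambda>w. \<kappa> * ?N (inverse (w - z) *\<^sub>C (f w - f z) - L)) \<longlongrightarrow> 0) (at z)"
          using tendsto_mult_right_zero[OF L(2)] .
        have "\<forall>\<^sub>F w in at z. w \<in> interior strip"
          using z by (intro eventually_at_in_open') auto
        then show "\<forall>\<^sub>F w in at z. norm ((?\<phi> w - ?\<phi> z) / (w - z) - mat_pairing n W L)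
            \<le> \<kappa> * ?N (inverse (w - z) *\<^sub>C (f w - f z) - L)"
        proof eventually_elim
          case (elim w)
          then have w: "w \<in> strip" using interior_subset by blast
          have fw: "f w - f z \<in> M" using fM[OF zs] by (rule minus_carrier_mat)
          have sc: "inverse (w - z) *\<^sub>C (f w - f z) \<in> M" using fw by (rule scaleC_mat_carrier)
          have "mat_pairing n W (inverse (w - z) *\<^sub>C (f w - f z) - L)
              = (?\<phi> w - ?\<phi> z) / (w - z) - mat_pairing n W L"
            using fM[OF w] fM[OF zs]
            by (simp only: mat_pairing_diff[OF sc L(1)] mat_pairing_scaleC[OF fw]
                mat_pairing_diff[OF fM[OF w] fM[OF zs]] divide_inverse mult.commute)
          moreover have "inverse (w - z) *\<^sub>C (f w - f z) - L \<in> M" using L(1) by (rule minus_carrier_mat)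
          ultimately show ?case using le by metis
        qed
      qed
      then have "(?\<phi> has_field_derivative mat_pairing n W L) (at z)"
        by (simp add: has_field_derivative_iff)
      then show ?thesis unfolding field_differentiable_def by blast
    qed
    then show "?\<phi> holomorphic_on interior strip"
      unfolding holomorphic_on_def using field_differentiable_at_within by blast
    fix t
    have b: "Complex 0 t \<in> strip" "Complex 1 t \<in> strip" by (simp_all add: strip_def)
    show "cmod (?\<phi> (Complex 0 t)) \<le> K\<^sub>0 * B"
      using W(1)[OF fM[OF b(1)]] mult_left_mono[OF B(1)[of t], of K\<^sub>0] K by linarith
    show "cmod (?\<phi> (Complex 1 t)) \<le> K\<^sub>1 * B"
      using W(2)[OF fM[OF b(2)]] mult_left_mono[OF B(2)[of t], of K\<^sub>1] K by linarith
  qed (use K B \<theta> in auto)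
  also have "\<dots> = K\<^sub>0 powr (1 - \<theta>) * K\<^sub>1 powr \<theta> * (B powr (1 - \<theta>) * B powr \<theta>)"
    using K B by (simp add: powr_mult)
  also have "B powr (1 - \<theta>) * B powr \<theta> = B"
    using B by (simp add: powr_add[symmetric])
  finally show ?thesis .
qed

text \<open>
  Lower bounds for the interpolation norm come from functionals: their norms with respect to the
  interpolated norm are at most the geometric mean of the endpoint norms with weights \<open>1 - \<theta>\<close> and \<open>\<theta>\<close>.
\<close>

lemma mat_pairing_le_interpolation_norm:
  assumes A: "A \<in> M" and \<theta>: "\<theta> \<in> {0..1}" and K: "0 < K\<^sub>0" "0 < K\<^sub>1"
    and W: "\<And>A. A \<in> M \<Longrightarrow> cmod (mat_pairing n W A) \<le> K\<^sub>0 * N\<^sub>0 A"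
      "\<And>A. A \<in> M \<Longrightarrow> cmod (mat_pairing n W A) \<le> K\<^sub>1 * N\<^sub>1 A"
  shows "cmod (mat_pairing n W A) \<le> K\<^sub>0 powr (1 - \<theta>) * K\<^sub>1 powr \<theta> * interpolation_norm M N\<^sub>0 M N\<^sub>1 \<theta> A"
proof -
  let ?X = "{max (SUP t. N\<^sub>0 (f (Complex 0 t))) (SUP t. N\<^sub>1 (f (Complex 1 t))) | f.
      f \<in> calderon_functions M N\<^sub>0 M N\<^sub>1 \<and> f (complex_of_real \<theta>) = A}"
  define c where "c = K\<^sub>0 powr (1 - \<theta>) * K\<^sub>1 powr \<theta>"
  have c: "c > 0" using K by (simp add: c_def)
  have "cmod (mat_pairing n W A) / c \<le> Inf ?X"
  proof (rule cInf_greatest)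
    have "(\<lambda>z. mat n n (\<lambda>(i, j). gaussian \<theta> 1 0 z *\<^sub>C A $$ (i, j))) \<in> calderon_functions M N\<^sub>0 M N\<^sub>1"
      by (intro calderon_functions_mat admissible_gaussian) simp
    moreover have "mat n n (\<lambda>(i, j). gaussian \<theta> 1 0 (complex_of_real \<theta>) *\<^sub>C A $$ (i, j)) = A"
      using A by (intro eq_matI) auto
    ultimately show "?X \<noteq> {}" by blast
  next
    fix x assume "x \<in> ?X"
    then obtain f where f: "f \<in> calderon_functions M N\<^sub>0 M N\<^sub>1" "f (complex_of_real \<theta>) = A"
      and x: "x = max (SUP t. N\<^sub>0 (f (Complex 0 t))) (SUP t. N\<^sub>1 (f (Complex 1 t)))" by blast
    have "N\<^sub>0 (f (Complex 0 t)) \<le> (SUP t. N\<^sub>0 (f (Complex 0 t)))"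
      "N\<^sub>1 (f (Complex 1 t)) \<le> (SUP t. N\<^sub>1 (f (Complex 1 t)))" for t
      by (rule cSUP_upper[OF UNIV_I] calderon_functions_bdd_above[OF f(1)])+
    then have le: "N\<^sub>0 (f (Complex 0 t)) \<le> x" "N\<^sub>1 (f (Complex 1 t)) \<le> x" for t
      unfolding x by (meson max.coboundedI1 max.coboundedI2)+
    have "0 \<le> N\<^sub>0 (f (Complex 0 0))"
      by (intro N\<^sub>0.nonneg calderon_functions_in_carrier[OF f(1)]) (simp add: strip_def)
    then have x0: "0 \<le> x" using le(1)[of 0] by linarith
    have "cmod (mat_pairing n W A) / c \<le> x + e" if "e > 0" for e
    proof -
      have "cmod (mat_pairing n W (f (complex_of_real \<theta>))) \<le> c * (x + e)"
        unfolding c_def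
        by (rule mat_pairing_three_lines[OF f(1) \<theta> K W])
          (use le x0 that in \<open>auto intro: add_increasing2 order_trans[OF le(1)] order_trans[OF le(2)]\<close>)
      then show ?thesis using c f(2) by (simp add: divide_le_eq mult.commute)
    qed
    then show "cmod (mat_pairing n W A) / c \<le> x" by (rule field_le_epsilon)
  qed
  then show ?thesis
    using c by (simp add: interpolation_norm_def c_def divide_le_eq mult.commute)
qed

end

section \<open>The interpolated matrix norms\<close>

lemma matrix_couple_row_col: "matrix_couple n (operator_norm_via row_op) (operator_norm_via col_op)"
  by (intro matrix_couple.intro matrix_seminorm_operator_norm_via isometric_row_op isometric_col_op)

lemma matrices_UNIV: "matrices n UNIV = carrier_mat n n"
  by (simp add: matrices_def)

lemma mat_norm_row_column_interpolation:
  assumes "A \<in> carrier_mat n n"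
  shows "mat_norm (row_column_interpolation \<theta>) A =
    interpolation_norm (carrier_mat n n) (operator_norm_via row_op)
      (carrier_mat n n) (operator_norm_via col_op) \<theta> A"
  using assms
  by (simp add: row_column_interpolation_def interpolation_def row_ell2_simps col_ell2_simps matrices_UNIV)

lemma point_norm_eq_norm:
  assumes "matrix_seminorm 1 (mat_norm X)"
  shows "point_norm X x = norm x"
proof -
  interpret matrix_seminorm 1 "mat_norm X" by (rule assms)
  show ?thesis
    using entry_le[of "mat 1 1 (\<lambda>_. x)" 0 0] le_entry_norm[of "mat 1 1 (\<lambda>_. x)"]
    by (simp add: point_norm_def entry_norm_def)
qed

lemma points_row_column_interpolation: "points (row_column_interpolation \<theta>) = UNIV"
proof -
  have sum: "sum_space UNIV UNIV = (UNIV :: ell2 set)"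
  proof -
    have "x \<in> sum_space UNIV UNIV" for x :: ell2
      unfolding sum_space_def by (intro CollectI exI[of _ x] exI[of _ 0]) simp
    then show ?thesis by blast
  qed
  have sum_norm: "0 \<le> sum_norm UNIV norm UNIV norm x \<and> sum_norm UNIV norm UNIV norm x \<le> norm x"
    for x :: ell2
  proof
    have x: "norm x + norm (0 :: ell2) \<in> {norm a + norm b | a b. a \<in> UNIV \<and> b \<in> UNIV \<and> x = a + b}"
      by (intro CollectI exI[of _ x] exI[of _ 0]) simp
    show "0 \<le> sum_norm UNIV norm UNIV norm x"
      unfolding sum_norm_def using x by (intro cInf_greatest) (blast, auto)
    have "sum_norm UNIV norm UNIV norm x \<le> norm x + norm (0 :: ell2)"
      unfolding sum_norm_def by (rule cInf_lower[OF x]) (auto intro!: bdd_belowI[of _ 0])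
    then show "sum_norm UNIV norm UNIV norm x \<le> norm x" by simp
  qed
  have "\<exists>f \<in> calderon_functions UNIV norm UNIV norm. f (complex_of_real \<theta>) = x" for x :: ell2
  proof
    let ?g = "gaussian \<theta> 1 0"
    have g: "admissible ?g" by (intro admissible_gaussian) simp
    obtain K where K: "\<And>z. z \<in> strip \<Longrightarrow> cmod (?g z) \<le> K"
      using g unfolding admissible_def by blast
    have lim: "((\<lambda>w. norm (h w *\<^sub>C x)) \<longlongrightarrow> 0) F" if "(h \<longlongrightarrow> 0) F" for h and F :: "'b filter"
      unfolding norm_scaleC by (intro tendsto_mult_left_zero tendsto_norm_zero that)
    show "(\<lambda>z. ?g z *\<^sub>C x) \<in> calderon_functions UNIV norm UNIV norm"
    proof (rule calderon_functionsI[where D = norm and K = "K * norm x"])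
      fix z
      have diff: "?g w *\<^sub>C x - ?g z *\<^sub>C x = (?g w - ?g z) *\<^sub>C x" for w
        by (rule complex_vector.scale_left_diff_distrib[symmetric])
      have "isCont ?g z"
        using g by (auto simp: admissible_def field_differentiable_imp_continuous_at)
      then show "((\<lambda>w. norm (?g w *\<^sub>C x - ?g z *\<^sub>C x)) \<longlongrightarrow> 0) (at z)"
        unfolding diff by (intro lim LIM_zero) (simp add: isCont_def)
      have "(?g has_field_derivative deriv ?g z) (at z)"
        using g by (simp add: admissible_def DERIV_deriv_iff_field_differentiable)
      then have "((\<lambda>w. norm (((?g w - ?g z) / (w - z) - deriv ?g z) *\<^sub>C x)) \<longlongrightarrow> 0) (at z)"
        by (intro lim LIM_zero) (simp add: has_field_derivative_iff)
      moreover have "inverse (w - z) *\<^sub>C (?g w *\<^sub>C x - ?g z *\<^sub>C x) - deriv ?g z *\<^sub>C x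
          = ((?g w - ?g z) / (w - z) - deriv ?g z) *\<^sub>C x" for w
        unfolding diff scaleC_scaleC complex_vector.scale_left_diff_distrib[symmetric]
        by (simp add: divide_inverse mult.commute)
      ultimately show "\<exists>L\<in>UNIV. ((\<lambda>w. norm (inverse (w - z) *\<^sub>C (?g w *\<^sub>C x - ?g z *\<^sub>C x) - L)) \<longlongrightarrow> 0) (at z)"
        by (intro bexI[of _ "deriv ?g z *\<^sub>C x"]) simp_all
    next
      show "norm (?g z *\<^sub>C x) \<le> K * norm x" if "z \<in> strip" for z
        using K[OF that] by (simp add: norm_scaleC mult_right_mono)
      show "((\<lambda>t. norm (?g (Complex 0 t) *\<^sub>C x)) \<longlongrightarrow> 0) at_infinity"
        "((\<lambda>t. norm (?g (Complex 1 t) *\<^sub>C x)) \<longlongrightarrow> 0) at_infinity"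
        using g by (intro lim; simp add: admissible_def)+
    qed (use sum sum_norm in auto)
  qed simp
  then have "interpolation_space UNIV norm UNIV norm \<theta> = (UNIV :: ell2 set)"
    unfolding interpolation_space_def by (auto simp: image_iff) metis
  moreover have "point_norm row_ell2 = norm" "point_norm col_ell2 = norm"
    by (intro ext point_norm_eq_norm;
      simp add: row_ell2_simps col_ell2_simps matrix_seminorm_operator_norm_via isometric_row_op isometric_col_op)+
  ultimately show ?thesis
    by (simp add: row_column_interpolation_def interpolation_def row_ell2_simps col_ell2_simps)
qed

section \<open>Rows and columns with a corner entry\<close>

definition line_index :: "bool \<Rightarrow> nat \<Rightarrow> nat \<times> nat"
  where "line_index r j = (if r then (0, j) else (j, 0))"

text \<open>
  The vectors \<open>z 0, \<dots>, z (n - 1)\<close> along the first row (if \<open>r\<close>) or the first column, and \<open>v\<close> at the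
  opposite corner, in a row and a column of its own. The norms of such a block diagonal matrix are
  the maximum of the norms of the line and of \<open>v\<close>, so that a large \<open>v\<close> fixes the norm of the whole
  matrix; subtracting two of these matrices with the same \<open>v\<close> leaves the difference of the lines.
\<close>

definition line_corner :: "bool \<Rightarrow> nat \<Rightarrow> (nat \<Rightarrow> 'a::zero) \<Rightarrow> 'a \<Rightarrow> 'a mat"
  where "line_corner r n z v = mat (Suc n) (Suc n) (\<lambda>(i, j).
    if i = n \<and> j = n then v
    else if i < n \<and> j < n \<and> (if r then i else j) = 0 then z (if r then j else i) else 0)"

text \<open>
  The embedding for whose matrix norm a line of \<open>m\<close> orthonormal vectors has norm \<open>sqrt m\<close>; for the
  other embedding it has norm \<open>1\<close>.
\<close>

definition long_op :: "bool \<Rightarrow> ell2 \<Rightarrow> ell2 \<Rightarrow>\<^sub>L ell2"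
  where "long_op r = (if r then row_op else col_op)"

text \<open>
  The correlations are small enough for \<open>norm_sum_almost_orthogonal\<close>. The sequence is padded with
  zeros so that lines of different lengths fit into matrices of one size.
\<close>

definition almost_orthogonal :: "nat \<Rightarrow> real \<Rightarrow> (nat \<Rightarrow> ell2) \<Rightarrow> bool"
  where "almost_orthogonal m c z \<longleftrightarrow> (\<forall>j<m. norm (z j) \<le> c) \<and> (\<forall>j\<ge>m. z j = 0) \<and>
    (\<forall>i<m. \<forall>j<m. i \<noteq> j \<longrightarrow> cmod (pair (z i) (cnj_ell2 (z j))) \<le> c\<^sup>2 / m)"

lemma line_corner_carrier [simp]: "line_corner r n z v \<in> carrier_mat (Suc n) (Suc n)"
  by (simp add: line_corner_def)

lemma isometric_norm_apply_le:
  assumes "isometric_operators T"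
  shows "norm (T x u) \<le> norm x * norm u"
  using assms norm_blinfun[of "T x" u] by (simp add: isometric_operators_def)

lemma isometric_zero: "isometric_operators T \<Longrightarrow> T 0 = 0"
  unfolding isometric_operators_def by (metis norm_zero norm_eq_zero)

text \<open>
  The line and the corner act on orthogonal coordinates and have orthogonal images, so a common bound
  for the two parts bounds the matrix.
\<close>

lemma operator_norm_row_corner_le:
  assumes T: "isometric_operators T" and K: "0 \<le> K" and n: "n > 0" and v: "norm v \<le> K"
    and z: "\<And>u. (norm (\<Sum>j<n. T (z j) (u j)))\<^sup>2 \<le> K\<^sup>2 * (\<Sum>j<n. (norm (u j))\<^sup>2)"
  shows "operator_norm_via T (line_corner True n z v) \<le> K"
proof (rule operator_norm_via_le[OF T line_corner_carrier])
  fix u :: "nat \<Rightarrow> ell2" assume "u \<in> direct_sum_ball (Suc n)"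
  then have u: "(\<Sum>j<n. (norm (u j))\<^sup>2) + (norm (u n))\<^sup>2 \<le> 1" by (simp add: direct_sum_ball_def)
  let ?A = "line_corner True n z v"
  have "(\<Sum>j<Suc n. T (?A $$ (i, j)) (u j)) =
    (if i = 0 then \<Sum>j<n. T (z j) (u j) else if i = n then T v (u n) else 0)" if "i < Suc n" for i
    using that n isometric_zero[OF T] by (auto simp: line_corner_def intro!: sum.neutral)
  then have "(\<Sum>i<Suc n. (norm (\<Sum>j<Suc n. T (?A $$ (i, j)) (u j)))\<^sup>2)
    = (\<Sum>i<Suc n. (norm (if i = 0 then \<Sum>j<n. T (z j) (u j) else if i = n then T v (u n) else 0))\<^sup>2)"
    by (intro sum.cong refl) auto
  also have "\<dots> = (norm (\<Sum>j<n. T (z j) (u j)))\<^sup>2 + (norm (T v (u n)))\<^sup>2"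
    using n by (simp add: if_distrib[of norm] if_distrib[of "\<lambda>x. x\<^sup>2"] sum.remove[of "{..<n}" 0] cong: if_cong)
  also have "\<dots> \<le> K\<^sup>2 * (\<Sum>j<n. (norm (u j))\<^sup>2) + K\<^sup>2 * (norm (u n))\<^sup>2"
  proof (rule add_mono[OF z])
    have "norm (T v (u n)) \<le> K * norm (u n)"
      using order_trans[OF isometric_norm_apply_le[OF T] mult_right_mono[OF v norm_ge_zero]] .
    then show "(norm (T v (u n)))\<^sup>2 \<le> K\<^sup>2 * (norm (u n))\<^sup>2"
      unfolding power_mult_distrib[symmetric] by (intro power_mono) auto
  qed
  also have "\<dots> \<le> K\<^sup>2"
    using mult_left_mono[OF u, of "K\<^sup>2"] by (simp add: distrib_left)
  finally show "action_norm T (Suc n) ?A u \<le> K"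
    unfolding action_norm_def L2_set_def using K by (intro real_le_lsqrt sum_nonneg) auto
qed

lemma operator_norm_column_corner_le:
  assumes T: "isometric_operators T" and K: "0 \<le> K" and n: "n > 0" and v: "norm v \<le> K"
    and z: "\<And>w. (\<Sum>i<n. (norm (T (z i) w))\<^sup>2) \<le> K\<^sup>2 * (norm w)\<^sup>2"
  shows "operator_norm_via T (line_corner False n z v) \<le> K"
proof (rule operator_norm_via_le[OF T line_corner_carrier])
  fix u :: "nat \<Rightarrow> ell2" assume "u \<in> direct_sum_ball (Suc n)"
  then have "(\<Sum>j<n. (norm (u j))\<^sup>2) + (norm (u n))\<^sup>2 \<le> 1" by (simp add: direct_sum_ball_def)
  moreover have "(norm (u 0))\<^sup>2 \<le> (\<Sum>j<n. (norm (u j))\<^sup>2)"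
    using n by (intro member_le_sum) auto
  ultimately have u: "(norm (u 0))\<^sup>2 + (norm (u n))\<^sup>2 \<le> 1" by linarith
  let ?A = "line_corner False n z v"
  have "(\<Sum>j<Suc n. T (?A $$ (i, j)) (u j)) = (if i < n then T (z i) (u 0) else T v (u n))"
    if "i < Suc n" for i
  proof -
    have "(\<Sum>j<Suc n. T (?A $$ (i, j)) (u j)) =
      (\<Sum>j<Suc n. if j = (if i < n then 0 else n) then (if i < n then T (z i) (u 0) else T v (u n)) else 0)"
      using that n isometric_zero[OF T] by (intro sum.cong refl) (auto simp: line_corner_def)
    then show ?thesis by (simp only: sum.delta finite_lessThan) simp
  qed
  then have "(\<Sum>i<Suc n. (norm (\<Sum>j<Suc n. T (?A $$ (i, j)) (u j)))\<^sup>2)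
    = (\<Sum>i<Suc n. (norm (if i < n then T (z i) (u 0) else T v (u n)))\<^sup>2)"
    by (intro sum.cong refl) auto
  also have "\<dots> = (\<Sum>i<n. (norm (T (z i) (u 0)))\<^sup>2) + (norm (T v (u n)))\<^sup>2"
    by simp
  also have "\<dots> \<le> K\<^sup>2 * (norm (u 0))\<^sup>2 + K\<^sup>2 * (norm (u n))\<^sup>2"
  proof (rule add_mono[OF z])
    have "norm (T v (u n)) \<le> K * norm (u n)"
      using order_trans[OF isometric_norm_apply_le[OF T] mult_right_mono[OF v norm_ge_zero]] .
    then show "(norm (T v (u n)))\<^sup>2 \<le> K\<^sup>2 * (norm (u n))\<^sup>2"
      unfolding power_mult_distrib[symmetric] by (intro power_mono) auto
  qed
  also have "\<dots> \<le> K\<^sup>2"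
    using mult_left_mono[OF u, of "K\<^sup>2"] by (simp add: distrib_left)
  finally show "action_norm T (Suc n) ?A u \<le> K"
    unfolding action_norm_def L2_set_def using K by (intro real_le_lsqrt sum_nonneg) auto
qed

lemma sum_support:
  fixes f :: "nat \<Rightarrow> 'a::comm_monoid_add"
  assumes "m \<le> n" "\<And>j. m \<le> j \<Longrightarrow> f j = 0"
  shows "sum f {..<n} = sum f {..<m}"
  using assms by (intro sum.mono_neutral_right) auto

text \<open>
  In the long direction only the sizes of the vectors matter, and the Cauchy--Schwarz inequality
  gives the factor \<open>sqrt m\<close>.
\<close>

lemma operator_norm_long_le:
  assumes z: "almost_orthogonal m c z" and m: "m \<le> n" "m > 0" and v: "norm v \<le> K"
    and K: "sqrt m * c \<le> K"
  shows "operator_norm_via (long_op r) (line_corner r n z v) \<le> K"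
proof -
  have c: "norm (z j) \<le> c" if "j < m" for j
    using z that by (simp add: almost_orthogonal_def)
  have z0: "z j = 0" if "m \<le> j" for j
    using z that by (simp add: almost_orthogonal_def)
  have c0: "0 \<le> c" using c[OF m(2)] norm_ge_zero[of "z 0"] by linarith
  have K0: "0 \<le> K" using v norm_ge_zero[of v] by linarith
  have "(sqrt m * c)\<^sup>2 \<le> K\<^sup>2" using K c0 by (intro power_mono) auto
  then have mc: "real m * c\<^sup>2 \<le> K\<^sup>2" by (simp add: power_mult_distrib)
  show ?thesis
  proof (cases r)
    case True
    have "(norm (\<Sum>j<n. row_op (z j) (u j)))\<^sup>2 \<le> K\<^sup>2 * (\<Sum>j<n. (norm (u j))\<^sup>2)" for u
    proof -
      have "(\<Sum>j<n. row_op (z j) (u j)) = (\<Sum>j<m. row_op (z j) (u j))"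
        using z0 isometric_zero[OF isometric_row_op] m by (intro sum_support) auto
      then have "norm (\<Sum>j<n. row_op (z j) (u j)) \<le> (\<Sum>j<m. norm (row_op (z j) (u j)))"
        by (simp add: norm_sum)
      also have "\<dots> \<le> (\<Sum>j<m. c * norm (u j))"
        using c by (intro sum_mono order_trans[OF isometric_norm_apply_le[OF isometric_row_op]] mult_right_mono) auto
      finally have "(norm (\<Sum>j<n. row_op (z j) (u j)))\<^sup>2 \<le> (\<Sum>j<m. c * norm (u j))\<^sup>2"
        by (intro power_mono) auto
      also have "\<dots> \<le> (\<Sum>j<m. (c * norm (u j))\<^sup>2) * m"
        using sum_squared_le_sum_of_squares[of "\<lambda>j. c * norm (u j)" "{..<m}"] by simp
      also have "\<dots> = (real m * c\<^sup>2) * (\<Sum>j<m. (norm (u j))\<^sup>2)"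
        by (simp add: power_mult_distrib sum_distrib_left[symmetric])
      also have "\<dots> \<le> K\<^sup>2 * (\<Sum>j<n. (norm (u j))\<^sup>2)"
        using mc m by (intro mult_mono sum_mono2 sum_nonneg) auto
      finally show ?thesis .
    qed
    then show ?thesis
      using True m v K0 by (simp add: long_op_def operator_norm_row_corner_le[OF isometric_row_op])
  next
    case False
    have "(\<Sum>i<n. (norm (col_op (z i) w))\<^sup>2) \<le> K\<^sup>2 * (norm w)\<^sup>2" for w
    proof -
      have "(\<Sum>i<n. (norm (col_op (z i) w))\<^sup>2) = (\<Sum>i<m. (norm (col_op (z i) w))\<^sup>2)"
        using z0 isometric_zero[OF isometric_col_op] m by (intro sum_support) auto
      also have "\<dots> \<le> (\<Sum>i<m. (c * norm w)\<^sup>2)"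
        using c by (intro sum_mono power_mono order_trans[OF isometric_norm_apply_le[OF isometric_col_op]] mult_right_mono) auto
      also have "\<dots> = (real m * c\<^sup>2) * (norm w)\<^sup>2"
        by (simp add: power_mult_distrib)
      also have "\<dots> \<le> K\<^sup>2 * (norm w)\<^sup>2"
        using mc by (intro mult_right_mono) auto
      finally show ?thesis .
    qed
    then show ?thesis
      using False m v K0 by (simp add: long_op_def operator_norm_column_corner_le[OF isometric_col_op])
  qed
qed

text \<open>
  In the short direction almost orthogonality removes the factor \<open>sqrt m\<close>: the column norm of a row is
  the norm of the synthesis operator, the row norm of a column is that of the analysis operator.
\<close>

lemma operator_norm_short_le:
  assumes z: "almost_orthogonal m c z" and m: "m \<le> n" "m > 0" and v: "norm v \<le> K"
    and K: "sqrt 2 * c \<le> K"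
  shows "operator_norm_via (long_op (\<not> r)) (line_corner r n z v) \<le> K"
proof -
  have c: "norm (z j) \<le> c" if "j < m" for j
    using z that by (simp add: almost_orthogonal_def)
  have orth: "cmod (pair (z i) (cnj_ell2 (z j))) \<le> c\<^sup>2 / m" if "i < m" "j < m" "i \<noteq> j" for i j
    using z that by (simp add: almost_orthogonal_def)
  have z0: "z j = 0" if "m \<le> j" for j
    using z that by (simp add: almost_orthogonal_def)
  have c0: "0 \<le> c" using c[OF m(2)] norm_ge_zero[of "z 0"] by linarith
  have K0: "0 \<le> K" using v norm_ge_zero[of v] by linarith
  have "(sqrt 2 * c)\<^sup>2 \<le> K\<^sup>2" using K c0 by (intro power_mono) auto
  then have mc: "2 * c\<^sup>2 \<le> K\<^sup>2" by (simp add: power_mult_distrib)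
  show ?thesis
  proof (cases r)
    case True
    have "(norm (\<Sum>j<n. col_op (z j) (u j)))\<^sup>2 \<le> K\<^sup>2 * (\<Sum>j<n. (norm (u j))\<^sup>2)" for u
    proof -
      have "(\<Sum>j<n. col_op (z j) (u j)) = (\<Sum>j<m. coord (u j) 0 *\<^sub>C z j)"
        unfolding col_op_apply using z0 m by (intro sum_support) auto
      then have "(norm (\<Sum>j<n. col_op (z j) (u j)))\<^sup>2 \<le> 2 * c\<^sup>2 * (\<Sum>j<m. (cmod (coord (u j) 0))\<^sup>2)"
        using norm_sum_almost_orthogonal[OF c orth, where a = "\<lambda>j. coord (u j) 0"] by simp
      also have "\<dots> \<le> K\<^sup>2 * (\<Sum>j<n. (norm (u j))\<^sup>2)"
      proof (intro mult_mono mc sum_nonneg)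
        have "(\<Sum>j<m. (cmod (coord (u j) 0))\<^sup>2) \<le> (\<Sum>j<m. (norm (u j))\<^sup>2)"
          by (intro sum_mono power_mono coord_le_norm) auto
        also have "\<dots> \<le> (\<Sum>j<n. (norm (u j))\<^sup>2)"
          using m by (intro sum_mono2) auto
        finally show "(\<Sum>j<m. (cmod (coord (u j) 0))\<^sup>2) \<le> (\<Sum>j<n. (norm (u j))\<^sup>2)" .
      qed auto
      finally show ?thesis .
    qed
    then show ?thesis
      using True m v K0 by (simp add: long_op_def operator_norm_row_corner_le[OF isometric_col_op])
  next
    case False
    have "(\<Sum>i<n. (norm (row_op (z i) w))\<^sup>2) \<le> K\<^sup>2 * (norm w)\<^sup>2" for w
    proof -
      have "(\<Sum>i<n. (norm (row_op (z i) w))\<^sup>2) = (\<Sum>i<m. (cmod (pair (z i) w))\<^sup>2)"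
        unfolding row_op_apply using z0 m by (subst sum_support[of m n]) (auto simp: norm_scaleC)
      also have "\<dots> \<le> 2 * c\<^sup>2 * (norm w)\<^sup>2"
        by (rule bessel_almost_orthogonal[OF c orth])
      also have "\<dots> \<le> K\<^sup>2 * (norm w)\<^sup>2"
        using mc by (intro mult_right_mono) auto
      finally show ?thesis .
    qed
    then show ?thesis
      using False m v K0 by (simp add: long_op_def operator_norm_column_corner_le[OF isometric_row_op])
  qed
qed

section \<open>Norms of lines of almost orthogonal vectors\<close>

text \<open>
  In the interpolated norm, a line of \<open>m\<close> orthonormal vectors has norm \<open>m powr exponent r \<theta>\<close>. The two
  exponents of a given \<open>\<theta>\<close> add up to \<open>1 / 2\<close>.
\<close>

definition exponent :: "bool \<Rightarrow> real \<Rightarrow> real"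
  where "exponent r \<theta> = (if r then (1 - \<theta>) / 2 else \<theta> / 2)"

lemma almost_orthogonal_scaleC:
  assumes "almost_orthogonal m c z"
  shows "almost_orthogonal m (cmod a * c) (\<lambda>j. a *\<^sub>C z j)"
proof -
  have "cmod (pair (a *\<^sub>C z i) (cnj_ell2 (a *\<^sub>C z j))) \<le> (cmod a * c)\<^sup>2 / m"
    if "i < m" "j < m" "i \<noteq> j" for i j
  proof -
    have "cmod (pair (a *\<^sub>C z i) (cnj_ell2 (a *\<^sub>C z j))) = (cmod a)\<^sup>2 * cmod (pair (z i) (cnj_ell2 (z j)))"
      by (simp add: cnj_ell2_scaleC pair_scaleC_left pair_scaleC_right norm_mult power2_eq_square)
    also have "\<dots> \<le> (cmod a)\<^sup>2 * (c\<^sup>2 / m)"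
      using assms that by (intro mult_left_mono) (auto simp: almost_orthogonal_def)
    finally show ?thesis by (simp add: power_mult_distrib)
  qed
  then show ?thesis
    using assms by (auto simp: almost_orthogonal_def norm_scaleC mult_left_mono)
qed

text \<open>
  The function \<open>f\<close> through the given matrix multiplies the line by a power of \<open>m\<close> of exponent linear in
  \<open>z\<close>. The slope \<open>l\<close> is chosen such that both boundary norms of the line agree with the interpolated
  one up to a constant. For the corner entry there is no constant, because its norm has to equal the
  radius of a sphere exactly.
\<close>

lemma mat_norm_line_corner_le:
  assumes z: "almost_orthogonal m c z" and m: "m \<le> n" "m > 0" and \<theta>: "\<theta> \<in> {0..1}"
  shows "mat_norm (row_column_interpolation \<theta>) (line_corner r n z v)
    \<le> max (sqrt 2 * c * m powr exponent r \<theta>) (norm v)" (is "?L \<le> ?K")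
proof -
  have "norm (z 0) \<le> c" using z m(2) by (simp add: almost_orthogonal_def)
  then have c0: "0 \<le> c" using norm_ge_zero[of "z 0"] by linarith
  have le: "?L \<le> exp d * ?K" if d: "d > 0" for d
  proof -
    define l where "l = (if r then ln m / 2 else - (ln m / 2))"
    let ?g = "gaussian \<theta> d l" and ?h = "gaussian \<theta> d 0"
    define f where "f \<zeta> = mat (Suc n) (Suc n) (\<lambda>(i, j).
      (if i = n \<and> j = n then ?h else ?g) \<zeta> *\<^sub>C line_corner r n z v $$ (i, j))" for \<zeta>
    have f_eq: "f \<zeta> = line_corner r n (\<lambda>j. ?g \<zeta> *\<^sub>C z j) (?h \<zeta> *\<^sub>C v)" for \<zeta>
      unfolding f_def by (rule eq_matI) (auto simp: line_corner_def)
    interpret matrix_couple "Suc n" "operator_norm_via row_op" "operator_norm_via col_op"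
      by (rule matrix_couple_row_col)
    have cald: "f \<in> calderon_functions M (operator_norm_via row_op) M (operator_norm_via col_op)"
      unfolding f_def
      by (rule calderon_functions_mat[where g = "\<lambda>i j. if i = n \<and> j = n then ?h else ?g"
          and a = "\<lambda>i j. line_corner r n z v $$ (i, j)"])
        (simp add: admissible_gaussian d)
    have at: "f (complex_of_real \<theta>) = line_corner r n z v"
      by (simp add: f_eq)
    have side: "operator_norm_via (long_op (s = 0)) (f (Complex s t)) \<le> exp d * ?K"
      if s: "s \<in> {0, 1}" for s t
    proof -
      have "s\<^sup>2 \<le> 1" using s by auto
      then have "s\<^sup>2 - t\<^sup>2 - \<theta>\<^sup>2 \<le> 1"
        using zero_le_power2[of t] zero_le_power2[of \<theta>] by linarith
      then have d1: "d * (s\<^sup>2 - t\<^sup>2 - \<theta>\<^sup>2) \<le> d"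
        using d by (metis mult.right_neutral mult_left_mono less_imp_le)
      have h: "cmod (?h (Complex s t)) \<le> exp d"
        using d1 by (simp add: norm_gaussian)
      have g: "cmod (?g (Complex s t)) \<le> exp d * exp (l * (s - \<theta>))"
        using d1 by (simp add: norm_gaussian exp_add[symmetric])
      have exp_l: "exp (l * (s - \<theta>)) = m powr ((if r then 1 else - 1) * (s - \<theta>) / 2)"
        using m(2) by (simp add: l_def powr_def field_simps)
      have ao: "almost_orthogonal m (cmod (?g (Complex s t)) * c) (\<lambda>j. ?g (Complex s t) *\<^sub>C z j)"
        by (rule almost_orthogonal_scaleC[OF z])
      have v: "norm (?h (Complex s t) *\<^sub>C v) \<le> exp d * ?K"
        unfolding norm_scaleC using h by (intro mult_mono) auto
      have gc: "cmod (?g (Complex s t)) * c \<le> exp d * exp (l * (s - \<theta>)) * c"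
        using g c0 by (rule mult_right_mono)
      show ?thesis
      proof (cases "r = (s = 0)")
        case True
        have "1 / 2 + (if r then 1 else - 1) * (s - \<theta>) / 2 = exponent r \<theta>"
          using True s by (auto simp: exponent_def field_simps)
        then have "sqrt m * exp (l * (s - \<theta>)) = m powr exponent r \<theta>"
          using m(2) by (simp only: exp_l powr_half_sqrt[symmetric] of_nat_0_le_iff powr_add[symmetric])
        moreover have "sqrt m * (cmod (?g (Complex s t)) * c) \<le> sqrt m * (exp d * exp (l * (s - \<theta>)) * c)"
          using gc by (intro mult_left_mono) auto
        ultimately have "sqrt m * (cmod (?g (Complex s t)) * c) \<le> exp d * (c * m powr exponent r \<theta>)"
          by (simp add: mult_ac)
        also have "\<dots> \<le> exp d * ?K"
        proof (intro mult_left_mono max.coboundedI1 mult_right_mono)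
          show "c \<le> sqrt 2 * c" using c0 mult_right_mono[of 1 "sqrt 2" c] by simp
        qed auto
        finally have "operator_norm_via (long_op r) (f (Complex s t)) \<le> exp d * ?K"
          unfolding f_eq using ao m v by (intro operator_norm_long_le)
        then show ?thesis using True by simp
      next
        case False
        have "(if r then 1 else - 1) * (s - \<theta>) / 2 = exponent r \<theta>"
          using False s by (auto simp: exponent_def field_simps)
        then have "exp (l * (s - \<theta>)) = m powr exponent r \<theta>"
          by (simp only: exp_l)
        moreover have "sqrt 2 * (cmod (?g (Complex s t)) * c) \<le> sqrt 2 * (exp d * exp (l * (s - \<theta>)) * c)"
          using gc by (intro mult_left_mono) auto
        ultimately have "sqrt 2 * (cmod (?g (Complex s t)) * c) \<le> exp d * (sqrt 2 * c * m powr exponent r \<theta>)"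
          by (simp add: mult_ac)
        also have "\<dots> \<le> exp d * ?K"
          by (intro mult_left_mono max.cobounded1) auto
        finally have "operator_norm_via (long_op (\<not> r)) (f (Complex s t)) \<le> exp d * ?K"
          unfolding f_eq using ao m v by (intro operator_norm_short_le)
        then show ?thesis using False by (simp add: long_op_def split: if_splits)
      qed
    qed
    have "interpolation_norm M (operator_norm_via row_op) M (operator_norm_via col_op) \<theta>
        (line_corner r n z v) \<le> exp d * ?K"
    proof (rule interpolation_norm_le[OF cald at])
      show "operator_norm_via row_op (f (Complex 0 t)) \<le> exp d * ?K"
        "operator_norm_via col_op (f (Complex 1 t)) \<le> exp d * ?K" for t
        using side[of 0 t] side[of 1 t] by (simp_all add: long_op_def)
    qed
    then show ?thesis by (simp add: mat_norm_row_column_interpolation[of _ "Suc n"])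
  qed
  have "((\<lambda>d. exp d * ?K) \<longlongrightarrow> exp 0 * ?K) (at_right 0)"
    by (intro tendsto_intros)
  moreover have "\<forall>\<^sub>F d in at_right 0. ?L \<le> exp d * ?K"
    using le by (intro eventually_at_right_less[THEN eventually_mono]) auto
  ultimately show ?thesis
    using tendsto_lowerbound[of "\<lambda>d. exp d * ?K" "exp 0 * ?K" "at_right 0" ?L] by simp
qed

text \<open>
  The vector of norm at most \<open>1\<close> that norms \<open>x\<close> under the bilinear pairing; it is \<open>0\<close> for \<open>x = 0\<close>.
\<close>

definition dual_unit :: "ell2 \<Rightarrow> ell2"
  where "dual_unit x = cnj_ell2 (x /\<^sub>R norm x)"

lemma norm_dual_unit_le: "norm (dual_unit x) \<le> 1"
  by (cases "x = 0") (simp_all add: dual_unit_def)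

lemma pair_dual_unit: "pair x (dual_unit x) = complex_of_real (norm x)"
  by (cases "x = 0")
    (simp_all add: dual_unit_def cnj_ell2_scaleR pair_scaleR_right norm_eq_pair power2_eq_square)

lemma norm_pair_le_norm:
  assumes "norm w \<le> 1"
  shows "cmod (pair x w) \<le> norm x"
  using norm_pair_le[of x w] mult_left_mono[OF assms norm_ge_zero[of x]] by simp

text \<open>
  Both endpoint norms dominate the entries, so the functional that reads off one entry has norm at
  most \<open>1\<close> on the interpolated space.
\<close>

lemma entry_le_mat_norm:
  assumes A: "A \<in> carrier_mat n n" and ij: "i < n" "j < n" and \<theta>: "\<theta> \<in> {0..1}"
  shows "norm (A $$ (i, j)) \<le> mat_norm (row_column_interpolation \<theta>) A"
proof -
  interpret matrix_couple n "operator_norm_via row_op" "operator_norm_via col_op"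
    by (rule matrix_couple_row_col)
  define w where "w = dual_unit (A $$ (i, j))"
  define W where "W k l = (if k = i \<and> l = j then w else 0)" for k l
  have eq: "mat_pairing n W B = pair (B $$ (i, j)) w" for B
  proof -
    have "mat_pairing n W B = (\<Sum>k<n. \<Sum>l<n. if k = i then if l = j then pair (B $$ (i, j)) w else 0 else 0)"
      unfolding mat_pairing_def by (intro sum.cong refl) (auto simp: W_def)
    also have "\<dots> = (\<Sum>k<n. if k = i then \<Sum>l<n. if l = j then pair (B $$ (i, j)) w else 0 else 0)"
      by (intro sum.cong refl) auto
    finally show ?thesis using ij by simp
  qed
  have le: "cmod (pair x w) \<le> norm x" for x
    unfolding w_def by (rule norm_pair_le_norm[OF norm_dual_unit_le])
  have "cmod (mat_pairing n W A) \<le> 1 powr (1 - \<theta>) * 1 powr \<theta> *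
      interpolation_norm M (operator_norm_via row_op) M (operator_norm_via col_op) \<theta> A"
    using ij le by (intro mat_pairing_le_interpolation_norm A \<theta>)
      (auto simp: eq intro: order_trans[OF le] N\<^sub>0.entry_le N\<^sub>1.entry_le)
  then show ?thesis
    by (simp add: eq w_def pair_dual_unit mat_norm_row_column_interpolation[OF A])
qed

text \<open>
  Pairing the entries of a line with unit vectors is a functional of norm at most \<open>sqrt m\<close> for the long
  endpoint norm and at most \<open>m\<close> for the short one. The entries are arbitrary vectors, so that
  the estimate applies to the images of basis vectors under an arbitrary map.
\<close>

lemma line_le_mat_norm:
  assumes A: "A \<in> carrier_mat n n" and m: "0 < m" "m \<le> n" and \<theta>: "\<theta> \<in> {0..1}"
  shows "(\<Sum>j<m. norm (A $$ line_index r j))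
    \<le> m powr (1 - exponent r \<theta>) * mat_norm (row_column_interpolation \<theta>) A"
proof -
  interpret matrix_couple n "operator_norm_via row_op" "operator_norm_via col_op"
    by (rule matrix_couple_row_col)
  define w where "w j = dual_unit (A $$ line_index r j)" for j
  define W where "W k l = (if (if r then k else l) = 0 \<and> (if r then l else k) < m
    then w (if r then l else k) else 0)" for k l
  have eq: "mat_pairing n W B = (\<Sum>j<m. pair (B $$ line_index r j) (w j))" for B
  proof (cases r)
    case True
    have "mat_pairing n W B = (\<Sum>k<n. if k = 0 then \<Sum>l<n. if l < m then pair (B $$ (0, l)) (w l) else 0 else 0)"
      unfolding mat_pairing_def using True by (intro sum.cong refl) (auto simp: W_def intro!: sum.cong)
    also have "\<dots> = (\<Sum>l<n. if l < m then pair (B $$ (0, l)) (w l) else 0)"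
      using m by simp
    also have "\<dots> = (\<Sum>l<m. pair (B $$ (0, l)) (w l))"
      using m by (subst sum_support[of m n]) auto
    finally show ?thesis using True by (simp add: line_index_def)
  next
    case False
    have "mat_pairing n W B = (\<Sum>k<n. \<Sum>l<n. if l = 0 then if k < m then pair (B $$ (k, 0)) (w k) else 0 else 0)"
      unfolding mat_pairing_def using False by (intro sum.cong refl) (auto simp: W_def)
    also have "\<dots> = (\<Sum>k<n. if k < m then pair (B $$ (k, 0)) (w k) else 0)"
      using m by simp
    also have "\<dots> = (\<Sum>k<m. pair (B $$ (k, 0)) (w k))"
      using m by (subst sum_support[of m n]) auto
    finally show ?thesis using False by (simp add: line_index_def)
  qed
  have w: "norm (w j) \<le> 1" for j by (simp add: w_def norm_dual_unit_le)
  have w_le: "cmod (pair x (w j)) \<le> norm x" for x j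
    by (rule norm_pair_le_norm[OF w])
  have short: "cmod (mat_pairing n W B) \<le> m * N B"
    if "matrix_seminorm n N" "B \<in> M" for N :: "ell2 mat \<Rightarrow> real" and B
  proof -
    have "cmod (mat_pairing n W B) \<le> (\<Sum>j<m. cmod (pair (B $$ line_index r j) (w j)))"
      unfolding eq by (rule norm_sum)
    also have "\<dots> \<le> (\<Sum>j<m. N B)"
      using m by (intro sum_mono order_trans[OF w_le]) 
        (auto simp: line_index_def intro!: matrix_seminorm.entry_le[OF that])
    finally show ?thesis by simp
  qed
  have long: "cmod (mat_pairing n W B) \<le> sqrt m * operator_norm_via (long_op r) B" if B: "B \<in> M" for B
  proof (cases r)
    case True
    define u where "u j = (if j < m then w j /\<^sub>R sqrt m else 0)" for j
    have "(\<Sum>j<n. (norm (u j))\<^sup>2) = (\<Sum>j<m. (norm (u j))\<^sup>2)"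
      using m by (intro sum_support) (auto simp: u_def)
    also have "\<dots> \<le> (\<Sum>j<m. 1 / m)"
      using w by (intro sum_mono) (auto simp: u_def power_divide divide_right_mono power_le_one divide_inverse_commute[symmetric])
    also have "\<dots> = 1" using m by simp
    finally have u: "u \<in> direct_sum_ball n" by (simp add: direct_sum_ball_def)
    have "(\<Sum>j<n. row_op (B $$ (0, j)) (u j)) = (\<Sum>j<m. row_op (B $$ (0, j)) (u j))"
      using m by (intro sum_support) (auto simp: u_def)
    also have "\<dots> = (mat_pairing n W B / sqrt m) *\<^sub>C unit_vec_ell2 0"
      unfolding eq using True
      by (simp add: u_def row_op_apply pair_scaleR_right line_index_def divide_inverse
          mult.commute[of _ "inverse _"] sum_distrib_left complex_vector.scale_sum_left)
    finally have "cmod (mat_pairing n W B) / sqrt m = norm (\<Sum>j<n. row_op (B $$ (0, j)) (u j))"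
      by (simp add: norm_scaleC norm_divide)
    also have "\<dots> \<le> action_norm row_op n B u"
      unfolding action_norm_def using m by (intro member_le_L2_set) auto
    also have "\<dots> \<le> operator_norm_via row_op B"
      by (rule action_norm_le_operator_norm_via[OF isometric_row_op B u])
    finally show ?thesis using True m by (simp add: long_op_def divide_le_eq mult.commute)
  next
    case False
    define u where "u j = (if j = 0 then unit_vec_ell2 0 else 0)" for j :: nat
    have "(\<Sum>j<n. (norm (u j))\<^sup>2) = (\<Sum>j<n. if j = 0 then 1 else 0)"
      by (intro sum.cong) (auto simp: u_def)
    then have u: "u \<in> direct_sum_ball n" using m by (simp add: direct_sum_ball_def)
    have "(\<Sum>j<n. col_op (B $$ (i, j)) (u j)) = (\<Sum>j<n. if j = 0 then B $$ (i, 0) else 0)" for i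
      by (intro sum.cong) (auto simp: u_def col_op_apply coord_unit_vec zero_ell2.rep_eq)
    then have act: "action_norm col_op n B u = L2_set (\<lambda>i. norm (B $$ (i, 0))) {..<n}"
      unfolding action_norm_def using m by (intro L2_set_cong) auto
    have "cmod (mat_pairing n W B) \<le> (\<Sum>j<m. norm (B $$ (j, 0)))"
      unfolding eq using False
      by (intro order_trans[OF norm_sum] sum_mono order_trans[OF w_le]) (simp add: line_index_def)
    also have "\<dots> \<le> L2_set (\<lambda>_. 1) {..<m} * L2_set (\<lambda>i. norm (B $$ (i, 0))) {..<m}"
      using L2_set_mult_ineq[of "\<lambda>_. 1" "\<lambda>i. norm (B $$ (i, 0))" "{..<m}"] by simp
    also have "\<dots> \<le> sqrt m * L2_set (\<lambda>i. norm (B $$ (i, 0))) {..<n}"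
      unfolding L2_set_def using m
      by (intro mult_mono real_sqrt_le_mono sum_mono2) (auto intro: sum_nonneg)
    also have "\<dots> \<le> sqrt m * operator_norm_via col_op B"
      unfolding act[symmetric]
      by (intro mult_left_mono action_norm_le_operator_norm_via[OF isometric_col_op B u]) simp
    finally show ?thesis using False by (simp add: long_op_def)
  qed
  define K\<^sub>0 K\<^sub>1 where "K\<^sub>0 = (if r then sqrt m else m)" and "K\<^sub>1 = (if r then m else sqrt m)"
  have K: "0 < K\<^sub>0" "0 < K\<^sub>1" using m by (simp_all add: K\<^sub>0_def K\<^sub>1_def)
  have "cmod (mat_pairing n W A) \<le> K\<^sub>0 powr (1 - \<theta>) * K\<^sub>1 powr \<theta> *
      interpolation_norm M (operator_norm_via row_op) M (operator_norm_via col_op) \<theta> A"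
  proof (rule mat_pairing_le_interpolation_norm[OF A \<theta> K])
    fix B assume B: "B \<in> M"
    show "cmod (mat_pairing n W B) \<le> K\<^sub>0 * operator_norm_via row_op B"
      using long[OF B] short[OF N\<^sub>0.matrix_seminorm_axioms B] by (cases r) (simp_all add: K\<^sub>0_def long_op_def)
    show "cmod (mat_pairing n W B) \<le> K\<^sub>1 * operator_norm_via col_op B"
      using long[OF B] short[OF N\<^sub>1.matrix_seminorm_axioms B] by (cases r) (simp_all add: K\<^sub>1_def long_op_def)
  qed
  moreover have "K\<^sub>0 powr (1 - \<theta>) * K\<^sub>1 powr \<theta> = m powr (1 - exponent r \<theta>)"
    using m by (auto simp: K\<^sub>0_def K\<^sub>1_def exponent_def powr_half_sqrt[symmetric] powr_powr powr_add[symmetric] field_simps)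
  moreover have "mat_pairing n W A = complex_of_real (\<Sum>j<m. norm (A $$ line_index r j))"
    by (simp add: eq w_def pair_dual_unit)
  ultimately show ?thesis
    by (simp add: mat_norm_row_column_interpolation[OF A] sum_nonneg del: of_real_sum)
qed

section \<open>Almost orthogonal differences in a bounded sequence\<close>

lemma infinite_almost_constant:
  fixes g :: "nat \<Rightarrow> complex"
  assumes I: "infinite I" and bdd: "\<And>k. cmod (g k) \<le> R" and e: "e > 0"
  obtains J where "J \<subseteq> I" "infinite J" "\<And>k l. k \<in> J \<Longrightarrow> l \<in> J \<Longrightarrow> cmod (g k - g l) \<le> e"
proof -
  have "compact (cball (0 :: complex) R)" by simp
  then have "\<exists>B. finite B \<and> cball (0 :: complex) R \<subseteq> (\<Union>x\<in>B. ball x (e / 2))"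
    using half_gt_zero[OF e] unfolding compact_eq_totally_bounded by blast
  then obtain B where B: "finite B" "cball (0 :: complex) R \<subseteq> (\<Union>x\<in>B. ball x (e / 2))"
    by blast
  have "\<forall>k\<in>I. \<exists>b\<in>B. g k \<in> ball b (e / 2)"
  proof
    fix k
    have "g k \<in> cball 0 R" using bdd[of k] by simp
    then show "\<exists>b\<in>B. g k \<in> ball b (e / 2)" using B(2) by blast
  qed
  from pigeonhole_infinite_rel[OF I B(1) this]
  obtain b where b: "infinite {k \<in> I. g k \<in> ball b (e / 2)}" by (rule bexE)
  show ?thesis
  proof (rule that[OF _ b])
    fix k l assume "k \<in> {k \<in> I. g k \<in> ball b (e / 2)}" "l \<in> {k \<in> I. g k \<in> ball b (e / 2)}"
    then have "dist b (g k) < e / 2" "dist b (g l) < e / 2" by auto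
    then have "dist (g k) (g l) < e" by (rule dist_triangle_half_r)
    then show "cmod (g k - g l) \<le> e" by (simp add: dist_norm)
  qed blast
qed

text \<open>
  A bounded sequence takes almost constant values against finitely many functionals along an infinite
  set of indices, so its differences there are almost orthogonal to the given vectors.
\<close>

lemma infinite_almost_orthogonal_to_finite:
  fixes y :: "nat \<Rightarrow> ell2"
  assumes y: "\<And>k. norm (y k) \<le> R" and e: "e > 0" and V: "finite V" and I: "infinite I"
  shows "\<exists>J\<subseteq>I. infinite J \<and> (\<forall>v\<in>V. \<forall>k\<in>J. \<forall>l\<in>J. cmod (pair (y k - y l) v) \<le> e)"
  using V
proof (induction V)
  case empty
  then show ?case using I by blast
next
  case (insert v V)
  then obtain J where J: "J \<subseteq> I" "infinite J" "\<forall>v\<in>V. \<forall>k\<in>J. \<forall>l\<in>J. cmod (pair (y k - y l) v) \<le> e"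
    by blast
  have bdd: "cmod (pair (y k) v) \<le> R * norm v" for k
    using norm_pair_le[of "y k" v] mult_right_mono[OF y norm_ge_zero] by (rule order_trans)
  obtain J' where J': "J' \<subseteq> J" "infinite J'"
    "\<And>k l. k \<in> J' \<Longrightarrow> l \<in> J' \<Longrightarrow> cmod (pair (y k) v - pair (y l) v) \<le> e"
    using infinite_almost_constant[where g = "\<lambda>k. pair (y k) v", OF J(2) bdd e] by blast
  show ?case
  proof (intro exI[of _ J'] conjI ballI)
    fix w k l assume "w \<in> insert v V" "k \<in> J'" "l \<in> J'"
    then show "cmod (pair (y k - y l) w) \<le> e"
      using J(3) J'(1,3) by (auto simp: pair_diff_left)
  qed (use J J' in auto)
qed

text \<open>
  The differences are chosen one after another, each almost orthogonal to the previous ones and with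
  indices not used before. This replaces the extraction of a weakly convergent subsequence.
\<close>

lemma almost_orthogonal_differences:
  fixes y :: "nat \<Rightarrow> ell2" and K :: nat
  assumes y: "\<And>k. norm (y k) \<le> R" and e: "e > 0"
    and close: "\<And>J. infinite J \<Longrightarrow> \<exists>k\<in>J. \<exists>l\<in>J. k \<noteq> l \<and> norm (y k - y l) \<le> c"
  shows "\<exists>p q. inj_on p {..<K} \<and> inj_on q {..<K} \<and>
    (\<forall>j<K. p j \<noteq> q j \<and> norm (y (p j) - y (q j)) \<le> c) \<and>
    (\<forall>i<K. \<forall>j<K. i \<noteq> j \<longrightarrow>
      cmod (pair (y (p i) - y (q i)) (cnj_ell2 (y (p j) - y (q j)))) \<le> e)"
proof (induction K)
  case 0
  then show ?case by simp
next
  case (Suc K)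
  then obtain p q where pq: "inj_on p {..<K}" "inj_on q {..<K}"
    "\<And>j. j < K \<Longrightarrow> p j \<noteq> q j \<and> norm (y (p j) - y (q j)) \<le> c"
    "\<And>i j. i < K \<Longrightarrow> j < K \<Longrightarrow> i \<noteq> j \<Longrightarrow>
      cmod (pair (y (p i) - y (q i)) (cnj_ell2 (y (p j) - y (q j)))) \<le> e" by blast
  let ?I = "UNIV - (p ` {..<K} \<union> q ` {..<K})"
  have "infinite ?I" by (intro Diff_infinite_finite) auto
  from infinite_almost_orthogonal_to_finite[where y = y, OF y e finite_imageI[OF finite_lessThan] this,
      of "\<lambda>j. cnj_ell2 (y (p j) - y (q j))" K]
  obtain J where J: "J \<subseteq> ?I" "infinite J"
    and J_orth: "\<forall>v\<in>(\<lambda>j. cnj_ell2 (y (p j) - y (q j))) ` {..<K}.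
      \<forall>k\<in>J. \<forall>l\<in>J. cmod (pair (y k - y l) v) \<le> e"
    by metis
  obtain k l where kl: "k \<in> J" "l \<in> J" "k \<noteq> l" "norm (y k - y l) \<le> c"
    using close[OF J(2)] by blast
  have new: "cmod (pair (y k - y l) (cnj_ell2 (y (p j) - y (q j)))) \<le> e"
    "cmod (pair (y (p j) - y (q j)) (cnj_ell2 (y k - y l))) \<le> e" if "j < K" for j
  proof -
    show 1: "cmod (pair (y k - y l) (cnj_ell2 (y (p j) - y (q j)))) \<le> e"
      using J_orth that kl(1,2) by simp
    then show "cmod (pair (y (p j) - y (q j)) (cnj_ell2 (y k - y l))) \<le> e"
      by (simp add: pair_cnj_swap[of "y (p j) - y (q j)"])
  qed
  have kl_new: "k \<notin> p ` {..<K}" "l \<notin> q ` {..<K}" using kl J(1) by auto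
  show ?case
  proof (rule exI[of _ "p(K := k)"], rule exI[of _ "q(K := l)"], intro conjI allI impI)
    show "inj_on (p(K := k)) {..<Suc K}" "inj_on (q(K := l)) {..<Suc K}"
      using pq(1,2) kl_new by (auto simp: lessThan_Suc inj_on_def)
  next
    fix j assume "j < Suc K"
    then show "(p(K := k)) j \<noteq> (q(K := l)) j" "norm (y ((p(K := k)) j) - y ((q(K := l)) j)) \<le> c"
      using pq(3)[of j] kl by (auto simp: less_Suc_eq)
  next
    fix i j assume "i < Suc K" "j < Suc K" "i \<noteq> j"
    then show "cmod (pair (y ((p(K := k)) i) - y ((q(K := l)) i))
        (cnj_ell2 (y ((p(K := k)) j) - y ((q(K := l)) j)))) \<le> e"
      using pq(4)[of i j] new by (auto simp: less_Suc_eq)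
  qed
qed

section \<open>Spherical amplifications on lines of basis vectors\<close>

definition basis_line :: "nat \<Rightarrow> real \<Rightarrow> (nat \<Rightarrow> nat) \<Rightarrow> nat \<Rightarrow> ell2"
  where "basis_line m s p j = (if j < m then s *\<^sub>R unit_vec_ell2 (p j) else 0)"

lemma almost_orthogonal_basis_line:
  assumes "inj_on p {..<m}" "0 \<le> s"
  shows "almost_orthogonal m s (basis_line m s p)"
proof -
  have "pair (basis_line m s p i) (cnj_ell2 (basis_line m s p j)) = 0"
    if "i < m" "j < m" "i \<noteq> j" for i j
  proof -
    have "p i \<noteq> p j" using that assms(1) by (auto simp: inj_on_def)
    then show ?thesis
      using that by (simp add: basis_line_def cnj_ell2_scaleR pair_scaleR_right coord_scaleR coord_unit_vec)
  qed
  then show ?thesis using assms(2) by (auto simp: almost_orthogonal_def basis_line_def)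
qed

lemma norm_basis_diff:
  assumes "i \<noteq> j"
  shows "norm (unit_vec_ell2 i - unit_vec_ell2 j) = sqrt 2"
proof -
  let ?d = "unit_vec_ell2 i - unit_vec_ell2 j"
  have "pair ?d (cnj_ell2 ?d) = complex_of_real 2"
    using assms by (simp add: cnj_ell2_diff pair_diff_right minus_ell2.rep_eq coord_unit_vec)
  then have "(norm ?d)\<^sup>2 = 2"
    unfolding norm_eq_pair of_real_eq_iff .
  then show ?thesis by (metis norm_ge_zero real_sqrt_unique)
qed

lemma almost_orthogonal_basis_line_diff:
  assumes "inj_on p {..<m}" "inj_on q {..<m}" "\<And>i j. i < m \<Longrightarrow> j < m \<Longrightarrow> p i \<noteq> q j" "0 \<le> s"
  shows "almost_orthogonal m (sqrt 2 * s) (\<lambda>j. basis_line m s p j - basis_line m s q j)"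
proof -
  have eq: "basis_line m s p j - basis_line m s q j = s *\<^sub>R (unit_vec_ell2 (p j) - unit_vec_ell2 (q j))"
    if "j < m" for j
    using that by (simp add: basis_line_def scaleR_diff_right)
  have "pair (basis_line m s p i - basis_line m s q i) (cnj_ell2 (basis_line m s p j - basis_line m s q j)) = 0"
    if "i < m" "j < m" "i \<noteq> j" for i j
  proof -
    have "p i \<noteq> p j" "q i \<noteq> q j" "p i \<noteq> q j" "p j \<noteq> q i"
      using that assms by (auto simp: inj_on_def)
    then show ?thesis
      unfolding eq[OF that(1)] eq[OF that(2)]
      by (simp add: cnj_ell2_scaleR cnj_ell2_diff pair_scaleR_right pair_diff_right
          coord_scaleR minus_ell2.rep_eq coord_unit_vec)
  qed
  moreover have "norm (basis_line m s p j - basis_line m s q j) \<le> sqrt 2 * s" if "j < m" for j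
    using assms(3)[OF that that] assms(4) by (simp add: eq[OF that] norm_basis_diff)
  ultimately show ?thesis by (auto simp: almost_orthogonal_def basis_line_def)
qed

lemma line_corner_diff:
  "line_corner r n z v - line_corner r n z' v' = line_corner r n (\<lambda>j. z j - z' j :: ell2) (v - v')"
  by (rule eq_matI) (auto simp: line_corner_def)

lemma map_line_corner_diff:
  fixes f :: "'a::zero \<Rightarrow> ell2"
  shows "map_mat f (line_corner r n z v) - map_mat f (line_corner r n z' v)
    = line_corner r n (\<lambda>j. f (z j) - f (z' j)) 0"
  by (rule eq_matI) (auto simp: line_corner_def)

lemma line_corner_index:
  assumes "j < n"
  shows "line_corner r n z v $$ line_index r j = z j"
  using assms by (auto simp: line_corner_def line_index_def)

text \<open>
  A spherical amplification may use a different map on every sphere. The corner entry of norm \<open>r\<close>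
  places all lines of norm at most \<open>r\<close>, rows and columns alike, on the sphere of radius \<open>r\<close>, where
  one map \<open>f\<close> serves for all of them.
\<close>

lemma spherical_amplification_basis_lines:
  fixes r :: real
  assumes F: "spherical_amplification (Suc n) (row_column_interpolation \<theta>) Y F"
    and \<theta>: "\<theta> \<in> {0..1}" and r: "0 < r"
  obtains f where "\<And>l m p s. 0 < m \<Longrightarrow> m \<le> n \<Longrightarrow> inj_on p {..<m} \<Longrightarrow> 0 \<le> s \<Longrightarrow>
    sqrt 2 * s * m powr exponent l \<theta> \<le> r \<Longrightarrow>
    F (line_corner l n (basis_line m s p) (r *\<^sub>R unit_vec_ell2 0))
      = map_mat f (line_corner l n (basis_line m s p) (r *\<^sub>R unit_vec_ell2 0))"
proof -
  let ?X = "row_column_interpolation \<theta>"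
  obtain f where f: "\<And>A. A \<in> map_mat (scaleR r) ` mat_unit_sphere (Suc n) ?X \<Longrightarrow> F A = map_mat f A"
    using F r unfolding spherical_amplification_def by (meson less_imp_le)
  show ?thesis
  proof (rule that[OF f])
    fix l and m :: nat and p :: "nat \<Rightarrow> nat" and s :: real
    assume m: "0 < m" "m \<le> n" and p: "inj_on p {..<m}" and s: "0 \<le> s"
      and small: "sqrt 2 * s * m powr exponent l \<theta> \<le> r"
    let ?B = "line_corner l n (basis_line m (s / r) p) (unit_vec_ell2 0)"
    have "mat_norm ?X ?B \<le> max (sqrt 2 * (s / r) * m powr exponent l \<theta>) (norm (unit_vec_ell2 0))"
      using almost_orthogonal_basis_line[OF p] s r m \<theta> by (intro mat_norm_line_corner_le) auto
    also have "\<dots> \<le> 1" using small r by (simp add: divide_le_eq)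
    finally have "mat_norm ?X ?B \<le> 1" .
    moreover have "1 \<le> mat_norm ?X ?B"
      using entry_le_mat_norm[of ?B "Suc n" n n \<theta>] \<theta> by (simp add: line_corner_def)
    ultimately have "?B \<in> mat_unit_sphere (Suc n) ?X"
      by (simp add: mat_unit_sphere_def points_row_column_interpolation matrices_UNIV)
    moreover have "line_corner l n (basis_line m s p) (r *\<^sub>R unit_vec_ell2 0) = map_mat (scaleR r) ?B"
      using r by (intro eq_matI) (auto simp: line_corner_def basis_line_def)
    ultimately show "line_corner l n (basis_line m s p) (r *\<^sub>R unit_vec_ell2 0)
        \<in> map_mat (scaleR r) ` mat_unit_sphere (Suc n) ?X" by blast
  qed
qed

section \<open>The row and column spaces of different parameters\<close>

lemma equi_coarse_embeddingsD:
  assumes "equi_coarse_embeddings I A d B d' F"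
  shows "0 \<le> t \<Longrightarrow> \<exists>W. \<forall>n\<in>I. \<forall>x\<in>A n. \<forall>y\<in>A n. d n x y \<le> t \<longrightarrow> d' n (F n x) (F n y) \<le> W"
    and "\<exists>t\<ge>t\<^sub>0. \<forall>n\<in>I. \<forall>x\<in>A n. \<forall>y\<in>A n. t \<le> d n x y \<longrightarrow> K \<le> d' n (F n x) (F n y)"
proof -
  assume "0 \<le> t"
  then have "expansion_modulus I A d d' F t \<noteq> \<infinity>"
    using assms unfolding equi_coarse_embeddings_def by auto
  then obtain W :: nat where W: "expansion_modulus I A d d' F t < ereal (real W)"
    using less_PInf_Ex_of_nat by auto
  have "d' n (F n x) (F n y) \<le> W" if "n \<in> I" "x \<in> A n" "y \<in> A n" "d n x y \<le> t" for n x y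
  proof -
    have "ereal (d' n (F n x) (F n y)) \<le> expansion_modulus I A d d' F t"
      unfolding expansion_modulus_def using that by (intro SUP_upper2[OF that(1)] Sup_upper) blast
    then have "ereal (d' n (F n x) (F n y)) < ereal (real W)" using W by (rule le_less_trans)
    then show ?thesis by simp
  qed
  then show "\<exists>W. \<forall>n\<in>I. \<forall>x\<in>A n. \<forall>y\<in>A n. d n x y \<le> t \<longrightarrow> d' n (F n x) (F n y) \<le> W" by blast
next
  have "(compression_modulus I A d d' F \<longlongrightarrow> \<infinity>) at_top"
    using assms unfolding equi_coarse_embeddings_def by blast
  then have "\<forall>\<^sub>F t in at_top. ereal K < compression_modulus I A d d' F t"
    unfolding tendsto_PInfty by blast
  then obtain t where t: "t \<ge> t\<^sub>0" "ereal K < compression_modulus I A d d' F t"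
    unfolding eventually_at_top_linorder by (metis max.cobounded1 max.cobounded2)
  have "K \<le> d' n (F n x) (F n y)" if "n \<in> I" "x \<in> A n" "y \<in> A n" "t \<le> d n x y" for n x y
  proof -
    have "compression_modulus I A d d' F t \<le> ereal (d' n (F n x) (F n y))"
      unfolding compression_modulus_def using that by (intro INF_lower2[OF that(1)] Inf_lower) blast
    with t(2) have "ereal K < ereal (d' n (F n x) (F n y))" by (rule less_le_trans)
    then show ?thesis by simp
  qed
  then show "\<exists>t\<ge>t\<^sub>0. \<forall>n\<in>I. \<forall>x\<in>A n. \<forall>y\<in>A n. t \<le> d n x y \<longrightarrow> K \<le> d' n (F n x) (F n y)"
    using t(1) by blast
qed

text \<open>
  The first inequality asks for \<open>k\<close> about \<open>(t * m powr a) powr (1 / (1 / 2 - a))\<close>. With this \<open>k\<close>, the left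
  side of the second one is a constant times \<open>m powr (- d)\<close> with \<open>d = (b - a) / (1 - 2 * a)\<close>, which is
  positive because \<open>a < b\<close>; so a large \<open>m\<close> works.
\<close>

lemma exists_line_lengths:
  fixes a b t W :: real
  assumes a: "0 \<le> a" "a < b" "b \<le> 1 / 2" and t: "1 \<le> t" and W: "1 \<le> W"
  obtains m k :: nat where "0 < m" "0 < k" "t * m powr a \<le> k powr (1 / 2 - a)"
    "sqrt 2 * (W * m powr - b) * k powr (1 / 2 - b) < 1"
proof -
  define a' b' where "a' = 1 / 2 - a" and "b' = 1 / 2 - b"
  have a': "0 < a'" and b': "0 \<le> b'" using a by (simp_all add: a'_def b'_def)
  define C where "C = sqrt 2 * W * 2 powr b' * t powr (b' / a')"
  define d where "d = b - a * b' / a'"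
  have "d = (b - a) / 2 / a'"
    using a' by (simp add: d_def a'_def b'_def field_simps)
  then have d: "0 < d" using a a' by simp
  have "(\<lambda>m. C * real m powr - d) \<longlonglongrightarrow> C * 0"
    using d by (intro tendsto_mult tendsto_const tendsto_neg_powr filterlim_real_sequentially) simp
  then have "\<forall>\<^sub>F m in sequentially. C * real m powr - d < 1"
    by (auto dest: order_tendstoD(2)[of _ 0 _ 1])
  then obtain m :: nat where m: "0 < m" "C * real m powr - d < 1"
    using eventually_happens[OF eventually_conj[OF _ eventually_gt_at_top[of 0]]] by auto
  define x where "x = (t * m powr a) powr (1 / a')"
  have tm: "1 \<le> t * m powr a"
    using t m a mult_mono[of 1 t 1 "m powr a"] by (simp add: ge_one_powr_ge_zero)
  then have x1: "1 \<le> x" using a' by (simp add: x_def ge_one_powr_ge_zero)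
  define k where "k = nat \<lceil>x\<rceil>"
  have kx: "x \<le> k" "k \<le> 2 * x" using x1 by (simp_all add: k_def) linarith+
  have k: "0 < k" using x1 kx by (cases k) auto
  show ?thesis
  proof (rule that[OF m(1) k])
    have "t * m powr a = x powr a'"
      using tm a' by (simp add: x_def powr_powr)
    also have "\<dots> \<le> k powr a'" using kx x1 a' by (intro powr_mono2) auto
    finally show "t * m powr a \<le> k powr (1 / 2 - a)" by (simp add: a'_def)
    have "k powr b' \<le> (2 * x) powr b'" using kx b' by (intro powr_mono2) auto
    also have "\<dots> = 2 powr b' * (t powr (b' / a') * m powr (a * b' / a'))"
      using x1 tm t by (simp add: powr_mult x_def powr_powr)
    finally have "sqrt 2 * (W * m powr - b) * k powr b'
        \<le> sqrt 2 * (W * m powr - b) * (2 powr b' * (t powr (b' / a') * m powr (a * b' / a')))"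
      using W by (intro mult_left_mono) auto
    also have "\<dots> = C * (m powr - b * m powr (a * b' / a'))"
      by (simp add: C_def)
    also have "m powr - b * m powr (a * b' / a') = m powr - d"
      by (simp add: d_def powr_add[symmetric])
    finally show "sqrt 2 * (W * m powr - b) * k powr (1 / 2 - b) < 1"
      using m(2) by (simp add: b'_def)
  qed
qed

theorem corollary1p10:
  fixes \<theta> \<gamma> :: real
  assumes "\<theta> \<in> {0..1}" and "\<gamma> \<in> {0..1}" and "\<theta> \<noteq> \<gamma>"
  shows "\<not> spherically_completely_coarsely_embeds
    (row_column_interpolation \<theta>) (row_column_interpolation \<gamma>)"
proof
  let ?X = "row_column_interpolation \<theta>" and ?Y = "row_column_interpolation \<gamma>"
  assume "spherically_completely_coarsely_embeds ?X ?Y"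
  then obtain F where F: "\<And>n. n \<ge> 1 \<Longrightarrow> spherical_amplification n ?X ?Y (F n)"
    and coarse: "equi_coarse_embeddings {1..} (\<lambda>n. carrier_mat n n) (\<lambda>n. mat_dist ?X)
        (\<lambda>n. carrier_mat n n) (\<lambda>n. mat_dist ?Y) F"
    unfolding spherically_completely_coarsely_embeds_def points_row_column_interpolation matrices_UNIV
    by blast
  obtain W\<^sub>0 where W\<^sub>0: "\<And>n A B. n \<ge> 1 \<Longrightarrow> A \<in> carrier_mat n n \<Longrightarrow> B \<in> carrier_mat n n \<Longrightarrow>
      mat_dist ?X A B \<le> 2 \<Longrightarrow> mat_dist ?Y (F n A) (F n B) \<le> W\<^sub>0"
    using equi_coarse_embeddingsD(1)[OF coarse, of 2] by auto
  define W where "W = max 1 W\<^sub>0"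
  obtain t where t: "t \<ge> 1" "\<And>n A B. n \<ge> 1 \<Longrightarrow> A \<in> carrier_mat n n \<Longrightarrow> B \<in> carrier_mat n n \<Longrightarrow>
      t \<le> mat_dist ?X A B \<Longrightarrow> 1 \<le> mat_dist ?Y (F n A) (F n B)"
    using equi_coarse_embeddingsD(2)[OF coarse, of 1 1] by auto
  \<comment> \<open>The direction in which the exponent of the source is the smaller one.\<close>
  define r where "r = (\<gamma> < \<theta>)"
  define a b where "a = exponent r \<theta>" and "b = exponent r \<gamma>"
  have ab: "0 \<le> a" "a < b" "b \<le> 1 / 2"
    using assms by (auto simp: a_def b_def r_def exponent_def)
  have dual: "exponent (\<not> r) \<theta> = 1 / 2 - a" "exponent (\<not> r) \<gamma> = 1 / 2 - b"
    by (auto simp: a_def b_def exponent_def field_simps)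
  have W1: "1 \<le> W" by (simp add: W_def)
  obtain m k :: nat where mk: "0 < m" "0 < k" and long: "t * m powr a \<le> k powr (1 / 2 - a)"
    and short: "sqrt 2 * (W * m powr - b) * k powr (1 / 2 - b) < 1"
    by (rule exists_line_lengths[OF ab t(1) W1])
  define n where "n = max m k"
  \<comment> \<open>Scaled by \<open>s\<close>, lines of length \<open>m\<close> in the direction \<open>r\<close> stay at bounded distance from each other.\<close>
  define s where "s = m powr - a"
  define c where "c = W * m powr - b"
  \<comment> \<open>Large enough for both kinds of lines used below.\<close>
  define \<rho> where "\<rho> = sqrt 2 * s * m powr a + sqrt 2 * s * k powr (1 / 2 - a)"
  have pos: "0 < s" "0 < c" "0 < \<rho>"
    using mk W1 by (simp_all add: s_def c_def \<rho>_def add_pos_pos)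
  have sm: "s * m powr a = 1" using mk by (simp add: s_def powr_minus)
  let ?v = "\<rho> *\<^sub>R unit_vec_ell2 0"
  obtain f where f: "\<And>l m p s. 0 < m \<Longrightarrow> m \<le> n \<Longrightarrow> inj_on p {..<m} \<Longrightarrow> 0 \<le> s \<Longrightarrow>
    sqrt 2 * s * m powr exponent l \<theta> \<le> \<rho> \<Longrightarrow>
    F (Suc n) (line_corner l n (basis_line m s p) ?v) = map_mat f (line_corner l n (basis_line m s p) ?v)"
    by (rule spherical_amplification_basis_lines[OF F assms(1) pos(3), of n]) simp_all
  define y where "y k = f (s *\<^sub>R unit_vec_ell2 k)" for k
  have fm: "F (Suc n) (line_corner r n (basis_line m s p) ?v) = map_mat f (line_corner r n (basis_line m s p) ?v)"
    if "inj_on p {..<m}" for p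
    using mk pos that by (intro f) (simp_all add: n_def \<rho>_def a_def[symmetric])
  have fk: "F (Suc n) (line_corner (\<not> r) n (basis_line k s p) ?v)
      = map_mat f (line_corner (\<not> r) n (basis_line k s p) ?v)"
    if "inj_on p {..<k}" for p
    using mk pos that by (intro f) (simp_all add: n_def \<rho>_def dual)
  have lines: "(\<lambda>j. f (basis_line l s p j) - f (basis_line l s q j))
      = (\<lambda>j. if j < l then y (p j) - y (q j) else 0)" for l p q
    by (auto simp: basis_line_def y_def)
  \<comment> \<open>The expansion bound in the direction \<open>r\<close>: the differences of images of basis vectors have
    average norm at most \<open>c\<close>.\<close>
  have sum_le: "(\<Sum>j<m. norm (y (p j) - y (q j))) \<le> m * c"
    if pq: "inj_on p {..<m}" "inj_on q {..<m}" "\<And>i j. i < m \<Longrightarrow> j < m \<Longrightarrow> p i \<noteq> q j" for p q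
  proof -
    let ?A = "\<lambda>p. line_corner r n (basis_line m s p) ?v"
    have "mat_dist ?X (?A p) (?A q) \<le> max (sqrt 2 * (sqrt 2 * s) * m powr exponent r \<theta>) (norm (0 :: ell2))"
      unfolding mat_dist_def line_corner_diff diff_self
      using almost_orthogonal_basis_line_diff[OF pq] pos mk assms(1)
      by (intro mat_norm_line_corner_le) (auto simp: n_def)
    also have "\<dots> = 2"
      using sm by (simp add: a_def[symmetric] mult.assoc)
    finally have "mat_dist ?Y (F (Suc n) (?A p)) (F (Suc n) (?A q)) \<le> W\<^sub>0"
      by (intro W\<^sub>0) simp_all
    then have le: "mat_norm ?Y (line_corner r n (\<lambda>j. if j < m then y (p j) - y (q j) else 0) 0) \<le> W"
      by (simp add: fm pq mat_dist_def map_line_corner_diff lines W_def)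
    have "(\<Sum>j<m. norm (y (p j) - y (q j)))
      = (\<Sum>j<m. norm (line_corner r n (\<lambda>j. if j < m then y (p j) - y (q j) else 0) 0 $$ line_index r j))"
      by (intro sum.cong refl) (simp add: line_corner_index n_def)
    also have "\<dots> \<le> m powr (1 - exponent r \<gamma>)
        * mat_norm ?Y (line_corner r n (\<lambda>j. if j < m then y (p j) - y (q j) else 0) 0)"
      using mk assms(2) by (intro line_le_mat_norm[where n = "Suc n"]) (simp_all add: n_def)
    also have "\<dots> \<le> m powr (1 - b) * W"
      unfolding b_def using le by (intro mult_left_mono) auto
    also have "\<dots> = m * c"
      using mk by (simp add: c_def powr_diff powr_minus divide_inverse)
    finally show ?thesis .
  qed
  have close: "\<exists>i\<in>J. \<exists>j\<in>J. i \<noteq> j \<and> norm (y i - y j) \<le> c" if J: "infinite J" for J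
  proof (rule ccontr)
    assume neg: "\<not> ?thesis"
    let ?p = "\<lambda>j. enumerate J (2 * j)" and ?q = "\<lambda>j. enumerate J (Suc (2 * j))"
    have inj: "enumerate J i = enumerate J j \<longleftrightarrow> i = j" for i j
      using strict_mono_eq[OF strict_mono_enumerate[OF J]] .
    have ne: "2 * i \<noteq> Suc (2 * j)" for i j :: nat by presburger
    have "(\<Sum>j<m. c) < (\<Sum>j<m. norm (y (?p j) - y (?q j)))"
    proof (rule sum_strict_mono)
      fix j
      have "?p j \<in> J" "?q j \<in> J" "?p j \<noteq> ?q j"
        using J ne by (simp_all add: enumerate_in_set inj)
      then show "c < norm (y (?p j) - y (?q j))" using neg by force
    qed (use mk in auto)
    moreover have "(\<Sum>j<m. norm (y (?p j) - y (?q j))) \<le> m * c"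
      using ne by (intro sum_le) (simp_all add: inj_on_def inj)
    ultimately show False by simp
  qed
  \<comment> \<open>The pair \<open>(i, 0)\<close> is completed to a family of \<open>m\<close> disjoint pairs.\<close>
  have y_bdd: "norm (y i) \<le> norm (y 0) + m * c" for i
  proof (cases "i = 0")
    case False
    let ?p = "\<lambda>j. i + 2 * j" and ?q = "\<lambda>j. if j = 0 then 0 else Suc (i + 2 * j)"
    have "?p l \<noteq> ?q j" for l j using False by (auto; presburger)
    then have "(\<Sum>j<m. norm (y (?p j) - y (?q j))) \<le> m * c"
      by (intro sum_le) (auto simp: inj_on_def)
    moreover have "norm (y (?p 0) - y (?q 0)) \<le> (\<Sum>j<m. norm (y (?p j) - y (?q j)))"
      using mk by (intro member_le_sum[of 0 "{..<m}" "\<lambda>j. norm (y (?p j) - y (?q j))"]) auto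
    ultimately have "norm (y i - y 0) \<le> m * c" by simp
    then show ?thesis using norm_triangle_sub[of "y i" "y 0"] by linarith
  qed (use pos in simp)
  have "0 < c\<^sup>2 / k" using pos mk by simp
  from almost_orthogonal_differences[OF y_bdd this close, of k]
  obtain p q where pq: "inj_on p {..<k}" "inj_on q {..<k}"
    and pqj: "\<And>j. j < k \<Longrightarrow> p j \<noteq> q j" "\<And>j. j < k \<Longrightarrow> norm (y (p j) - y (q j)) \<le> c"
    and orth: "\<And>i j. i < k \<Longrightarrow> j < k \<Longrightarrow> i \<noteq> j \<Longrightarrow>
      cmod (pair (y (p i) - y (q i)) (cnj_ell2 (y (p j) - y (q j)))) \<le> c\<^sup>2 / k"
    by blast
  let ?B = "\<lambda>p. line_corner (\<not> r) n (basis_line k s p) ?v"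
  let ?D = "\<lambda>j. basis_line k s p j - basis_line k s q j"
  \<comment> \<open>In the other direction the same basis vectors give far apart columns or rows, whose images are
    close because their differences are short and almost orthogonal.\<close>
  have "t \<le> mat_dist ?X (?B p) (?B q)"
  proof -
    have norm_D: "s \<le> norm (line_corner (\<not> r) n ?D 0 $$ line_index (\<not> r) j)" if "j < k" for j
    proof -
      have "norm (?D j) = s * sqrt 2"
        using that pos norm_basis_diff[OF pqj(1)[OF that]]
        by (simp add: basis_line_def scaleR_diff_right[symmetric])
      then show ?thesis using that pos by (simp add: line_corner_index n_def)
    qed
    have "t = s * (t * m powr a)"
      using sm by (metis mult.left_commute mult.right_neutral)
    also have "\<dots> \<le> s * k powr (1 / 2 - a)"
      using long pos by (intro mult_left_mono) auto
    finally have ts: "t \<le> s * k powr (1 / 2 - a)" .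
    have "k powr (1 - (1 / 2 - a)) * (s * k powr (1 / 2 - a)) = (\<Sum>j<k. s)"
      using mk by (simp add: powr_add[symmetric] mult.left_commute)
    also have "\<dots> \<le> (\<Sum>j<k. norm (line_corner (\<not> r) n ?D 0 $$ line_index (\<not> r) j))"
      using norm_D by (intro sum_mono) auto
    also have "\<dots> \<le> k powr (1 - (1 / 2 - a)) * mat_norm ?X (line_corner (\<not> r) n ?D 0)"
      unfolding dual[symmetric] using mk assms(1)
      by (intro line_le_mat_norm[where n = "Suc n"]) (simp_all add: n_def)
    finally have "s * k powr (1 / 2 - a) \<le> mat_norm ?X (line_corner (\<not> r) n ?D 0)"
      using mk by simp
    then show ?thesis using ts by (simp add: mat_dist_def line_corner_diff)
  qed
  then have "1 \<le> mat_dist ?Y (F (Suc n) (?B p)) (F (Suc n) (?B q))"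
    by (intro t(2)) simp_all
  also have "\<dots> = mat_norm ?Y (line_corner (\<not> r) n (\<lambda>j. if j < k then y (p j) - y (q j) else 0) 0)"
    by (simp add: fk pq mat_dist_def map_line_corner_diff lines)
  also have "\<dots> \<le> max (sqrt 2 * c * k powr exponent (\<not> r) \<gamma>) (norm (0 :: ell2))"
    using pqj(2) orth mk assms(2)
    by (intro mat_norm_line_corner_le) (auto simp: n_def almost_orthogonal_def)
  also have "\<dots> < 1" using short by (simp add: dual c_def)
  finally show False by simp
qed

end
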